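(* Let $\boldsymbol{X}=\boldsymbol{V}_h\times Q_h$, $\zeta=\sqrt{\lambda+2\mu/d}$, and let $$\mathcal{A}=\begin{pmatrix}A_{\boldsymbol{u}}&\alpha B^T\\-\alpha B&\tau A_p+\eta h^2L_p\end{pmatrix},\quad \mathcal{B}_U=\begin{pmatrix}A_{\boldsymbol{u}}&\alpha B^T\\0&\tau A_p+\eta h^2L_p+\frac{\alpha^2}{\zeta^2}M\end{pmatrix}^{-1},\quad \mathcal{B}_D=\begin{pmatrix}A_{\boldsymbol{u}}&0\\0&\tau A_p+\eta h^2L_p+\frac{\alpha^2}{\zeta^2}M\end{pmatrix}^{-1}.$$ Suppose that $\eta=\delta\frac{\alpha^2}{\zeta^2}$ with $\delta>0$. Then there exist positive constants $\Sigma$ and $\Upsilon$, independent of discretization or physical parameters, such that, for any $\boldsymbol{0}\ne\boldsymbol{x}'\in\boldsymbol{X}'$, $$\Sigma\le\frac{(\mathcal{A}\mathcal{B}_U\boldsymbol{x}',\boldsymbol{x}')_{\mathcal{B}_D}}{(\boldsymbol{x}',\boldsymbol{x}')_{\mathcal{B}_D}},\qquad \frac{\|\mathcal{A}\mathcal{B}_U\boldsymbol{x}'\|_{\mathcal{B}_D}}{\|\boldsymbol{x}'\|_{\mathcal{B}_D}}\le\Upsilon.$$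
   Context: Setting. $\Omega\subset\mathbb{R}^d$, $d\in\{2,3\}$, is a bounded open set with regular boundary. Physical parameters: Lamé coefficients $\lambda\ge 0$, $\mu>0$; Biot–Willis constant $\alpha>0$; hydraulic conductivity $K>0$. Discretization parameters: mesh size $h>0$, time step size $\tau>0$. $(\cdot,\cdot)$ and $\|\cdot\|$ are the $L^2(\Omega)$ inner product and norm (also used for the duality pairing between a finite-dimensional space and its dual), $\|\cdot\|_1$ is the $H^1(\Omega)$ norm, and $\varepsilon(\boldsymbol{u})=\frac12(\nabla\boldsymbol{u}+\nabla\boldsymbol{u}^t)$. Bilinear forms: $a(\boldsymbol{u},\boldsymbol{v})=2\mu\int_\Omega\varepsilon(\boldsymbol{u}):\varepsilon(\boldsymbol{v})+\lambda\int_\Omega\operatorname{div}\boldsymbol{u}\,\operatorname{div}\boldsymbol{v}$ and $a_p(p,q)=\int_\Omega K\nabla p\cdot\nabla q$. Finite-element spaces: $\boldsymbol{V}_h\subset\boldsymbol{H}^1_0(\Omega)=H_0^1(\Omega)^d$ and $Q_h\subset H^1_0(\Omega)$ are the finite-element spaces for displacement and pressure given by the $\mathbb{P}_1$-$\mathbb{P}_1$ pair or the Mini element on a mesh of size $h$. The pair is taken to satisfy the weak inf-sup condition $$\sup_{0\ne\boldsymbol{v}\in\boldsymbol{V}_h}\frac{(\operatorname{div}\boldsymbol{v},q)}{\|\boldsymbol{v}\|_1}\ge\gamma_B^0\|q\|-\xi^0h\|\nabla q\|\qquad\text{for all }q\in Q_h,$$ with constants $\gamma_B^0>0$, $\xi^0\ge0$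 that do not depend on $h$ ($\xi^0=0$ for the Mini element). Discrete operators: $A_{\boldsymbol{u}}:\boldsymbol{V}_h\to\boldsymbol{V}_h'$, $B:\boldsymbol{V}_h\to Q_h'$, $A_p,L_p,M:Q_h\to Q_h'$ are defined by $(A_{\boldsymbol{u}}\boldsymbol{u},\boldsymbol{v})=a(\boldsymbol{u},\boldsymbol{v})$, $(B\boldsymbol{u},q)=-(\operatorname{div}\boldsymbol{u},q)$, $(A_pp,q)=a_p(p,q)$, $(L_pp,q)=(\nabla p,\nabla q)$, $(Mp,q)=\int_\Omega pq$ (pressure mass operator); $B^T:Q_h\to\boldsymbol{V}_h'$ is the adjoint of $B$. Here $\mathcal{A}:\boldsymbol{X}\to\boldsymbol{X}'$ is the operator of the stabilized discrete Biot system with its second equation negated, and $\eta$ is the stabilization parameter. Inner product on the dual: for symmetric positive definite $\mathcal{N}:\boldsymbol{X}'\to\boldsymbol{X}$, $(\boldsymbol{x}',\boldsymbol{y}')_{\mathcal{N}}=\langle\boldsymbol{x}',\mathcal{N}\boldsymbol{y}'\rangle$ and $\|\boldsymbol{x}'\|_{\mathcal{N}}^2=(\boldsymbol{x}',\boldsymbol{x}')_{\mathcal{N}}$ for $\boldsymbol{x}',\boldsymbol{y}'\in\boldsymbol{X}'$. "Independent of discretization or physical parameters" means independent of $\lambda,\mu,K,\alpha,h,\tau$; the constants may depend on $d,\gamma_B^0,\xi^0,\delta$. *)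

theory Defs
  imports "HOL-Analysis.Analysis"
begin

section \<open>Sobolev spaces\<close>

definition l2_inner :: "(real^'n) set \<Rightarrow> (real^'n \<Rightarrow> 'b::euclidean_space) \<Rightarrow> (real^'n \<Rightarrow> 'b) \<Rightarrow> real"
  where "l2_inner \<Omega> f g = (LINT x:\<Omega>|lebesgue. f x \<bullet> g x)"

definition l2_norm :: "(real^'n) set \<Rightarrow> (real^'n \<Rightarrow> 'b::euclidean_space) \<Rightarrow> real"
  where "l2_norm \<Omega> f = sqrt (l2_inner \<Omega> f f)"

definition L2 :: "(real^'n) set \<Rightarrow> (real^'n \<Rightarrow> real) set"
  where "L2 \<Omega> = {f. set_borel_measurable lebesgue \<Omega> f \<and> set_integrable lebesgue \<Omega> (\<lambda>x. (f x)\<^sup>2)}"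

definition pderiv_at :: "'n \<Rightarrow> (real^'n \<Rightarrow> real) \<Rightarrow> real^'n \<Rightarrow> real"
  where "pderiv_at i f x = frechet_derivative f (at x) (axis i 1)"

primrec C_k :: "nat \<Rightarrow> (real^'n \<Rightarrow> real) \<Rightarrow> bool" where
  "C_k 0 f = continuous_on UNIV f"
| "C_k (Suc k) f = ((\<forall>x. f differentiable (at x)) \<and> (\<forall>i. C_k k (pderiv_at i f)))"

definition test_functions :: "(real^'n) set \<Rightarrow> (real^'n \<Rightarrow> real) set"
  where "test_functions \<Omega> =
    {\<phi>. (\<forall>k. C_k k \<phi>) \<and> compact (closure {x. \<phi> x \<noteq> 0}) \<and> closure {x. \<phi> x \<noteq> 0} \<subseteq> \<Omega>}"

definition is_weak_grad :: "(real^'n) set \<Rightarrow> (real^'n \<Rightarrow> real) \<Rightarrow> (real^'n \<Rightarrow> real^'n) \<Rightarrow> bool"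
  where "is_weak_grad \<Omega> u G \<longleftrightarrow>
    (\<forall>i. (\<lambda>x. G x $ i) \<in> L2 \<Omega>) \<and>
    (\<forall>\<phi>\<in>test_functions \<Omega>. \<forall>i.
       (LINT x:\<Omega>|lebesgue. u x * pderiv_at i \<phi> x) = - (LINT x:\<Omega>|lebesgue. G x $ i * \<phi> x))"

text \<open>The weak gradient is determined only up to a null set of \<open>\<Omega>\<close>; \<open>wgrad\<close> is some representative,
  and it is used below only under integrals over \<open>\<Omega>\<close>.\<close>

definition wgrad :: "(real^'n) set \<Rightarrow> (real^'n \<Rightarrow> real) \<Rightarrow> real^'n \<Rightarrow> real^'n"
  where "wgrad \<Omega> u = (SOME G. is_weak_grad \<Omega> u G)"

definition H1 :: "(real^'n) set \<Rightarrow> (real^'n \<Rightarrow> real) set"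
  where "H1 \<Omega> = {u \<in> L2 \<Omega>. \<exists>G. is_weak_grad \<Omega> u G}"

definition h1_norm :: "(real^'n) set \<Rightarrow> (real^'n \<Rightarrow> real) \<Rightarrow> real"
  where "h1_norm \<Omega> u = sqrt ((l2_norm \<Omega> u)\<^sup>2 + (l2_norm \<Omega> (wgrad \<Omega> u))\<^sup>2)"

definition H10 :: "(real^'n) set \<Rightarrow> (real^'n \<Rightarrow> real) set"
  where "H10 \<Omega> = {u \<in> H1 \<Omega>. \<exists>\<phi>. (\<forall>n::nat. \<phi> n \<in> test_functions \<Omega>) \<and>
                          (\<lambda>n. h1_norm \<Omega> (\<lambda>x. u x - \<phi> n x)) \<longlonglongrightarrow> 0}"

text \<open>Entry \<open>(i, j)\<close> of the matrix \<open>vgrad \<Omega> v x\<close> is \<open>\<partial>\<^sub>j v\<^sub>i\<close>. On matrices \<open>\<bullet>\<close> is the Frobenius product.\<close>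

definition vgrad :: "(real^'n) set \<Rightarrow> (real^'n \<Rightarrow> real^'n) \<Rightarrow> real^'n \<Rightarrow> real^'n^'n"
  where "vgrad \<Omega> v x = (\<chi> i. wgrad \<Omega> (\<lambda>y. v y $ i) x)"

definition strain :: "(real^'n) set \<Rightarrow> (real^'n \<Rightarrow> real^'n) \<Rightarrow> real^'n \<Rightarrow> real^'n^'n"
  where "strain \<Omega> v x = (1/2) *\<^sub>R (vgrad \<Omega> v x + transpose (vgrad \<Omega> v x))"

definition wdiv :: "(real^'n) set \<Rightarrow> (real^'n \<Rightarrow> real^'n) \<Rightarrow> real^'n \<Rightarrow> real"
  where "wdiv \<Omega> v x = trace (vgrad \<Omega> v x)"

definition vh1_norm :: "(real^'n) set \<Rightarrow> (real^'n \<Rightarrow> real^'n) \<Rightarrow> real"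
  where "vh1_norm \<Omega> v = sqrt ((l2_norm \<Omega> v)\<^sup>2 + (l2_norm \<Omega> (vgrad \<Omega> v))\<^sup>2)"


section \<open>Domains, meshes and finite-element spaces\<close>

text \<open>Near each boundary point, \<open>\<Omega>\<close> is the set below the graph, in some direction \<open>e\<close>, of a Lipschitz
  function \<open>g\<close> of the coordinates orthogonal to \<open>e\<close>.\<close>

definition lipschitz_boundary :: "(real^'n) set \<Rightarrow> bool"
  where "lipschitz_boundary \<Omega> \<longleftrightarrow>
    (\<forall>x\<in>frontier \<Omega>. \<exists>e r L. \<exists>g :: real^'n \<Rightarrow> real.
       norm e = 1 \<and> r > 0 \<and> L-lipschitz_on UNIV g \<and> (\<forall>y t. g (y + t *\<^sub>R e) = g y) \<and>
       \<Omega> \<inter> ball x r = {y \<in> ball x r. e \<bullet> y < g y})"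

text \<open>Since \<open>\<Omega>\<close> need not be a polytope, the simplices are only required to lie in \<open>closure \<Omega>\<close>;
  finite-element functions are extended by zero outside them.\<close>

definition mesh :: "(real^'n) set \<Rightarrow> (real^'n) set set \<Rightarrow> real \<Rightarrow> bool"
  where "mesh \<Omega> \<T> h \<longleftrightarrow>
    triangulation \<T> \<and> \<T> \<noteq> {} \<and> (\<forall>T\<in>\<T>. int CARD('n) simplex T) \<and> \<Union>\<T> \<subseteq> closure \<Omega> \<and>
    h = Max (diameter ` \<T>)"

definition vertices :: "(real^'n) set \<Rightarrow> (real^'n) set"
  where "vertices T = {w. w extreme_point_of T}"

definition barycentric :: "(real^'n) set \<Rightarrow> real^'n \<Rightarrow> real^'n \<Rightarrow> real"
  where "barycentric T x = (THE c. (\<forall>w. w \<notin> vertices T \<longrightarrow> c w = 0) \<and>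
           (\<Sum>w\<in>vertices T. c w) = 1 \<and> (\<Sum>w\<in>vertices T. c w *\<^sub>R w) = x)"

definition bubble :: "(real^'n) set \<Rightarrow> real^'n \<Rightarrow> real"
  where "bubble T x = (\<Prod>w\<in>vertices T. barycentric T x w)"

definition P1_local :: "(real^'n) set \<Rightarrow> (real^'n \<Rightarrow> real) set"
  where "P1_local T = {p. \<exists>a b. \<forall>x. p x = a \<bullet> x + b}"

definition P1_bubble_local :: "(real^'n) set \<Rightarrow> (real^'n \<Rightarrow> real) set"
  where "P1_bubble_local T = {p. \<exists>a b c. \<forall>x. p x = a \<bullet> x + b + c * bubble T x}"

definition fe_space :: "((real^'n) set \<Rightarrow> (real^'n \<Rightarrow> real) set) \<Rightarrow> (real^'n) set \<Rightarrow>
    (real^'n) set set \<Rightarrow> (real^'n \<Rightarrow> real) set"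
  where "fe_space loc \<Omega> \<T> = {v \<in> H10 \<Omega>. continuous_on UNIV v \<and> (\<forall>x. x \<notin> \<Union>\<T> \<longrightarrow> v x = 0) \<and>
           (\<forall>T\<in>\<T>. \<exists>p\<in>loc T. \<forall>x\<in>T. v x = p x)}"

datatype element = P1_P1 | Mini

definition displacement_space :: "element \<Rightarrow> (real^'n) set \<Rightarrow> (real^'n) set set \<Rightarrow> (real^'n \<Rightarrow> real^'n) set"
  where "displacement_space el \<Omega> \<T> =
    {v. \<forall>i. (\<lambda>x. v x $ i) \<in>
          (case el of P1_P1 \<Rightarrow> fe_space P1_local \<Omega> \<T> | Mini \<Rightarrow> fe_space P1_bubble_local \<Omega> \<T>)}"

definition pressure_space :: "(real^'n) set \<Rightarrow> (real^'n) set set \<Rightarrow> (real^'n \<Rightarrow> real) set"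
  where "pressure_space \<Omega> \<T> = fe_space P1_local \<Omega> \<T>"

definition weak_inf_sup :: "(real^'n) set \<Rightarrow> (real^'n \<Rightarrow> real^'n) set \<Rightarrow> (real^'n \<Rightarrow> real) set \<Rightarrow>
    real \<Rightarrow> real \<Rightarrow> real \<Rightarrow> bool"
  where "weak_inf_sup \<Omega> V Q \<gamma> \<xi> h \<longleftrightarrow>
    (\<forall>q\<in>Q. (SUP v\<in>V - {\<lambda>_. 0}. ereal (l2_inner \<Omega> (wdiv \<Omega> v) q / vh1_norm \<Omega> v))
             \<ge> ereal (\<gamma> * l2_norm \<Omega> q - \<xi> * h * l2_norm \<Omega> (wgrad \<Omega> q)))"


section \<open>Dual spaces and discrete operators\<close>

text \<open>Functionals on a function space \<open>S\<close> are extended by zero outside \<open>S\<close>, so that equality in the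
  dual space is equality of HOL functions.\<close>

definition functional :: "('a \<Rightarrow> 'b) set \<Rightarrow> (('a \<Rightarrow> 'b) \<Rightarrow> real) \<Rightarrow> ('a \<Rightarrow> 'b) \<Rightarrow> real"
  where "functional S F = (\<lambda>v. if v \<in> S then F v else 0)"

definition dual :: "('a \<Rightarrow> 'b::real_vector) set \<Rightarrow> (('a \<Rightarrow> 'b) \<Rightarrow> real) set"
  where "dual S = {f. (\<forall>v. v \<notin> S \<longrightarrow> f v = 0) \<and>
    (\<forall>u\<in>S. \<forall>v\<in>S. \<forall>c d. f (\<lambda>x. c *\<^sub>R u x + d *\<^sub>R v x) = c * f u + d * f v)}"

definition a_form :: "(real^'n) set \<Rightarrow> real \<Rightarrow> real \<Rightarrow> (real^'n \<Rightarrow> real^'n) \<Rightarrow> (real^'n \<Rightarrow> real^'n) \<Rightarrow> real"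
  where "a_form \<Omega> lam \<mu> u v =
    2 * \<mu> * (LINT x:\<Omega>|lebesgue. strain \<Omega> u x \<bullet> strain \<Omega> v x) +
    lam * (LINT x:\<Omega>|lebesgue. wdiv \<Omega> u x * wdiv \<Omega> v x)"

definition ap_form :: "(real^'n) set \<Rightarrow> real \<Rightarrow> (real^'n \<Rightarrow> real) \<Rightarrow> (real^'n \<Rightarrow> real) \<Rightarrow> real"
  where "ap_form \<Omega> K p q = (LINT x:\<Omega>|lebesgue. (K *\<^sub>R wgrad \<Omega> p x) \<bullet> wgrad \<Omega> q x)"

definition Au_op where "Au_op \<Omega> lam \<mu> V u = functional V (\<lambda>v. a_form \<Omega> lam \<mu> u v)"

definition B_op where "B_op \<Omega> Q u = functional Q (\<lambda>q. - l2_inner \<Omega> (wdiv \<Omega> u) q)"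

definition BT_op where "BT_op \<Omega> V Q p = functional V (\<lambda>v. B_op \<Omega> Q v p)"

definition Ap_op where "Ap_op \<Omega> K Q p = functional Q (\<lambda>q. ap_form \<Omega> K p q)"

definition Lp_op where "Lp_op \<Omega> Q p = functional Q (\<lambda>q. l2_inner \<Omega> (wgrad \<Omega> p) (wgrad \<Omega> q))"

definition M_op :: "(real^'n) set \<Rightarrow> (real^'n \<Rightarrow> real) set \<Rightarrow> (real^'n \<Rightarrow> real) \<Rightarrow> (real^'n \<Rightarrow> real) \<Rightarrow> real"
  where "M_op \<Omega> Q p = functional Q (\<lambda>q. l2_inner \<Omega> p q)"

text \<open>\<open>block S11 S12 S21 S22\<close> is the operator matrix with these entries, mapping \<open>V \<times> Q\<close> to
  \<open>dual V \<times> dual Q\<close>, the dual of \<open>V \<times> Q\<close>.\<close>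

definition block :: "('u \<Rightarrow> 'v \<Rightarrow> real) \<Rightarrow> ('p \<Rightarrow> 'v \<Rightarrow> real) \<Rightarrow> ('u \<Rightarrow> 'q \<Rightarrow> real) \<Rightarrow> ('p \<Rightarrow> 'q \<Rightarrow> real) \<Rightarrow>
    'u \<times> 'p \<Rightarrow> ('v \<Rightarrow> real) \<times> ('q \<Rightarrow> real)"
  where "block S11 S12 S21 S22 x =
    ((\<lambda>v. S11 (fst x) v + S12 (snd x) v), (\<lambda>q. S21 (fst x) q + S22 (snd x) q))"

definition dual_pairing :: "('v \<Rightarrow> real) \<times> ('q \<Rightarrow> real) \<Rightarrow> 'v \<times> 'q \<Rightarrow> real"
  where "dual_pairing x' y = fst x' (fst y) + snd x' (snd y)"

definition dual_inner :: "(('v \<Rightarrow> real) \<times> ('q \<Rightarrow> real) \<Rightarrow> 'v \<times> 'q) \<Rightarrow>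
    ('v \<Rightarrow> real) \<times> ('q \<Rightarrow> real) \<Rightarrow> ('v \<Rightarrow> real) \<times> ('q \<Rightarrow> real) \<Rightarrow> real"
  where "dual_inner N x' y' = dual_pairing x' (N y')"

definition dual_norm :: "(('v \<Rightarrow> real) \<times> ('q \<Rightarrow> real) \<Rightarrow> 'v \<times> 'q) \<Rightarrow>
    ('v \<Rightarrow> real) \<times> ('q \<Rightarrow> real) \<Rightarrow> real"
  where "dual_norm N x' = sqrt (dual_inner N x' x')"

definition biot_op where
  "biot_op \<Omega> V Q lam \<mu> \<alpha> K \<tau> \<eta> h = block
     (Au_op \<Omega> lam \<mu> V)                (\<lambda>p v. \<alpha> * BT_op \<Omega> V Q p v)
     (\<lambda>u q. - \<alpha> * B_op \<Omega> Q u q)     (\<lambda>p q. \<tau> * Ap_op \<Omega> K Q p q + \<eta> * h\<^sup>2 * Lp_op \<Omega> Q p q)"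

definition precond_U where
  "precond_U \<Omega> V Q lam \<mu> \<alpha> K \<tau> \<eta> h \<zeta> = inv_into (V \<times> Q) (block
     (Au_op \<Omega> lam \<mu> V)     (\<lambda>p v. \<alpha> * BT_op \<Omega> V Q p v)
     (\<lambda>u q. 0)               (\<lambda>p q. \<tau> * Ap_op \<Omega> K Q p q + \<eta> * h\<^sup>2 * Lp_op \<Omega> Q p q
                                        + \<alpha>\<^sup>2 / \<zeta>\<^sup>2 * M_op \<Omega> Q p q))"

definition precond_D where
  "precond_D \<Omega> V Q lam \<mu> \<alpha> K \<tau> \<eta> h \<zeta> = inv_into (V \<times> Q) (block
     (Au_op \<Omega> lam \<mu> V)     (\<lambda>p v. 0)
     (\<lambda>u q. 0)               (\<lambda>p q. \<tau> * Ap_op \<Omega> K Q p q + \<eta> * h\<^sup>2 * Lp_op \<Omega> Q p q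
                                        + \<alpha>\<^sup>2 / \<zeta>\<^sup>2 * M_op \<Omega> Q p q))"

end

(*
  Let (w, p) = B_D x' and let r in V_h represent the functional v |-> alpha (B v, p) in the inner
  product a.  Then B_U x' = (w - r, p), the denominator is a(w, w) + s(p, p) with s the form of the
  lower right block, and the numerator is a(w, w) - a(w, r) + a(r, r) + C(p, p) with
  C = tau a_p + eta h^2 (grad, grad).  Young's inequality leaves the task of bounding
  (alpha / zeta)^2 |p|^2 by a(r, r) + C(p, p).  Here sqrt(a(r, r)) is the dual norm of alpha B^T p, which
  the weak inf-sup condition bounds from below because a(v, v) <= d zeta^2 |v|_1^2; the defect
  xi h |grad p| is absorbed by the stabilization eta h^2 |grad p|^2.  The upper bound rests on
  zeta |div v| <= sqrt(a(v, v)), which follows from (tr e)^2 <= d |e|^2.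

  The operators are invertible because the spaces are finite-dimensional and the forms definite.
  Definiteness needs uniqueness of weak gradients (testing against smooth bumps that increase to the
  indicator of a box) and a Poincare inequality in a single coordinate direction.
*)
theory Submission
  imports Defs "HOL-Computational_Algebra.Polynomial"
begin

section \<open>Riesz representation in finite-dimensional function spaces\<close>

text \<open>The obstacle to coercivity is that the preconditioner contains the mass term (\<alpha> /
  \<zeta>)^2 |p|^2, which the lower right block of the Biot operator lacks; it can only be recovered
  through the coupling. Uniformity in \<lambda> and \<mu> rests on \<zeta>^2 = \<lambda> + 2 \<mu> /
  d being comparable to \<open>a\<close> from both sides: \<zeta>^2 |div v|^2 <= a(v, v) <= d
  \<zeta>^2 |v|_1^2. The second inequality turns the inf-sup condition into an estimate in which
  \<alpha> and \<zeta> occur only as \<alpha> / \<zeta>, and squaring it gives \<kappa> = 2 (d +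
  \<xi>^2 / \<delta>) / \<gamma>^2. The final constants are 1 / (2 (1 + \<kappa>)) and 3.

  The discrete spaces are sets of everywhere defined functions that vary with the mesh. Linear
  algebra is therefore done relative to a carrier set, and statements that Sobolev theory gives
  almost everywhere must be upgraded to equality of functions, by continuity and by the extension by
  zero.\<close>

definition fun_subspace :: "('a \<Rightarrow> 'b::real_vector) set \<Rightarrow> bool"
  where "fun_subspace S \<longleftrightarrow> (\<lambda>_. 0) \<in> S \<and>
    (\<forall>u\<in>S. \<forall>v\<in>S. \<forall>c d. (\<lambda>x. c *\<^sub>R u x + d *\<^sub>R v x) \<in> S)"

text \<open>Unlike membership in \<open>dual S\<close>, this asks nothing outside \<open>S\<close>,
  so it passes to subspaces and applies directly to partially applied forms such as
  \<open>b u\<close>.\<close>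

definition linear_fun :: "('a \<Rightarrow> 'b::real_vector) set \<Rightarrow> (('a \<Rightarrow> 'b) \<Rightarrow> real) \<Rightarrow> bool"
  where "linear_fun S f \<longleftrightarrow>
    (\<forall>u\<in>S. \<forall>v\<in>S. \<forall>c d. f (\<lambda>x. c *\<^sub>R u x + d *\<^sub>R v x) = c * f u + d * f v)"

definition semi_inner_on :: "('a \<Rightarrow> 'b::real_vector) set \<Rightarrow> (('a \<Rightarrow> 'b) \<Rightarrow> ('a \<Rightarrow> 'b) \<Rightarrow> real) \<Rightarrow> bool"
  where "semi_inner_on S b \<longleftrightarrow>
    (\<forall>u\<in>S. linear_fun S (b u)) \<and> (\<forall>u\<in>S. \<forall>v\<in>S. b u v = b v u) \<and> (\<forall>u\<in>S. b u u \<ge> 0)"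

definition inner_on :: "('a \<Rightarrow> 'b::real_vector) set \<Rightarrow> (('a \<Rightarrow> 'b) \<Rightarrow> ('a \<Rightarrow> 'b) \<Rightarrow> real) \<Rightarrow> bool"
  where "inner_on S b \<longleftrightarrow> semi_inner_on S b \<and> (\<forall>u\<in>S. b u u = 0 \<longrightarrow> u = (\<lambda>_. 0))"

text \<open>Finite dimension, phrased dually: finitely many linear functionals separate the points
  of \<open>S\<close>. This needs no basis of the finite-element space, and point evaluations can
  serve as the functionals.\<close>

definition finitely_determined :: "('a \<Rightarrow> 'b::real_vector) set \<Rightarrow> bool"
  where "finitely_determined S \<longleftrightarrow>
    (\<exists>L. finite L \<and> (\<forall>l\<in>L. linear_fun S l) \<and> (\<forall>v\<in>S. (\<forall>l\<in>L. l v = 0) \<longrightarrow> v = (\<lambda>_. 0)))"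

lemma fun_subspace_zero: "fun_subspace S \<Longrightarrow> (\<lambda>_. 0) \<in> S"
  by (simp add: fun_subspace_def)

lemma fun_subspace_lincomb:
  "fun_subspace S \<Longrightarrow> u \<in> S \<Longrightarrow> v \<in> S \<Longrightarrow> (\<lambda>x. c *\<^sub>R u x + d *\<^sub>R v x) \<in> S"
  by (simp add: fun_subspace_def)

lemma fun_subspace_diff: "fun_subspace S \<Longrightarrow> u \<in> S \<Longrightarrow> v \<in> S \<Longrightarrow> (\<lambda>x. u x - v x) \<in> S"
  using fun_subspace_lincomb[of S u v 1 "-1"] by simp

lemma linear_fun_lincomb:
  "linear_fun S f \<Longrightarrow> u \<in> S \<Longrightarrow> v \<in> S \<Longrightarrow> f (\<lambda>x. c *\<^sub>R u x + d *\<^sub>R v x) = c * f u + d * f v"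
  by (simp add: linear_fun_def)

lemma linear_fun_diff: "linear_fun S f \<Longrightarrow> u \<in> S \<Longrightarrow> v \<in> S \<Longrightarrow> f (\<lambda>x. u x - v x) = f u - f v"
  using linear_fun_lincomb[of S f u v 1 "-1"] by simp

lemma linear_fun_scale: "linear_fun S f \<Longrightarrow> u \<in> S \<Longrightarrow> f (\<lambda>x. c *\<^sub>R u x) = c * f u"
  using linear_fun_lincomb[of S f u u c 0] by simp

lemma linear_fun_zero: "linear_fun S f \<Longrightarrow> fun_subspace S \<Longrightarrow> f (\<lambda>_. 0) = 0"
  using linear_fun_scale[of S f "\<lambda>_. 0" 0] by (simp add: fun_subspace_zero)

lemma linear_fun_mono: "linear_fun S f \<Longrightarrow> S' \<subseteq> S \<Longrightarrow> linear_fun S' f"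
  unfolding linear_fun_def by blast

lemma inner_on_mono: "inner_on S b \<Longrightarrow> S' \<subseteq> S \<Longrightarrow> inner_on S' b"
  unfolding inner_on_def semi_inner_on_def by (meson linear_fun_mono subsetD)

lemma semi_inner_linear: "semi_inner_on S b \<Longrightarrow> u \<in> S \<Longrightarrow> linear_fun S (b u)"
  and semi_inner_sym: "semi_inner_on S b \<Longrightarrow> u \<in> S \<Longrightarrow> v \<in> S \<Longrightarrow> b u v = b v u"
  and semi_inner_nonneg: "semi_inner_on S b \<Longrightarrow> u \<in> S \<Longrightarrow> b u u \<ge> 0"
  by (simp_all add: semi_inner_on_def)

lemma semi_inner_linear_left:
  assumes "semi_inner_on S b" "fun_subspace S" "w \<in> S"
  shows "linear_fun S (\<lambda>u. b u w)"
proof -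
  have "b u w = b w u" if "u \<in> S" for u using semi_inner_sym[OF assms(1)] assms(3) that by simp
  then show ?thesis
    using semi_inner_linear[OF assms(1,3)] fun_subspace_lincomb[OF assms(2)]
    by (simp add: linear_fun_def)
qed

lemma semi_inner_expand:
  assumes b: "semi_inner_on S b" and S: "fun_subspace S" and u: "u \<in> S" and v: "v \<in> S"
  shows "b (\<lambda>x. c *\<^sub>R u x + d *\<^sub>R v x) (\<lambda>x. c *\<^sub>R u x + d *\<^sub>R v x) =
    c\<^sup>2 * b u u + 2 * c * d * b u v + d\<^sup>2 * b v v"
proof -
  let ?z = "\<lambda>x. c *\<^sub>R u x + d *\<^sub>R v x"
  have z: "?z \<in> S" using fun_subspace_lincomb[OF S u v] .
  have "b ?z ?z = c * b ?z u + d * b ?z v"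
    using linear_fun_lincomb[OF semi_inner_linear[OF b z] u v] .
  also have "\<dots> = c * (c * b u u + d * b v u) + d * (c * b u v + d * b v v)"
    using linear_fun_lincomb[OF semi_inner_linear_left[OF b S u] u v]
      linear_fun_lincomb[OF semi_inner_linear_left[OF b S v] u v] by simp
  finally show ?thesis
    using semi_inner_sym[OF b u v] by (simp add: power2_eq_square algebra_simps)
qed

text \<open>Parallelogram law: the nonnegative square of c u - d v is added to the left
  side.\<close>

lemma semi_inner_lincomb_le:
  assumes b: "semi_inner_on S b" and S: "fun_subspace S" and u: "u \<in> S" and v: "v \<in> S"
  shows "b (\<lambda>x. c *\<^sub>R u x + d *\<^sub>R v x) (\<lambda>x. c *\<^sub>R u x + d *\<^sub>R v x) \<le>
    2 * c\<^sup>2 * b u u + 2 * d\<^sup>2 * b v v"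
  using semi_inner_nonneg[OF b fun_subspace_lincomb[OF S u v, of c "- d"]]
    semi_inner_expand[OF assms, of c "- d"] semi_inner_expand[OF assms, of c d]
  by (simp add: algebra_simps)

lemma semi_inner_Cauchy_Schwarz:
  assumes b: "semi_inner_on S b" and S: "fun_subspace S" and u: "u \<in> S" and v: "v \<in> S"
  shows "\<bar>b u v\<bar> \<le> sqrt (b u u) * sqrt (b v v)"
proof -
  have quad: "0 \<le> c\<^sup>2 * b u u + 2 * c * d * b u v + d\<^sup>2 * b v v" for c d
    using semi_inner_nonneg[OF b fun_subspace_lincomb[OF S u v, of c d]]
      semi_inner_expand[OF assms, of c d] by simp
  have uu: "b u u \<ge> 0" and vv: "b v v \<ge> 0" using semi_inner_nonneg[OF b] u v by auto
  have "(b u v)\<^sup>2 \<le> b u u * b v v"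
  proof (cases "b v v = 0")
    case True
    have "b u v = 0"
    proof (rule ccontr)
      assume n: "b u v \<noteq> 0"
      \<comment> \<open>With this coefficient the nonnegative quadratic would equal -1.\<close>
      have "0 \<le> b u u + 2 * (- (b u u + 1) / (2 * b u v)) * b u v"
        using quad[of 1 "- (b u u + 1) / (2 * b u v)"] True by simp
      then show False using n by (simp add: field_simps)
    qed
    then show ?thesis using True by simp
  next
    case False
    then have p: "b v v > 0" using vv by simp
    have "0 \<le> (b v v)\<^sup>2 * b u u - 2 * b v v * (b u v)\<^sup>2 + (b u v)\<^sup>2 * b v v"
      using quad[of "b v v" "- b u v"] by (simp add: power2_eq_square algebra_simps)
    also have "\<dots> = b v v * (b u u * b v v - (b u v)\<^sup>2)"
      by (simp add: power2_eq_square algebra_simps)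
    finally show ?thesis using p by (simp add: zero_le_mult_iff)
  qed
  then have "sqrt ((b u v)\<^sup>2) \<le> sqrt (b u u * b v v)" by (rule real_sqrt_le_mono)
  then show ?thesis by (simp add: real_sqrt_mult)
qed

text \<open>Induction on the number of separating functionals. On the kernel of \<open>l\<close> the
  remaining functionals still separate points, so the hypothesis applies there, and a single vector
  orthogonal to the kernel accounts for the rest of \<open>S\<close>. The carrier is generalized
  because the kernel is a new carrier.\<close>

lemma riesz_finitely_determined:
  assumes "finite L" "fun_subspace S" "inner_on S b" "\<forall>l\<in>L. linear_fun S l"
    "\<forall>v\<in>S. (\<forall>l\<in>L. l v = 0) \<longrightarrow> v = (\<lambda>_. 0)" "linear_fun S f"
  shows "\<exists>u\<in>S. \<forall>v\<in>S. b u v = f v"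
  using assms
proof (induction L arbitrary: S f rule: finite_induct)
  case empty
  have S: "v = (\<lambda>_. 0)" if "v \<in> S" for v using empty(4) that by blast
  have z: "(\<lambda>_. 0) \<in> S" using empty(1) by (rule fun_subspace_zero)
  have "f (\<lambda>_. 0) = 0" using linear_fun_zero empty by blast
  moreover have "b (\<lambda>_. 0) (\<lambda>_. 0) = 0"
    using linear_fun_zero[OF semi_inner_linear[OF _ z]] empty(1,2) inner_on_def by blast
  ultimately have "\<forall>v\<in>S. b (\<lambda>_. 0) v = f v" using S by metis
  then show ?case using z by blast
next
  case (insert l L)
  note S = \<open>fun_subspace S\<close>
  have semi: "semi_inner_on S b" using insert.prems(2) by (simp add: inner_on_def)
  have l: "linear_fun S l" using insert.prems(3) by simp
  define S' where "S' = {v\<in>S. l v = 0}"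
  have sub: "S' \<subseteq> S" by (auto simp: S'_def)
  have S': "fun_subspace S'"
    unfolding fun_subspace_def S'_def
    using fun_subspace_zero[OF S] linear_fun_zero[OF l S] fun_subspace_lincomb[OF S]
      linear_fun_lincomb[OF l] by auto
  have IH: "\<exists>u\<in>S'. \<forall>v\<in>S'. b u v = g v" if "linear_fun S g" for g
    using insert.IH[OF S' inner_on_mono[OF insert.prems(2) sub] _ _ linear_fun_mono[OF that sub]]
      insert.prems(3,4) linear_fun_mono[OF _ sub] S'_def by auto
  show ?case
  proof (cases "S' = S")
    case True
    then show ?thesis using IH[OF insert.prems(5)] by simp
  next
    case False
    then obtain e where e: "e \<in> S" "l e \<noteq> 0" using S'_def by blast
    \<comment> \<open>Representing \<open>b e\<close> on the kernel yields the orthogonal projection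
      of \<open>e\<close> onto it.\<close>
    obtain p where p: "p \<in> S'" "\<forall>v\<in>S'. b p v = b e v"
      using IH[OF semi_inner_linear[OF semi e(1)]] by blast
    have pS: "p \<in> S" "l p = 0" using p(1) by (auto simp: S'_def)
    define e' where "e' = (\<lambda>x. e x - p x)"
    have e'S: "e' \<in> S" unfolding e'_def using fun_subspace_diff[OF S e(1) pS(1)] .
    have le': "l e' = l e" unfolding e'_def using linear_fun_diff[OF l e(1) pS(1)] pS(2) by simp
    have orth: "b e' v = 0" if "v \<in> S'" for v
      unfolding e'_def
      using linear_fun_diff[OF semi_inner_linear_left[OF semi S, of v] e(1) pS(1)] that p(2) sub
      by auto
    have "e' \<noteq> (\<lambda>_. 0)" using le' e(2) linear_fun_zero[OF l S] by auto
    then have bpos: "b e' e' \<noteq> 0" using insert.prems(2) e'S by (auto simp: inner_on_def)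
    obtain u where u: "u \<in> S'" "\<forall>v\<in>S'. b u v = f v" using IH[OF insert.prems(5)] by blast
    have uS: "u \<in> S" using u(1) sub by blast
    \<comment> \<open>The coefficient is forced by testing with \<open>e'\<close>, to which
      \<open>u\<close> is orthogonal.\<close>
    let ?w = "\<lambda>x. 1 *\<^sub>R u x + (f e' / b e' e') *\<^sub>R e' x"
    have w: "?w \<in> S" using fun_subspace_lincomb[OF S uS e'S] .
    have "b ?w v = f v" if v: "v \<in> S" for v
    proof -
      define c where "c = l v / l e"
      define v' where "v' = (\<lambda>x. 1 *\<^sub>R v x + (- c) *\<^sub>R e' x)"
      have v'S: "v' \<in> S" unfolding v'_def using fun_subspace_lincomb[OF S v e'S] .
      have "l v' = 0" unfolding v'_def using linear_fun_lincomb[OF l v e'S, of 1 "-c"] le' e(2) c_def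
        by simp
      then have v': "v' \<in> S'" using v'S S'_def by simp
      have veq: "v = (\<lambda>x. 1 *\<^sub>R v' x + c *\<^sub>R e' x)" by (simp add: v'_def)
      have left: "b ?w z = b u z + f e' / b e' e' * b e' z" if "z \<in> S" for z
        using linear_fun_lincomb[OF semi_inner_linear_left[OF semi S that] uS e'S, of 1 "f e' / b e' e'"]
        by (simp only: mult_1)
      have "b ?w v = b ?w v' + c * b ?w e'"
        by (subst veq, subst linear_fun_lincomb[OF semi_inner_linear[OF semi w] v'S e'S]) simp
      also have "b ?w v' = f v'" using left[OF v'S] orth[OF v'] u(2) v' by simp
      also have "b ?w e' = f e'"
        using left[OF e'S] bpos semi_inner_sym[OF semi uS e'S] orth[OF u(1)] by simp
      also have "f v' + c * f e' = f v"
        using linear_fun_lincomb[OF insert.prems(5) v'S e'S, of 1 c] veq by simp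
      finally show ?thesis .
    qed
    then show ?thesis using w by blast
  qed
qed

lemma finitely_determined_by_points:
  fixes S :: "('a \<Rightarrow> 'b::euclidean_space) set"
  assumes "finite P" and "\<And>v. v \<in> S \<Longrightarrow> (\<And>x. x \<in> P \<Longrightarrow> v x = 0) \<Longrightarrow> v = (\<lambda>_. 0)"
  shows "finitely_determined S"
  unfolding finitely_determined_def
proof (intro exI conjI ballI impI)
  let ?L = "(\<lambda>(x, e) v. v x \<bullet> e) ` (P \<times> (Basis :: 'b set)) :: (('a \<Rightarrow> 'b) \<Rightarrow> real) set"
  show "finite ?L" using assms(1) by simp
  show "linear_fun S l" if "l \<in> ?L" for l
    using that by (auto simp: linear_fun_def inner_add_left)
  show "v = (\<lambda>_. 0)" if v: "v \<in> S" "\<forall>l\<in>?L. l v = 0" for v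
  proof (rule assms(2)[OF v(1)])
    show "v x = 0" if "x \<in> P" for x
      using v(2) that by (intro euclidean_eqI[of "v x" 0]) auto
  qed
qed

lemma dual_linear_fun: "f \<in> dual S \<Longrightarrow> linear_fun S f"
  and dual_outside: "f \<in> dual S \<Longrightarrow> v \<notin> S \<Longrightarrow> f v = 0"
  by (auto simp: dual_def linear_fun_def)

lemma functional_in_dual: "fun_subspace S \<Longrightarrow> linear_fun S f \<Longrightarrow> functional S f \<in> dual S"
  by (auto simp: dual_def linear_fun_def functional_def fun_subspace_def)

lemma riesz:
  assumes "fun_subspace S" "inner_on S b" "finitely_determined S" "linear_fun S f"
  obtains u where "u \<in> S" "\<And>v. v \<in> S \<Longrightarrow> b u v = f v"
  using riesz_finitely_determined[OF _ assms(1,2) _ _ assms(4)] assms(3)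
  unfolding finitely_determined_def by (metis (no_types, lifting))

lemma riesz_unique:
  assumes S: "fun_subspace S" and b: "inner_on S b" and u: "u \<in> S" "u' \<in> S"
    and eq: "\<And>v. v \<in> S \<Longrightarrow> b u v = b u' v"
  shows "u = u'"
proof -
  let ?d = "\<lambda>x. u x - u' x"
  have semi: "semi_inner_on S b" using b by (simp add: inner_on_def)
  have d: "?d \<in> S" using fun_subspace_diff[OF S u] .
  have "b ?d ?d = 0"
    using linear_fun_diff[OF semi_inner_linear_left[OF semi S d] u] eq[OF d] by simp
  then have "?d = (\<lambda>_. 0)" using b d by (auto simp: inner_on_def)
  then have "u x = u' x" for x by (metis eq_iff_diff_eq_0)
  then show ?thesis by blast
qed

section \<open>Block preconditioners for an abstract saddle point problem\<close>

text \<open>\<open>inv_into\<close> returns a chosen preimage, so a solution of the block system is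
  its value only because the matrix is injective: the second row determines \<open>p\<close>, and
  then the first determines \<open>u\<close>. Taking \<open>c\<close> to be zero covers the block
  diagonal case.\<close>

lemma inv_into_block_eq:
  assumes V: "fun_subspace V" "inner_on V a" and Q: "fun_subspace Q" "inner_on Q s"
    and c: "\<And>p. p \<in> Q \<Longrightarrow> linear_fun V (\<lambda>v. c v p)"
    and T: "\<And>u p. u \<in> V \<Longrightarrow> p \<in> Q \<Longrightarrow>
      T (u, p) = (functional V (\<lambda>v. a u v + c v p), functional Q (\<lambda>q. s p q))"
    and f: "f \<in> dual V" and g: "g \<in> dual Q" and u: "u \<in> V" and p: "p \<in> Q"
    and uf: "\<And>v. v \<in> V \<Longrightarrow> a u v + c v p = f v" and pg: "\<And>q. q \<in> Q \<Longrightarrow> s p q = g q"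
  shows "inv_into (V \<times> Q) T (f, g) = (u, p)"
proof (rule inv_into_f_eq)
  show "(u, p) \<in> V \<times> Q" using u p by simp
  show "T (u, p) = (f, g)"
    using uf pg dual_outside[OF f] dual_outside[OF g]
    by (auto simp: T[OF u p] functional_def fun_eq_iff)
  show "inj_on T (V \<times> Q)"
  proof (rule inj_onI, clarify)
    fix u p u' p' assume in_VQ: "u \<in> V" "p \<in> Q" "u' \<in> V" "p' \<in> Q" and eq: "T (u, p) = T (u', p')"
    have eq1: "functional V (\<lambda>v. a u v + c v p) v = functional V (\<lambda>v. a u' v + c v p') v"
      and eq2: "functional Q (\<lambda>q. s p q) q = functional Q (\<lambda>q. s p' q) q" for v q
      using eq in_VQ by (simp_all add: T)
    have "s p q = s p' q" if "q \<in> Q" for q using eq2[of q] that by (simp add: functional_def)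
    then have pp: "p = p'" using riesz_unique[OF Q in_VQ(2,4)] by blast
    have "a u v = a u' v" if "v \<in> V" for v using eq1[of v] that pp by (simp add: functional_def)
    then have "u = u'" using riesz_unique[OF V in_VQ(1,3)] by blast
    with pp show "u = u' \<and> p = p'" by simp
  qed
qed

text \<open>Absorption step for estimates obtained by testing a quantity against itself, where the
  square root of the left side reappears on the right.\<close>

lemma le_of_square_le_mult:
  fixes x y :: real
  assumes "0 \<le> x" "0 \<le> y" "x \<le> sqrt y * sqrt x"
  shows "x \<le> y"
proof -
  have "x\<^sup>2 \<le> (sqrt y * sqrt x)\<^sup>2" using assms by (intro power_mono)
  also have "\<dots> = y * x" using assms by (simp add: power_mult_distrib)
  finally have "x * x \<le> y * x" by (simp add: power2_eq_square)
  then show ?thesis using assms by (cases "x = 0") auto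
qed

text \<open>In the application \<open>a\<close> is the elasticity form, \<open>c v p\<close> is
  -\<alpha> (div v, p), \<open>C\<close> is the stabilized diffusion form and \<open>m\<close> is
  the mass term with weight (\<alpha> / \<zeta>)^2. The representer of the functional
  \<open>c _ p\<close> is controlled from above by \<open>bound\<close> and from below by
  \<open>infsup\<close>. The upper estimate rests on \<open>bound\<close>, which is why its constant
  is free of \<open>\<kappa>\<close>.\<close>

lemma saddle_point_field_of_values:
  fixes V :: "('x \<Rightarrow> 'b::real_vector) set" and Q :: "('y \<Rightarrow> 'c::real_vector) set"
  assumes V: "fun_subspace V" "finitely_determined V" "inner_on V a"
    and Q: "fun_subspace Q" "finitely_determined Q" "inner_on Q s"
    and C: "semi_inner_on Q C" and m: "semi_inner_on Q m"
    and s: "\<And>p q. p \<in> Q \<Longrightarrow> q \<in> Q \<Longrightarrow> s p q = C p q + m p q"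
    and c1: "\<And>p. p \<in> Q \<Longrightarrow> linear_fun V (\<lambda>v. c v p)"
    and c2: "\<And>v. v \<in> V \<Longrightarrow> linear_fun Q (c v)"
    and bound: "\<And>v q. v \<in> V \<Longrightarrow> q \<in> Q \<Longrightarrow> \<bar>c v q\<bar> \<le> sqrt (a v v) * sqrt (m q q)"
    and \<kappa>: "\<kappa> \<ge> 0"
    and infsup: "\<And>p r. p \<in> Q \<Longrightarrow> r \<in> V \<Longrightarrow> (\<And>v. v \<in> V \<Longrightarrow> a r v = c v p) \<Longrightarrow>
      m p p \<le> \<kappa> * (a r r + C p p)"
    and A: "\<And>u p. u \<in> V \<Longrightarrow> p \<in> Q \<Longrightarrow>
      A (u, p) = (functional V (\<lambda>v. a u v + c v p), functional Q (\<lambda>q. - c u q + C p q))"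
    and U: "\<And>u p. u \<in> V \<Longrightarrow> p \<in> Q \<Longrightarrow>
      U (u, p) = (functional V (\<lambda>v. a u v + c v p), functional Q (\<lambda>q. s p q))"
    and D: "\<And>u p. u \<in> V \<Longrightarrow> p \<in> Q \<Longrightarrow>
      D (u, p) = (functional V (\<lambda>v. a u v), functional Q (\<lambda>q. s p q))"
    and x': "x' \<in> dual V \<times> dual Q" "x' \<noteq> (\<lambda>_. 0, \<lambda>_. 0)"
  defines "BU \<equiv> inv_into (V \<times> Q) U" and "BD \<equiv> inv_into (V \<times> Q) D"
  shows "1 / (2 * (1 + \<kappa>)) \<le> dual_inner BD (A (BU x')) x' / dual_inner BD x' x'"
    and "dual_norm BD (A (BU x')) / dual_norm BD x' \<le> 3"
proof -
  obtain f g where x'eq: "x' = (f, g)" and f: "f \<in> dual V" and g: "g \<in> dual Q" using x'(1) by auto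
  have semia: "semi_inner_on V a" and semis: "semi_inner_on Q s"
    using V(3) Q(3) by (auto simp: inner_on_def)
  obtain w where w: "w \<in> V" "\<And>v. v \<in> V \<Longrightarrow> a w v = f v"
    using riesz[OF V(1,3,2) dual_linear_fun[OF f]] by blast
  obtain p where p: "p \<in> Q" "\<And>q. q \<in> Q \<Longrightarrow> s p q = g q"
    using riesz[OF Q(1,3,2) dual_linear_fun[OF g]] by blast
  obtain r where r: "r \<in> V" "\<And>v. v \<in> V \<Longrightarrow> a r v = c v p"
    using riesz[OF V(1,3,2) c1[OF p(1)]] by blast
  define u where "u = (\<lambda>x. w x - r x)"
  have u: "u \<in> V" unfolding u_def using fun_subspace_diff[OF V(1) w(1) r(1)] .
  have au: "a u v = a w v - a r v" if "v \<in> V" for v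
    unfolding u_def
    using linear_fun_diff[OF semi_inner_linear_left[OF semia V(1) that] w(1) r(1)] .
  have BD: "BD (F, G) = (z, t)"
    if "F \<in> dual V" "G \<in> dual Q" "z \<in> V" "t \<in> Q" "\<And>v. v \<in> V \<Longrightarrow> a z v = F v"
      "\<And>q. q \<in> Q \<Longrightarrow> s t q = G q" for F G z t
    unfolding BD_def
    by (rule inv_into_block_eq[OF V(1,3) Q(1,3), where c="\<lambda>_ _. 0"])
      (use that D in \<open>auto simp: linear_fun_def\<close>)
  have BDx: "BD x' = (w, p)" unfolding x'eq by (rule BD) (use f g w p in auto)
  have BUx: "BU x' = (u, p)"
    unfolding x'eq BU_def
    by (rule inv_into_block_eq[OF V(1,3) Q(1,3), where c=c])
      (use c1 U f g u p au w r in auto)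
  define G where "G = functional Q (\<lambda>q. - c u q + C p q)"
  have "linear_fun Q (\<lambda>q. - c u q + C p q)"
    using c2[OF u] semi_inner_linear[OF C p(1)] by (simp add: linear_fun_def algebra_simps)
  then have G: "G \<in> dual Q" unfolding G_def using functional_in_dual[OF Q(1)] by blast
  \<comment> \<open>\<open>A\<close> and \<open>U\<close> share their first row, so applying
    \<open>A\<close> after \<open>BU\<close> returns the first component \<open>f\<close>
    unchanged.\<close>
  have Af: "functional V (\<lambda>v. a u v + c v p) = f"
    using au w(2) r(2) dual_outside[OF f] by (auto simp: functional_def fun_eq_iff)
  have Ax: "A (BU x') = (f, G)" unfolding BUx A[OF u p(1)] Af G_def ..
  obtain t where t: "t \<in> Q" "\<And>q. q \<in> Q \<Longrightarrow> s t q = G q"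
    using riesz[OF Q(1,3,2) dual_linear_fun[OF G]] by blast
  have BDAx: "BD (A (BU x')) = (w, t)" unfolding Ax by (rule BD) (use f G w t in auto)
  have Gq: "G q = - c u q + C p q" if "q \<in> Q" for q using that by (simp add: G_def functional_def)
  have den: "dual_inner BD x' x' = a w w + s p p"
    unfolding dual_inner_def BDx dual_pairing_def unfolding x'eq using w p by simp
  \<comment> \<open>The coupling term satisfies c u p = a r u = a w r - a r r, because
    \<open>r\<close> represents \<open>c _ p\<close> and u = w - r.\<close>
  have num: "dual_inner BD (A (BU x')) x' = a w w - a w r + a r r + C p p"
    unfolding dual_inner_def BDx dual_pairing_def Ax
    using w p Gq r(2)[OF u] au[OF r(1)] semi_inner_sym[OF semia r(1) u] by simp
  have num2: "dual_inner BD (A (BU x')) (A (BU x')) = a w w + s t t"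
    unfolding dual_inner_def BDAx dual_pairing_def unfolding Ax using w t by simp
  have ww: "a w w \<ge> 0" and rr: "a r r \<ge> 0" and uu: "a u u \<ge> 0" and Cp: "C p p \<ge> 0"
    and Ct: "C t t \<ge> 0" and mp: "m p p \<ge> 0" and mt: "m t t \<ge> 0" and spp: "s p p \<ge> 0"
    and stt: "s t t \<ge> 0"
    using semi_inner_nonneg[OF semia] semi_inner_nonneg[OF C] semi_inner_nonneg[OF m]
      semi_inner_nonneg[OF semis] w(1) r(1) u p(1) t(1) by simp_all
  \<comment> \<open>Both quotients are meaningful only for a nonzero denominator; definiteness of
    the two forms supplies this.\<close>
  have denpos: "a w w + s p p > 0"
  proof (rule ccontr)
    assume "\<not> ?thesis"
    then have "a w w = 0" "s p p = 0" using ww spp by auto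
    then have "w = (\<lambda>_. 0)" "p = (\<lambda>_. 0)" using V(3) Q(3) w p by (auto simp: inner_on_def)
    then have "a w v = 0" "s p q = 0" if "v \<in> V" "q \<in> Q" for v q
      using linear_fun_zero[OF semi_inner_linear_left[OF semia V(1) that(1)] V(1)]
        linear_fun_zero[OF semi_inner_linear_left[OF semis Q(1) that(2)] Q(1)] by auto
    then have "f v = 0" "g q = 0" for v q
      using w(2) p(2) dual_outside[OF f] dual_outside[OF g]
        fun_subspace_zero[OF V(1)] fun_subspace_zero[OF Q(1)] by metis+
    then have "f = (\<lambda>_. 0)" "g = (\<lambda>_. 0)" by auto
    with x'(2) x'eq show False by simp
  qed
  have uu_expand: "a u u = a w w - 2 * a w r + a r r"
    using au[OF u] semi_inner_sym[OF semia w(1) u] semi_inner_sym[OF semia r(1) u]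
      au[OF w(1)] au[OF r(1)] semi_inner_sym[OF semia r(1) w(1)] by simp
  \<comment> \<open>Twice the difference of the two sides is a u u + C p p.\<close>
  have lower: "a w w - a w r + a r r + C p p \<ge> (a w w + (a r r + C p p)) / 2"
    using uu uu_expand Cp by (simp add: field_simps)
  have "s p p \<le> (1 + \<kappa>) * (a r r + C p p)"
    using s[OF p(1) p(1)] infsup[OF p(1) r] rr by (simp add: algebra_simps)
  moreover have "a w w \<le> (1 + \<kappa>) * a w w" using ww \<kappa> by (simp add: algebra_simps)
  ultimately have "a w w + s p p \<le> (1 + \<kappa>) * (a w w + (a r r + C p p))"
    by (simp add: algebra_simps)
  also have "\<dots> \<le> (1 + \<kappa>) * (2 * (a w w - a w r + a r r + C p p))"
    using lower \<kappa> by (intro mult_left_mono) auto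
  finally show "1 / (2 * (1 + \<kappa>)) \<le> dual_inner BD (A (BU x')) x' / dual_inner BD x' x'"
    unfolding num den using denpos \<kappa> by (simp add: field_simps)
  \<comment> \<open>Testing \<open>r\<close> against itself gives a r r = c r p;
    \<open>bound\<close> then allows one factor sqrt (a r r) to be absorbed.\<close>
  have "a r r \<le> m p p"
    using le_of_square_le_mult[OF rr mp] bound[OF r(1) p(1)] r(2)[OF r(1)] by (simp add: mult.commute)
  moreover have "0 \<le> a w w + 2 * a w r + a r r"
  proof -
    have "\<bar>a w r\<bar> \<le> sqrt (a w w) * sqrt (a r r)"
      using semi_inner_Cauchy_Schwarz[OF semia V(1) w(1) r(1)] .
    moreover have "2 * (sqrt (a w w) * sqrt (a r r)) \<le> a w w + a r r"
      using sum_squares_bound[of "sqrt (a w w)" "sqrt (a r r)"] ww rr by simp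
    ultimately show ?thesis by linarith
  qed
  ultimately have uu_le: "a u u \<le> 2 * a w w + 2 * m p p" using uu_expand by linarith
  \<comment> \<open>The representer \<open>t\<close> of the second residual component is tested
    against itself. A Cauchy-Schwarz inequality in the plane merges m t t and C t t into s t t,
    whose square root is then absorbed.\<close>
  have "s t t \<le> a u u + C p p"
  proof (rule le_of_square_le_mult)
    have "s t t = - c u t + C p t" using t Gq by simp
    also have "\<dots> \<le> sqrt (a u u) * sqrt (m t t) + sqrt (C p p) * sqrt (C t t)"
      using bound[OF u t(1)] semi_inner_Cauchy_Schwarz[OF C Q(1) p(1) t(1)] by linarith
    also have "\<dots> \<le> sqrt (a u u + C p p) * sqrt (m t t + C t t)"
    proof -
      have "(x * y + z * w)\<^sup>2 \<le> (x\<^sup>2 + z\<^sup>2) * (y\<^sup>2 + w\<^sup>2)" for x y z w :: real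
      proof -
        \<comment> \<open>Lagrange's identity for two vectors in the plane.\<close>
        have "(x\<^sup>2 + z\<^sup>2) * (y\<^sup>2 + w\<^sup>2) - (x * y + z * w)\<^sup>2 = (x * w - z * y)\<^sup>2"
          by (simp add: power2_eq_square algebra_simps)
        then show ?thesis using zero_le_power2[of "x * w - z * y"] by linarith
      qed
      from this[of "sqrt (a u u)" "sqrt (m t t)" "sqrt (C p p)" "sqrt (C t t)"]
      have "(sqrt (a u u) * sqrt (m t t) + sqrt (C p p) * sqrt (C t t))\<^sup>2 \<le>
        (a u u + C p p) * (m t t + C t t)" using uu Cp mt Ct by simp
      then show ?thesis using real_le_rsqrt by (simp add: real_sqrt_mult[symmetric])
    qed
    also have "m t t + C t t = s t t" using s[OF t(1) t(1)] by simp
    finally show "s t t \<le> sqrt (a u u + C p p) * sqrt (s t t)" .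
  qed (use uu Cp stt in auto)
  then have "a w w + s t t \<le> 3 * a w w + 2 * m p p + C p p" using uu_le by simp
  also have "\<dots> \<le> 3 * (a w w + s p p)" using s[OF p(1) p(1)] Cp mp by simp
  finally have "a w w + s t t \<le> 3 * (a w w + s p p)" .
  then have "sqrt (a w w + s t t) \<le> sqrt (3 * (a w w + s p p))" by (rule real_sqrt_le_mono)
  also have "\<dots> = sqrt 3 * sqrt (a w w + s p p)" by (rule real_sqrt_mult)
  \<comment> \<open>The factor sqrt 3 is rounded up to 3.\<close>
  also have "\<dots> \<le> 3 * sqrt (a w w + s p p)"
    using denpos by (intro mult_right_mono real_le_lsqrt) auto
  finally show "dual_norm BD (A (BU x')) / dual_norm BD x' \<le> 3"
    unfolding dual_norm_def num2 den using denpos by (simp add: field_simps)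
qed

section \<open>Square integrable functions\<close>

text \<open>One notion for scalar, vector and matrix fields, stated for a measure so that
  \<open>lebesgue_on \<Omega>\<close> replaces set integrals throughout.\<close>

definition sq_integrable :: "'a measure \<Rightarrow> ('a \<Rightarrow> 'b::euclidean_space) \<Rightarrow> bool"
  where "sq_integrable N f \<longleftrightarrow> f \<in> borel_measurable N \<and> integrable N (\<lambda>x. f x \<bullet> f x)"

lemma sq_integrable_measurable: "sq_integrable N f \<Longrightarrow> f \<in> borel_measurable N"
  by (simp add: sq_integrable_def)

lemma sq_integrable_inner:
  assumes "sq_integrable N f" "sq_integrable N g"
  shows "integrable N (\<lambda>x. f x \<bullet> g x)"
proof (rule Bochner_Integration.integrable_bound)
  show "integrable N (\<lambda>x. f x \<bullet> f x + g x \<bullet> g x)"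
    using assms by (auto simp: sq_integrable_def)
  show "(\<lambda>x. f x \<bullet> g x) \<in> borel_measurable N"
    using assms by (auto simp: sq_integrable_def)
  have "\<bar>x \<bullet> y\<bar> \<le> x \<bullet> x + y \<bullet> y" for x y :: 'b
  proof -
    have "\<bar>x \<bullet> y\<bar> \<le> norm x * norm y" by (rule Cauchy_Schwarz_ineq2)
    moreover have "2 * (norm x * norm y) \<le> x \<bullet> x + y \<bullet> y"
      using sum_squares_bound[of "norm x" "norm y"] by (simp add: dot_square_norm)
    moreover have "0 \<le> norm x * norm y" by simp
    ultimately show ?thesis by linarith
  qed
  then show "AE x in N. norm (f x \<bullet> g x) \<le> norm (f x \<bullet> f x + g x \<bullet> g x)"
    by (simp add: add_nonneg_nonneg)
qed

lemma sq_integrable_lincomb: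
  assumes f: "sq_integrable N f" and g: "sq_integrable N g"
  shows "sq_integrable N (\<lambda>x. c *\<^sub>R f x + d *\<^sub>R g x)"
  unfolding sq_integrable_def
proof
  show "(\<lambda>x. c *\<^sub>R f x + d *\<^sub>R g x) \<in> borel_measurable N"
    using f g by (auto simp: sq_integrable_def)
  have "integrable N (\<lambda>x. c\<^sup>2 * (f x \<bullet> f x) + 2 * c * d * (f x \<bullet> g x) + d\<^sup>2 * (g x \<bullet> g x))"
    using sq_integrable_inner[OF f f] sq_integrable_inner[OF f g] sq_integrable_inner[OF g g]
    by auto
  then show "integrable N (\<lambda>x. (c *\<^sub>R f x + d *\<^sub>R g x) \<bullet> (c *\<^sub>R f x + d *\<^sub>R g x))"
    by (simp add: inner_add_left inner_add_right inner_commute power2_eq_square algebra_simps)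
qed

lemma sq_integrable_zero: "sq_integrable N (\<lambda>_. 0)"
  by (simp add: sq_integrable_def)

lemma sq_integrable_diff: "sq_integrable N f \<Longrightarrow> sq_integrable N g \<Longrightarrow> sq_integrable N (\<lambda>x. f x - g x)"
  using sq_integrable_lincomb[of N f g 1 "-1"] by simp

lemma sq_integrable_components:
  "sq_integrable N f \<longleftrightarrow> (\<forall>b\<in>Basis. sq_integrable N (\<lambda>x. f x \<bullet> b))"
proof
  assume f: "sq_integrable N f"
  show "\<forall>b\<in>Basis. sq_integrable N (\<lambda>x. f x \<bullet> b)"
    unfolding sq_integrable_def
  proof (intro ballI conjI)
    fix b :: 'b assume b: "b \<in> Basis"
    show "(\<lambda>x. f x \<bullet> b) \<in> borel_measurable N" using f by (auto simp: sq_integrable_def)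
    then show "integrable N (\<lambda>x. (f x \<bullet> b) \<bullet> (f x \<bullet> b))"
    proof (rule Bochner_Integration.integrable_bound[OF sq_integrable_inner[OF f f] borel_measurable_inner])
      have "(y \<bullet> b) * (y \<bullet> b) \<le> y \<bullet> y" for y :: 'b
        using Cauchy_Schwarz_ineq[of y b] b by (simp add: power2_eq_square inner_Basis)
      then show "AE x in N. norm ((f x \<bullet> b) \<bullet> (f x \<bullet> b)) \<le> norm (f x \<bullet> f x)" by simp
    qed (use \<open>(\<lambda>x. f x \<bullet> b) \<in> borel_measurable N\<close> in auto)
  qed
next
  assume f: "\<forall>b\<in>Basis. sq_integrable N (\<lambda>x. f x \<bullet> b)"
  show "sq_integrable N f"
    unfolding sq_integrable_def
  proof
    show "f \<in> borel_measurable N"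
      using f borel_measurable_euclidean_space[of f N] by (auto simp: sq_integrable_def)
    have "integrable N (\<lambda>x. \<Sum>b\<in>Basis. (f x \<bullet> b) \<bullet> (f x \<bullet> b))"
      using f by (intro Bochner_Integration.integrable_sum) (auto simp: sq_integrable_def)
    then show "integrable N (\<lambda>x. f x \<bullet> f x)"
      by (subst euclidean_inner) simp
  qed
qed

text \<open>\<open>is_weak_grad\<close> asks for square integrability of each component; this joins
  the components into one condition on the field, and applied to rows it serves matrix fields
  too.\<close>

lemma sq_integrable_vec:
  fixes f :: "'a \<Rightarrow> 'b::euclidean_space^'n"
  shows "sq_integrable N f \<longleftrightarrow> (\<forall>i. sq_integrable N (\<lambda>x. f x $ i))"
proof -
  have "sq_integrable N f \<longleftrightarrow> (\<forall>i. \<forall>b\<in>Basis. sq_integrable N (\<lambda>x. f x \<bullet> axis i b))"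
    unfolding sq_integrable_components[of N f] by (auto simp: Basis_vec_def)
  also have "\<dots> \<longleftrightarrow> (\<forall>i. \<forall>b\<in>Basis. sq_integrable N (\<lambda>x. f x $ i \<bullet> b))"
    by (simp add: inner_axis)
  also have "\<dots> \<longleftrightarrow> (\<forall>i. sq_integrable N (\<lambda>x. f x $ i))"
    by (subst (2) sq_integrable_components) simp
  finally show ?thesis .
qed

lemma semi_inner_sq_integrable:
  "semi_inner_on {f. sq_integrable N f} (\<lambda>f g. LINT x|N. f x \<bullet> g x)"
  unfolding semi_inner_on_def linear_fun_def
  by (auto simp: inner_add_right sq_integrable_inner inner_commute)

lemma fun_subspace_sq_integrable: "fun_subspace {f. sq_integrable N f}"
  by (simp add: fun_subspace_def sq_integrable_zero sq_integrable_lincomb)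

lemma AE_eq_zero_of_norm_zero:
  assumes "sq_integrable N f" "(LINT x|N. f x \<bullet> f x) = 0"
  shows "AE x in N. f x = 0"
  using assms integral_nonneg_eq_0_iff_AE[OF sq_integrable_inner[OF assms(1,1)]] by simp

lemma set_integral_eq_lebesgue_on:
  assumes "\<Omega> \<in> sets lebesgue"
  shows "(LINT x:\<Omega>|lebesgue. f x) = (LINT x|lebesgue_on \<Omega>. (f x :: real))"
  unfolding set_lebesgue_integral_def using assms by (subst integral_restrict_space) auto

lemma L2_iff_sq_integrable:
  assumes "\<Omega> \<in> sets lebesgue"
  shows "f \<in> L2 \<Omega> \<longleftrightarrow> sq_integrable (lebesgue_on \<Omega>) f"
  using assms unfolding L2_def sq_integrable_def set_borel_measurable_def set_integrable_def
  by (simp add: borel_measurable_restrict_space_iff integrable_restrict_space power2_eq_square)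

lemma l2_inner_eq:
  assumes "\<Omega> \<in> sets lebesgue"
  shows "l2_inner \<Omega> f g = (LINT x|lebesgue_on \<Omega>. f x \<bullet> g x)"
  unfolding l2_inner_def by (rule set_integral_eq_lebesgue_on[OF assms])

lemma is_weak_grad_iff:
  assumes "\<Omega> \<in> sets lebesgue"
  shows "is_weak_grad \<Omega> u G \<longleftrightarrow> sq_integrable (lebesgue_on \<Omega>) G \<and>
    (\<forall>\<phi>\<in>test_functions \<Omega>. \<forall>i. (LINT x|lebesgue_on \<Omega>. u x * pderiv_at i \<phi> x) =
       - (LINT x|lebesgue_on \<Omega>. G x $ i * \<phi> x))"
  unfolding is_weak_grad_def sq_integrable_vec[of _ G] set_integral_eq_lebesgue_on[OF assms]
    L2_iff_sq_integrable[OF assms] ..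

section \<open>Test functions\<close>

lemma pderiv_at_eqI: "(f has_derivative F) (at x) \<Longrightarrow> pderiv_at i f x = F (axis i 1)"
  unfolding pderiv_at_def by (metis frechet_derivative_at)

lemma pderiv_at_line:
  fixes f :: "real^'n \<Rightarrow> real"
  assumes "f differentiable (at (x + t *\<^sub>R axis i 1))"
  shows "((\<lambda>s. f (x + s *\<^sub>R axis i 1)) has_real_derivative pderiv_at i f (x + t *\<^sub>R axis i 1)) (at t)"
proof -
  let ?F = "frechet_derivative f (at (x + t *\<^sub>R axis i 1))"
  have F: "(f has_derivative ?F) (at (x + t *\<^sub>R axis i 1))"
    using assms by (simp add: frechet_derivative_works)
  have "((\<lambda>s. x + s *\<^sub>R axis i 1) has_derivative (\<lambda>s. s *\<^sub>R axis i 1)) (at t)"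
    by (auto intro!: derivative_eq_intros)
  then have "((\<lambda>s. f (x + s *\<^sub>R axis i 1)) has_derivative (\<lambda>s. ?F (s *\<^sub>R axis i 1))) (at t)"
    using has_derivative_compose[of "\<lambda>s. x + s *\<^sub>R axis i 1" _ t UNIV f ?F] F by simp
  moreover have "?F (s *\<^sub>R axis i 1) = s * pderiv_at i f (x + t *\<^sub>R axis i 1)" for s
    using linear_scale[OF has_derivative_linear[OF F]] by (simp add: pderiv_at_def)
  ultimately show ?thesis by (simp add: has_field_derivative_def mult_commute_abs)
qed

lemma integral_translate_lborel:
  fixes f :: "'a::euclidean_space \<Rightarrow> real"
  assumes "f \<in> borel_measurable borel"
  shows "(LINT x|lborel. f (x + c)) = (LINT x|lborel. f x)"
    and "integrable lborel f \<Longrightarrow> integrable lborel (\<lambda>x. f (x + c))"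
proof -
  have "(LINT x|lborel. f x) = (LINT x|distr lborel borel ((+) c). f x)"
    by (simp add: lborel_distr_plus)
  also have "\<dots> = (LINT x|lborel. f (c + x))" by (rule integral_distr) (use assms in auto)
  finally show "(LINT x|lborel. f (x + c)) = (LINT x|lborel. f x)" by (simp add: add.commute)
  assume "integrable lborel f"
  then have "integrable (distr lborel borel ((+) c)) f" by (simp add: lborel_distr_plus)
  then have "integrable lborel (\<lambda>x. f (c + x))"
    by (subst (asm) integrable_distr_eq) (use assms in auto)
  then show "integrable lborel (\<lambda>x. f (x + c))" by (simp add: add.commute)
qed

lemma integrable_continuous_bounded_support:
  fixes f :: "'a::euclidean_space \<Rightarrow> real"
  assumes "continuous_on UNIV f" and supp: "\<And>x. R < norm x \<Longrightarrow> f x = 0"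
  shows "integrable lborel f"
proof -
  have "integrable lborel (\<lambda>x. indicator (cball 0 R) x *\<^sub>R f x)"
    by (rule borel_integrable_compact) (use assms(1) continuous_on_subset in auto)
  moreover have "(\<lambda>x. indicator (cball 0 R) x *\<^sub>R f x) = f"
    using supp by (auto simp: indicator_def fun_eq_iff)
  ultimately show ?thesis by simp
qed

text \<open>The partial derivative is the pointwise limit of difference quotients, each of which
  integrates to zero by translation invariance; dominated convergence passes to the limit. No
  iterated integration is involved.\<close>

lemma integral_pderiv_eq_0:
  fixes f :: "real^'n \<Rightarrow> real"
  assumes diff: "\<And>x. f differentiable (at x)" and cont: "continuous_on UNIV (pderiv_at i f)"
    and supp: "\<And>x. R < norm x \<Longrightarrow> f x = 0"
  shows "integrable lborel (pderiv_at i f)" and "(LINT x|lborel. pderiv_at i f x) = 0"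
proof -
  let ?e = "axis i 1 :: real^'n"
  have ne: "norm ?e = 1" by (simp add: norm_axis_1)
  define t where "t n = inverse (real (Suc n))" for n
  have t: "0 < t n" "t n \<le> 1" for n by (auto simp: t_def field_simps)
  have fc: "continuous_on UNIV f"
    using diff by (intro continuous_at_imp_continuous_on) (auto intro: differentiable_imp_continuous_within)
  then have fm: "f \<in> borel_measurable borel" by (rule borel_measurable_continuous_onI)
  have fi: "integrable lborel f" by (rule integrable_continuous_bounded_support[OF fc supp])
  \<comment> \<open>Radius R + 2, because below a point of norm at most R + 1 is shifted by less
    than 1 to the intermediate point of the mean value theorem.\<close>
  have "bounded (pderiv_at i f ` cball 0 (R + 2))"
    by (intro compact_imp_bounded compact_continuous_image continuous_on_subset[OF cont]) auto
  then obtain B where B: "\<And>x. norm x \<le> R + 2 \<Longrightarrow> \<bar>pderiv_at i f x\<bar> \<le> B"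
    unfolding bounded_iff by (metis imageI mem_cball_0 real_norm_def)
  define s where "s n x = (f (x + t n *\<^sub>R ?e) - f x) / t n" for n x
  \<comment> \<open>Since \<open>t n\<close> is at most 1, the difference quotients vanish beyond
    radius R + 1; within it the mean value theorem bounds them by \<open>B\<close>.\<close>
  define w where "w x = indicator (cball 0 (R + 1)) x *\<^sub>R B" for x :: "real^'n"
  have bound: "norm (s n x) \<le> w x" for n x
  proof (cases "norm x \<le> R + 1")
    case True
    have "\<exists>z>0. z < t n \<and> f (x + t n *\<^sub>R ?e) - f (x + 0 *\<^sub>R ?e) = (t n - 0) * pderiv_at i f (x + z *\<^sub>R ?e)"
      by (rule MVT2[OF t(1) pderiv_at_line[OF diff]])
    then obtain z where z: "0 < z" "z < t n" "f (x + t n *\<^sub>R ?e) - f x = t n * pderiv_at i f (x + z *\<^sub>R ?e)"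
      by auto
    have "norm (x + z *\<^sub>R ?e) \<le> norm x + z"
      using norm_triangle_ineq[of x "z *\<^sub>R ?e"] z(1) ne by simp
    then have "norm (x + z *\<^sub>R ?e) \<le> R + 2" using True z(2) t(2)[of n] by simp
    then show ?thesis using B True z(3) t(1)[of n] by (simp add: s_def w_def)
  next
    case False
    have "norm x \<le> norm (x + t n *\<^sub>R ?e) + norm (t n *\<^sub>R ?e)"
      using norm_triangle_ineq4[of "x + t n *\<^sub>R ?e" "t n *\<^sub>R ?e"] by simp
    also have "norm (t n *\<^sub>R ?e) = t n" using ne t[of n] by simp
    finally have "R < norm (x + t n *\<^sub>R ?e)" using False t(2)[of n] by simp
    then show ?thesis using supp[of x] supp[of "x + t n *\<^sub>R ?e"] False by (simp add: s_def w_def)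
  qed
  have lim: "(\<lambda>n. s n x) \<longlonglongrightarrow> pderiv_at i f x" for x
  proof -
    have "((\<lambda>u. (f (x + (0 + u) *\<^sub>R ?e) - f (x + 0 *\<^sub>R ?e)) / u) \<longlongrightarrow> pderiv_at i f (x + 0 *\<^sub>R ?e)) (at 0)"
      using pderiv_at_line[of f x 0 i] diff unfolding DERIV_def by blast
    moreover have "filterlim t (at 0) sequentially"
      unfolding filterlim_at
    proof
      show "\<forall>\<^sub>F n in sequentially. t n \<in> UNIV \<and> t n \<noteq> 0" using t by (auto simp: less_imp_neq[symmetric])
      show "t \<longlonglongrightarrow> 0" unfolding t_def by (rule LIMSEQ_inverse_real_of_nat)
    qed
    ultimately show ?thesis unfolding s_def by (auto dest: filterlim_compose)
  qed
  have wi: "integrable lborel w"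
    unfolding w_def by (rule borel_integrable_compact) auto
  have pm: "pderiv_at i f \<in> borel_measurable lborel"
    using borel_measurable_continuous_onI[OF cont] by simp
  have tm: "(\<lambda>x. f (x + c)) \<in> borel_measurable borel" for c
    using fm by (rule measurable_compose[rotated]) simp
  have sm: "s n \<in> borel_measurable lborel" for n
    unfolding s_def using fm tm by simp
  have s0: "(LINT x|lborel. s n x) = 0" for n
    unfolding s_def
    using fi integral_translate_lborel[OF fm, of "t n *\<^sub>R ?e"] by simp
  show "integrable lborel (pderiv_at i f)"
    by (rule integrable_dominated_convergence[where s=s and w=w]) (use pm sm wi lim bound in auto)
  have "(\<lambda>n. LINT x|lborel. s n x) \<longlonglongrightarrow> (LINT x|lborel. pderiv_at i f x)"
    by (rule integral_dominated_convergence[where w=w]) (use pm sm wi lim bound in auto)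
  then show "(LINT x|lborel. pderiv_at i f x) = 0"
    using s0 LIMSEQ_unique[OF _ tendsto_const] by simp
qed

section \<open>Rules for partial derivatives and linear combinations of test functions\<close>

lemma has_derivative_pderiv_at:
  assumes "f differentiable (at x)"
  shows "\<exists>F. (f has_derivative F) (at x) \<and> (\<forall>i. pderiv_at i f x = F (axis i 1))"
  using assms pderiv_at_eqI[of f _ x] unfolding differentiable_def by metis

lemma pderiv_at_lincomb:
  fixes f g :: "real^'n \<Rightarrow> real"
  assumes "f differentiable (at x)" "g differentiable (at x)"
  shows "pderiv_at i (\<lambda>x. c * f x + d * g x) x = c * pderiv_at i f x + d * pderiv_at i g x"
proof -
  obtain F G where F: "(f has_derivative F) (at x)" "pderiv_at i f x = F (axis i 1)"
    and G: "(g has_derivative G) (at x)" "pderiv_at i g x = G (axis i 1)"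
    using has_derivative_pderiv_at[OF assms(1)] has_derivative_pderiv_at[OF assms(2)] by metis
  have "((\<lambda>x. c * f x + d * g x) has_derivative (\<lambda>v. c * F v + d * G v)) (at x)"
    by (intro has_derivative_add has_derivative_mult_right F(1) G(1))
  from pderiv_at_eqI[OF this] show ?thesis using F(2) G(2) by simp
qed

lemma pderiv_at_mult:
  fixes f g :: "real^'n \<Rightarrow> real"
  assumes "f differentiable (at x)" "g differentiable (at x)"
  shows "pderiv_at i (\<lambda>x. f x * g x) x = f x * pderiv_at i g x + pderiv_at i f x * g x"
proof -
  obtain F G where F: "(f has_derivative F) (at x)" "pderiv_at i f x = F (axis i 1)"
    and G: "(g has_derivative G) (at x)" "pderiv_at i g x = G (axis i 1)"
    using has_derivative_pderiv_at[OF assms(1)] has_derivative_pderiv_at[OF assms(2)] by metis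
  have "((\<lambda>x. f x * g x) has_derivative (\<lambda>v. f x * G v + F v * g x)) (at x)"
    by (rule has_derivative_mult[OF F(1) G(1)])
  from pderiv_at_eqI[OF this] show ?thesis using F(2) G(2) by simp
qed

lemma C_k_lincomb:
  fixes f g :: "real^'n \<Rightarrow> real"
  shows "C_k k f \<Longrightarrow> C_k k g \<Longrightarrow> C_k k (\<lambda>x. c * f x + d * g x)"
proof (induction k arbitrary: f g)
  case 0
  then show ?case by (auto intro!: continuous_intros)
next
  case (Suc k)
  have d: "f differentiable (at x)" "g differentiable (at x)" for x using Suc.prems by auto
  have "pderiv_at i (\<lambda>x. c * f x + d * g x) = (\<lambda>x. c * pderiv_at i f x + d * pderiv_at i g x)" for i
    using pderiv_at_lincomb[OF d] by blast
  moreover have "C_k k (\<lambda>x. c * pderiv_at i f x + d * pderiv_at i g x)" for i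
    by (rule Suc.IH) (use Suc.prems in auto)
  moreover have "(\<lambda>x. c * f x + d * g x) differentiable (at x)" for x
    using d[of x] by (intro derivative_intros) auto
  ultimately show ?case by simp
qed

lemma test_functions_lincomb:
  fixes \<Omega> :: "(real^'n) set"
  assumes "\<phi> \<in> test_functions \<Omega>" "\<psi> \<in> test_functions \<Omega>"
  shows "(\<lambda>x. c * \<phi> x + d * \<psi> x) \<in> test_functions \<Omega>"
proof -
  let ?A = "closure {x. \<phi> x \<noteq> 0}" and ?B = "closure {x. \<psi> x \<noteq> 0}"
  let ?S = "closure {x. c * \<phi> x + d * \<psi> x \<noteq> 0}"
  have "?S \<subseteq> closure ({x. \<phi> x \<noteq> 0} \<union> {x. \<psi> x \<noteq> 0})" by (intro closure_mono) auto
  then have sub: "?S \<subseteq> ?A \<union> ?B" by simp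
  then have "compact ?S"
    using assms compact_Int_closed[of "?A \<union> ?B" ?S]
    by (auto simp: test_functions_def compact_Un Int_absorb1)
  then show ?thesis using sub assms by (auto simp: test_functions_def C_k_lincomb)
qed

lemma zero_test_function: "(\<lambda>_. 0) \<in> test_functions \<Omega>" for \<Omega> :: "(real^'n) set"
proof -
  have "C_k k (\<lambda>_::real^'n. 0 :: real)" for k
  proof (induction k)
    case (Suc k)
    have "pderiv_at i (\<lambda>_. 0) = (\<lambda>_::real^'n. 0 :: real)" for i
      using pderiv_at_eqI[OF has_derivative_const] by (auto simp: fun_eq_iff)
    with Suc show ?case by simp
  qed simp
  then show ?thesis by (auto simp: test_functions_def)
qed

section \<open>Smooth functions of one variable and smooth bumps on boxes\<close>

primrec smooth1 :: "nat \<Rightarrow> (real \<Rightarrow> real) \<Rightarrow> bool" where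
  "smooth1 0 f = continuous_on UNIV f"
| "smooth1 (Suc k) f = (\<exists>f'. (\<forall>x. (f has_real_derivative f' x) (at x)) \<and> smooth1 k f')"

text \<open>\<open>smooth1\<close> quantifies existentially over the derivative, so smoothness is
  proved by exhibiting a formula for it.\<close>

lemma smooth1_SucI:
  "(\<And>x. (f has_real_derivative f' x) (at x)) \<Longrightarrow> smooth1 k f' \<Longrightarrow> smooth1 (Suc k) f"
  unfolding smooth1.simps by blast

lemma smooth1_SucE:
  assumes "smooth1 (Suc k) f"
  obtains f' where "\<And>x. (f has_real_derivative f' x) (at x)" "smooth1 k f'"
  using assms unfolding smooth1.simps by blast

lemma continuous_on_of_DERIV:
  fixes f :: "real \<Rightarrow> real"
  assumes "\<And>x. (f has_real_derivative f' x) (at x)"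
  shows "continuous_on UNIV f"
  by (rule DERIV_continuous_on) (rule assms[THEN has_field_derivative_at_within])

text \<open>The product rule leaves one factor undifferentiated, so products need smoothness of one
  order lower as well.\<close>

lemma smooth1_SucD: "smooth1 (Suc k) f \<Longrightarrow> smooth1 k f"
proof (induction k arbitrary: f)
  case 0
  then obtain f' where "\<And>x. (f has_real_derivative f' x) (at x)" by (rule smooth1_SucE) blast
  then show ?case unfolding smooth1.simps by (rule continuous_on_of_DERIV)
next
  case (Suc k)
  obtain f' where "\<And>x. (f has_real_derivative f' x) (at x)" "smooth1 (Suc k) f'"
    using Suc.prems by (rule smooth1_SucE) blast
  with Suc.IH[of f'] show ?case by (intro smooth1_SucI)
qed

lemma smooth1_add: "smooth1 k f \<Longrightarrow> smooth1 k g \<Longrightarrow> smooth1 k (\<lambda>x. f x + g x)"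
proof (induction k arbitrary: f g)
  case (Suc k)
  obtain f' where f': "\<And>x. (f has_real_derivative f' x) (at x)" "smooth1 k f'"
    using Suc.prems(1) by (rule smooth1_SucE) blast
  obtain g' where g': "\<And>x. (g has_real_derivative g' x) (at x)" "smooth1 k g'"
    using Suc.prems(2) by (rule smooth1_SucE) blast
  show ?case by (rule smooth1_SucI[OF DERIV_add[OF f'(1) g'(1)] Suc.IH[OF f'(2) g'(2)]])
qed (auto intro: continuous_intros)

lemma smooth1_mult: "smooth1 k f \<Longrightarrow> smooth1 k g \<Longrightarrow> smooth1 k (\<lambda>x. f x * g x)"
proof (induction k arbitrary: f g)
  case (Suc k)
  obtain f' where f': "\<And>x. (f has_real_derivative f' x) (at x)" "smooth1 k f'"
    using Suc.prems(1) by (rule smooth1_SucE) blast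
  obtain g' where g': "\<And>x. (g has_real_derivative g' x) (at x)" "smooth1 k g'"
    using Suc.prems(2) by (rule smooth1_SucE) blast
  have "smooth1 k (\<lambda>x. f' x * g x + g' x * f x)"
    using Suc.IH[OF f'(2) smooth1_SucD[OF Suc.prems(2)]] Suc.IH[OF g'(2) smooth1_SucD[OF Suc.prems(1)]]
    by (rule smooth1_add)
  then show ?case by (rule smooth1_SucI[OF DERIV_mult[OF f'(1) g'(1)]])
qed (auto intro: continuous_intros)

lemma smooth1_const: "smooth1 k (\<lambda>_. c)"
proof (induction k arbitrary: c)
  case (Suc k)
  show ?case by (rule smooth1_SucI[OF DERIV_const Suc.IH])
qed simp

lemma smooth1_affine: "smooth1 k f \<Longrightarrow> smooth1 k (\<lambda>x. f (r * x + s))"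
proof (induction k arbitrary: f)
  case 0
  then have "continuous_on UNIV f" by simp
  then have "continuous_on UNIV (\<lambda>x. f (r * x + s))"
    by (rule continuous_on_compose2) (auto intro!: continuous_intros)
  then show ?case by simp
next
  case (Suc k)
  obtain f' where D: "\<And>x. (f has_real_derivative f' x) (at x)" "smooth1 k f'"
    using Suc.prems by (rule smooth1_SucE) blast
  have "((\<lambda>x. f (r * x + s)) has_real_derivative f' (r * x + s) * r) (at x)" for x
    by (rule DERIV_chain2[OF D(1)]) (auto intro!: derivative_eq_intros)
  then show ?case by (rule smooth1_SucI[OF _ smooth1_mult[OF Suc.IH[OF D(2)] smooth1_const]])
qed

lemma poly_times_exp_tendsto_0:
  fixes c :: real assumes "c > 0"
  shows "((\<lambda>y. poly p y * exp (- c * y)) \<longlongrightarrow> 0) at_top"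
proof -
  have "((\<lambda>y. y ^ i * exp (- c * y)) \<longlongrightarrow> 0) at_top" for i
  proof -
    have "filterlim (\<lambda>y. c * y) at_top at_top"
      using assms by (intro filterlim_tendsto_pos_mult_at_top[OF tendsto_const]) (auto simp: filterlim_ident)
    then have "((\<lambda>y. (c * y) ^ i / exp (c * y)) \<longlongrightarrow> 0) at_top"
      by (rule filterlim_compose[OF tendsto_power_div_exp_0])
    from tendsto_mult[OF this tendsto_const[of "1 / c ^ i"]]
    show ?thesis using assms by (simp add: power_mult_distrib exp_minus field_simps)
  qed
  then have "((\<lambda>y. \<Sum>i\<le>degree p. coeff p i * (y ^ i * exp (- c * y))) \<longlongrightarrow> (\<Sum>i\<le>degree p. coeff p i * 0)) at_top"
    by (intro tendsto_sum tendsto_mult tendsto_const)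
  then show ?thesis by (simp add: poly_altdef sum_distrib_right mult.assoc)
qed

text \<open>The classical flat function exp (- c / x), with a polynomial in 1 / x in front so that
  the family is closed under differentiation.\<close>

definition flat :: "real \<Rightarrow> real poly \<Rightarrow> real \<Rightarrow> real"
  where "flat c p x = (if x > 0 then poly p (1 / x) * exp (- c / x) else 0)"

text \<open>With y = 1 / x, so dy/dx = - y^2, differentiation replaces p(y) by y^2 (c p(y) -
  p'(y)).\<close>

lemma flat_DERIV:
  assumes c: "c > 0"
  shows "(flat c p has_real_derivative flat c ([:0, 0, 1:] * (smult c p - pderiv p)) x) (at x)"
proof -
  consider "x > 0" | "x < 0" | "x = 0" by linarith
  then show ?thesis
  proof cases
    case 1
    have "((\<lambda>x. poly p (1 / x)) has_real_derivative poly (pderiv p) (1 / x) * (- 1 / x\<^sup>2)) (at x)"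
      by (rule DERIV_chain2[OF poly_DERIV])
        (rule derivative_eq_intros refl | use 1 in \<open>simp add: power2_eq_square\<close>)+
    moreover have "((\<lambda>x. exp (- c / x)) has_real_derivative exp (- c / x) * (c / x\<^sup>2)) (at x)"
      by (rule DERIV_chain2[OF DERIV_exp])
        (rule derivative_eq_intros refl | use 1 in \<open>simp add: power2_eq_square\<close>)+
    ultimately have "((\<lambda>x. poly p (1 / x) * exp (- c / x)) has_real_derivative
      poly (pderiv p) (1 / x) * (- 1 / x\<^sup>2) * exp (- c / x) +
      exp (- c / x) * (c / x\<^sup>2) * poly p (1 / x)) (at x)"
      by (rule DERIV_mult)
    moreover have "poly (pderiv p) (1 / x) * (- 1 / x\<^sup>2) * exp (- c / x) +
      exp (- c / x) * (c / x\<^sup>2) * poly p (1 / x) = flat c ([:0, 0, 1:] * (smult c p - pderiv p)) x"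
      using 1 by (simp add: flat_def power2_eq_square algebra_simps)
    ultimately have "((\<lambda>x. poly p (1 / x) * exp (- c / x)) has_real_derivative
      flat c ([:0, 0, 1:] * (smult c p - pderiv p)) x) (at x)" by simp
    then show ?thesis
      by (rule has_field_derivative_transform_within_open[of _ _ _ "{0<..}"])
        (use 1 in \<open>auto simp: flat_def\<close>)
  next
    case 2
    have "((\<lambda>x. 0) has_real_derivative flat c ([:0, 0, 1:] * (smult c p - pderiv p)) x) (at x)"
      using 2 unfolding flat_def by simp
    then show ?thesis
      by (rule has_field_derivative_transform_within_open[of _ _ _ "{..<0}"])
        (use 2 in \<open>auto simp: flat_def\<close>)
  next
    case 3
    \<comment> \<open>At the origin the difference quotient is again of the same type: dividing by
      \<open>h\<close> multiplies the polynomial by 1 / h, and the exponential decay still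
      wins.\<close>
    have "((\<lambda>h. flat c p h / h) \<longlongrightarrow> 0) (at 0)"
    proof (rule filterlim_split_at)
      show "((\<lambda>h. flat c p h / h) \<longlongrightarrow> 0) (at_left 0)"
        by (rule tendsto_eventually) (simp add: flat_def eventually_at_filter)
      have "((\<lambda>h. poly (pCons 0 p) (inverse h) * exp (- c * inverse h)) \<longlongrightarrow> 0) (at_right 0)"
        by (rule filterlim_compose[OF poly_times_exp_tendsto_0[OF c] filterlim_inverse_at_top_right])
      moreover have "\<forall>\<^sub>F h in at_right 0. poly (pCons 0 p) (inverse h) * exp (- c * inverse h) = flat c p h / h"
        by (simp add: flat_def eventually_at_filter divide_inverse mult.assoc mult.left_commute)
      ultimately show "((\<lambda>h. flat c p h / h) \<longlongrightarrow> 0) (at_right 0)"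
        by (rule Lim_transform_eventually)
    qed
    then show ?thesis unfolding 3 DERIV_def by (simp add: flat_def)
  qed
qed

lemma smooth1_flat:
  assumes "c > 0"
  shows "smooth1 k (flat c p)"
proof (induction k arbitrary: p)
  case 0
  have "continuous_on UNIV (flat c p)"
    by (rule continuous_on_of_DERIV[where f'="flat c ([:0, 0, 1:] * (smult c p - pderiv p))"])
      (rule flat_DERIV[OF assms])
  then show ?case unfolding smooth1.simps .
next
  case (Suc k)
  show ?case
    by (rule smooth1_SucI[where f'="flat c ([:0, 0, 1:] * (smult c p - pderiv p))"])
      (rule flat_DERIV[OF assms], rule Suc.IH)
qed

text \<open>A partial derivative of a product of one-variable functions is again such a product with
  one factor replaced by its derivative. Letting the factors depend on the coordinate keeps the
  induction closed.\<close>

lemma C_k_prod_components: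
  fixes g :: "'n::finite \<Rightarrow> real \<Rightarrow> real"
  shows "(\<And>i. smooth1 k (g i)) \<Longrightarrow> C_k k (\<lambda>x::real^'n. \<Prod>i\<in>UNIV. g i (x $ i))"
proof (induction k arbitrary: g)
  case 0
  have "continuous_on UNIV (\<lambda>x::real^'n. g i (x $ i))" for i
    by (rule continuous_on_compose2[OF 0[of i, unfolded smooth1.simps]])
      (auto intro!: continuous_intros)
  then show ?case unfolding C_k.simps by (rule continuous_on_prod)
next
  case (Suc k)
  obtain g' where g': "\<And>i x. (g i has_real_derivative g' i x) (at x)" "\<And>i. smooth1 k (g' i)"
  proof -
    have "\<forall>i. \<exists>f'. (\<forall>x. (g i has_real_derivative f' x) (at x)) \<and> smooth1 k f'"
      using Suc.prems unfolding smooth1.simps by blast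
    then show thesis using that by metis
  qed
  let ?f = "\<lambda>x::real^'n. \<Prod>i\<in>UNIV. g i (x $ i)"
  have gi: "((\<lambda>x. g i (x $ i)) has_derivative (\<lambda>v. g' i (x $ i) * v $ i)) (at x)" for i and x :: "real^'n"
  proof -
    have "((\<lambda>x::real^'n. x $ i) has_derivative (\<lambda>v. v $ i)) (at x)"
      by (intro bounded_linear_imp_has_derivative bounded_linear_vec_nth)
    from has_derivative_compose[OF this, of "g i" "(*) (g' i (x $ i))"] show ?thesis
      using g'(1)[of i "x $ i"] by (simp add: has_field_derivative_def)
  qed
  have D: "(?f has_derivative (\<lambda>v. \<Sum>i\<in>UNIV. g' i (x $ i) * v $ i * (\<Prod>j\<in>UNIV - {i}. g j (x $ j)))) (at x)" for x
    by (rule has_derivative_prod) (rule gi)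
  have "pderiv_at j ?f x = (\<Prod>i\<in>UNIV. (if i = j then g' j else g i) (x $ i))" for j x
  proof -
    have "pderiv_at j ?f x = (\<Sum>i\<in>UNIV. g' i (x $ i) * axis j 1 $ i * (\<Prod>j\<in>UNIV - {i}. g j (x $ j)))"
      by (rule pderiv_at_eqI[OF D])
    also have "\<dots> = (\<Sum>i\<in>UNIV. if i = j then g' j (x $ j) * (\<Prod>i\<in>UNIV - {j}. g i (x $ i)) else 0)"
      by (intro sum.cong) (auto simp: axis_def)
    also have "\<dots> = g' j (x $ j) * (\<Prod>i\<in>UNIV - {j}. g i (x $ i))" by simp
    also have "\<dots> = (\<Prod>i\<in>UNIV. (if i = j then g' j else g i) (x $ i))"
      by (subst (2) prod.remove[of _ j]) (auto intro!: prod.cong)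
    finally show ?thesis .
  qed
  then have P: "pderiv_at j ?f = (\<lambda>x. \<Prod>i\<in>UNIV. (if i = j then g' j else g i) (x $ i))" for j by blast
  have "C_k k (pderiv_at j ?f)" for j
    unfolding P by (rule Suc.IH) (simp add: g'(2) smooth1_SucD[OF Suc.prems])
  moreover have "?f differentiable (at x)" for x using D by (auto simp: differentiable_def)
  ultimately show ?case by simp
qed

definition box_bump :: "real \<Rightarrow> real^'n \<Rightarrow> real^'n \<Rightarrow> real^'n \<Rightarrow> real"
  where "box_bump c a b x = (\<Prod>i\<in>UNIV. flat c 1 (x $ i - a $ i) * flat c 1 (b $ i - x $ i))"

lemma box_bump_outside: "x \<notin> box a b \<Longrightarrow> box_bump c a b x = 0"
  unfolding box_bump_def mem_box_cart
  by (rule prod_zero) (auto simp: flat_def)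

text \<open>The bump is nonzero only in the open box, so its support lies in the closed box;
  therefore the closed box is the one required to lie in \<open>\<Omega>\<close>.\<close>

lemma box_bump_test_function:
  assumes c: "c > 0" and sub: "cbox a b \<subseteq> \<Omega>"
  shows "box_bump c a b \<in> test_functions \<Omega>"
proof -
  have "smooth1 k (\<lambda>y. flat c 1 (y - a $ i) * flat c 1 (b $ i - y))" for k i
    using smooth1_mult[OF smooth1_affine[OF smooth1_flat[OF c], of k 1 1 "- a $ i"]
        smooth1_affine[OF smooth1_flat[OF c], of k 1 "-1" "b $ i"]] by simp
  then have "C_k k (box_bump c a b)" for k
    unfolding box_bump_def[abs_def] by (rule C_k_prod_components)
  moreover have supp: "closure {x. box_bump c a b x \<noteq> 0} \<subseteq> cbox a b"
    using box_bump_outside box_subset_cbox by (intro closure_minimal closed_cbox) blast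
  moreover have "compact (closure {x. box_bump c a b x \<noteq> 0})"
    using compact_Int_closed[OF compact_cbox closed_closure, of a b "{x. box_bump c a b x \<noteq> 0}"] supp
    by (simp add: Int_absorb1)
  ultimately show ?thesis using sub by (auto simp: test_functions_def)
qed

lemma box_bump_bounds: "c > 0 \<Longrightarrow> 0 \<le> box_bump c a b x \<and> box_bump c a b x \<le> 1"
  unfolding box_bump_def
  by (auto intro!: prod_nonneg prod_le_1 mult_le_one simp: flat_def)

text \<open>Inside the box every factor is exp (- c / y) with y > 0 fixed, which tends to 1 as c
  tends to 0; outside the box all the bumps vanish.\<close>

lemma box_bump_tendsto_indicator:
  "(\<lambda>n. box_bump (inverse (real (Suc n))) a b x) \<longlonglongrightarrow> indicator (box a b) x"
proof (cases "x \<in> box a b")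
  case True
  have "(\<lambda>n. flat (inverse (real (Suc n))) 1 y) \<longlonglongrightarrow> 1" if "y > 0" for y
  proof -
    have "(\<lambda>n. exp (- inverse (real (Suc n)) / y)) \<longlonglongrightarrow> exp (- 0 / y)"
      using that by (intro tendsto_intros LIMSEQ_inverse_real_of_nat) simp
    then show ?thesis using that by (simp add: flat_def)
  qed
  then have "(\<lambda>n. box_bump (inverse (real (Suc n))) a b x) \<longlonglongrightarrow> (\<Prod>i\<in>(UNIV::'a set). 1 * 1)"
    unfolding box_bump_def using True by (intro tendsto_intros) (auto simp: mem_box_cart)
  then show ?thesis using True by simp
qed (simp add: box_bump_outside)

section \<open>Supports, integrability and weak gradients of test functions\<close>

lemma not_in_support: "x \<notin> closure {x. \<phi> x \<noteq> 0} \<Longrightarrow> \<phi> x = 0"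
  using subsetD[OF closure_subset, of x "{x. \<phi> x \<noteq> 0}"] by (metis mem_Collect_eq)

lemma test_function_outside:
  assumes "\<phi> \<in> test_functions \<Omega>" "x \<notin> \<Omega>" shows "\<phi> x = 0"
  by (rule not_in_support) (use assms in \<open>auto simp: test_functions_def\<close>)

lemma test_function_C_k: "\<phi> \<in> test_functions \<Omega> \<Longrightarrow> C_k k \<phi>"
  by (simp add: test_functions_def)

lemma test_function_differentiable: "\<phi> \<in> test_functions \<Omega> \<Longrightarrow> \<phi> differentiable (at x)"
  and test_function_continuous_pderiv: "\<phi> \<in> test_functions \<Omega> \<Longrightarrow> continuous_on UNIV (pderiv_at i \<phi>)"
  using test_function_C_k[of \<phi> \<Omega> "Suc 0"] unfolding C_k.simps by blast+

lemma test_function_continuous: "\<phi> \<in> test_functions \<Omega> \<Longrightarrow> continuous_on UNIV \<phi>"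
  using test_function_C_k[of \<phi> \<Omega> 0] unfolding C_k.simps .

lemma pderiv_at_outside_support:
  fixes \<phi> :: "real^'n \<Rightarrow> real"
  assumes "x \<notin> closure {x. \<phi> x \<noteq> 0}"
  shows "pderiv_at i \<phi> x = 0"
proof -
  have "(\<phi> has_derivative (\<lambda>_. 0)) (at x)"
  proof (rule has_derivative_transform_within_open)
    show "((\<lambda>_. 0) has_derivative (\<lambda>_. 0)) (at x)" by simp
    show "open (- closure {x. \<phi> x \<noteq> 0})" by auto
    show "x \<in> - closure {x. \<phi> x \<noteq> 0}" using assms by simp
    show "0 = \<phi> y" if "y \<in> - closure {x. \<phi> x \<noteq> 0}" for y
      using not_in_support[of y \<phi>] that by simp
  qed
  from pderiv_at_eqI[OF this] show ?thesis .
qed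

lemma test_function_support_bounded:
  assumes "\<phi> \<in> test_functions \<Omega>"
  obtains R where "\<And>x. R < norm x \<Longrightarrow> \<phi> x = 0" "\<And>x i. R < norm x \<Longrightarrow> pderiv_at i \<phi> x = 0"
proof -
  have "bounded (closure {x. \<phi> x \<noteq> 0})"
    using assms by (intro compact_imp_bounded) (simp add: test_functions_def)
  then obtain R where R: "\<forall>x \<in> closure {x. \<phi> x \<noteq> 0}. norm x \<le> R"
    unfolding bounded_iff ..
  have x: "x \<notin> closure {x. \<phi> x \<noteq> 0}" if "R < norm x" for x
    using bspec[OF R, of x] that by linarith
  show ?thesis
    by (rule that[of R]) (erule not_in_support[OF x] pderiv_at_outside_support[OF x])+
qed

lemma test_function_pderiv_outside:
  assumes "\<phi> \<in> test_functions \<Omega>" "x \<notin> \<Omega>" shows "pderiv_at i \<phi> x = 0"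
  by (rule pderiv_at_outside_support) (use assms in \<open>auto simp: test_functions_def\<close>)

text \<open>Translation invariance was used on \<open>lborel\<close>, whereas the Sobolev notions
  integrate over \<open>lebesgue_on \<Omega>\<close>. Borel measurability removes the completion,
  and vanishing outside \<open>\<Omega>\<close> removes the restriction.\<close>

lemma lebesgue_on_eq_lborel:
  fixes f :: "real^'n \<Rightarrow> real"
  assumes \<Omega>: "\<Omega> \<in> sets lebesgue" and f: "f \<in> borel_measurable borel" and 0: "\<And>x. x \<notin> \<Omega> \<Longrightarrow> f x = 0"
  shows "(LINT x|lebesgue_on \<Omega>. f x) = (LINT x|lborel. f x)"
    and "integrable lborel f \<Longrightarrow> integrable (lebesgue_on \<Omega>) f"
proof -
  have eq: "(\<lambda>x. indicator \<Omega> x *\<^sub>R f x) = f" using 0 by (auto simp: indicator_def fun_eq_iff)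
  have sp: "\<Omega> \<inter> space lebesgue \<in> sets lebesgue" using \<Omega> by simp
  have "(LINT x|lebesgue_on \<Omega>. f x) = (LINT x|lebesgue. f x)"
    by (simp only: integral_restrict_space[OF sp] eq)
  also have "\<dots> = (LINT x|lborel. f x)" using f by (intro integral_completion) simp
  finally show "(LINT x|lebesgue_on \<Omega>. f x) = (LINT x|lborel. f x)" .
  assume "integrable lborel f"
  then have "integrable lebesgue f" using f by (simp add: integrable_completion)
  then show "integrable (lebesgue_on \<Omega>) f"
    by (simp only: integrable_restrict_space[OF sp] eq)
qed

lemma test_function_sq_integrable:
  fixes \<Omega> :: "(real^'n) set"
  assumes \<Omega>: "\<Omega> \<in> sets lebesgue" and \<phi>: "\<phi> \<in> test_functions \<Omega>"
  shows "sq_integrable (lebesgue_on \<Omega>) \<phi>" and "sq_integrable (lebesgue_on \<Omega>) (pderiv_at i \<phi>)"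
proof -
  obtain R where R: "\<And>x. R < norm x \<Longrightarrow> \<phi> x = 0" "\<And>x i. R < norm x \<Longrightarrow> pderiv_at i \<phi> x = 0"
    using test_function_support_bounded[OF \<phi>] by blast
  have "sq_integrable (lebesgue_on \<Omega>) f"
    if c: "continuous_on UNIV f" and f: "\<And>x. R < norm x \<Longrightarrow> f x = 0" "\<And>x. x \<notin> \<Omega> \<Longrightarrow> f x = 0"
    for f :: "real^'n \<Rightarrow> real"
    unfolding sq_integrable_def
  proof
    have m: "f \<in> borel_measurable borel" by (rule borel_measurable_continuous_onI[OF c])
    then have "f \<in> borel_measurable lborel" by simp
    then have "f \<in> borel_measurable lebesgue" by (rule measurable_completion)
    then show "f \<in> borel_measurable (lebesgue_on \<Omega>)" by (rule measurable_restrict_space1)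
    show "integrable (lebesgue_on \<Omega>) (\<lambda>x. f x \<bullet> f x)"
    proof (rule lebesgue_on_eq_lborel(2)[OF \<Omega>])
      show "integrable lborel (\<lambda>x. f x \<bullet> f x)"
        by (rule integrable_continuous_bounded_support[of _ R])
          (use f(1) c in \<open>auto intro: continuous_intros\<close>)
    qed (use m f in auto)
  qed
  then show "sq_integrable (lebesgue_on \<Omega>) \<phi>" "sq_integrable (lebesgue_on \<Omega>) (pderiv_at i \<phi>)"
    using R test_function_continuous[OF \<phi>] test_function_continuous_pderiv[OF \<phi>]
      test_function_outside[OF \<phi>] test_function_pderiv_outside[OF \<phi>] by blast+
qed

text \<open>Integration by parts: the integral of the partial derivative of \<phi> \<psi> over the
  whole space is zero.\<close>

lemma test_function_is_weak_grad:
  fixes \<Omega> :: "(real^'n) set"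
  assumes \<Omega>: "\<Omega> \<in> sets lebesgue" and \<phi>: "\<phi> \<in> test_functions \<Omega>"
  shows "is_weak_grad \<Omega> \<phi> (\<lambda>x. \<chi> i. pderiv_at i \<phi> x)"
  unfolding is_weak_grad_iff[OF \<Omega>]
proof (intro conjI ballI allI)
  show "sq_integrable (lebesgue_on \<Omega>) (\<lambda>x. \<chi> i. pderiv_at i \<phi> x)"
    using test_function_sq_integrable[OF \<Omega> \<phi>] by (simp add: sq_integrable_vec)
  fix \<psi> i assume \<psi>: "\<psi> \<in> test_functions \<Omega>"
  let ?N = "lebesgue_on \<Omega>"
  note d = test_function_differentiable[OF \<phi>] test_function_differentiable[OF \<psi>]
  have P: "pderiv_at i (\<lambda>x. \<phi> x * \<psi> x) = (\<lambda>x. \<phi> x * pderiv_at i \<psi> x + pderiv_at i \<phi> x * \<psi> x)"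
    by (rule ext) (rule pderiv_at_mult[OF d])
  obtain R where R: "\<And>x. R < norm x \<Longrightarrow> \<phi> x = 0" "\<And>x i. R < norm x \<Longrightarrow> pderiv_at i \<phi> x = 0"
    using test_function_support_bounded[OF \<phi>] by blast
  have c: "continuous_on UNIV (pderiv_at i (\<lambda>x. \<phi> x * \<psi> x))"
    unfolding P by (rule continuous_on_add continuous_on_mult test_function_continuous[OF \<phi>]
        test_function_continuous[OF \<psi>] test_function_continuous_pderiv[OF \<phi>]
        test_function_continuous_pderiv[OF \<psi>])+
  have "0 = (LINT x|lborel. pderiv_at i (\<lambda>x. \<phi> x * \<psi> x) x)"
    by (rule integral_pderiv_eq_0(2)[where R=R, symmetric, OF differentiable_mult[OF d] c]) (simp add: R(1))
  also have "\<dots> = (LINT x|?N. pderiv_at i (\<lambda>x. \<phi> x * \<psi> x) x)"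
    by (rule lebesgue_on_eq_lborel(1)[symmetric, OF \<Omega> borel_measurable_continuous_onI[OF c]])
      (simp add: P test_function_outside[OF \<phi>] test_function_outside[OF \<psi>])
  also have "\<dots> = (LINT x|?N. \<phi> x * pderiv_at i \<psi> x) + (LINT x|?N. pderiv_at i \<phi> x * \<psi> x)"
    unfolding P
    using sq_integrable_inner[OF test_function_sq_integrable(1)[OF \<Omega> \<phi>] test_function_sq_integrable(2)[OF \<Omega> \<psi>]]
      sq_integrable_inner[OF test_function_sq_integrable(2)[OF \<Omega> \<phi>] test_function_sq_integrable(1)[OF \<Omega> \<psi>]]
    by (intro Bochner_Integration.integral_add) auto
  finally show "(LINT x|?N. \<phi> x * pderiv_at i \<psi> x) = - (LINT x|?N. (\<chi> i. pderiv_at i \<phi> x) $ i * \<psi> x)"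
    by simp
qed

lemma sq_integrable_Cauchy_Schwarz:
  assumes "sq_integrable N f" "sq_integrable N g"
  shows "\<bar>LINT x|N. f x \<bullet> g x\<bar> \<le> sqrt (LINT x|N. f x \<bullet> f x) * sqrt (LINT x|N. g x \<bullet> g x)"
  using semi_inner_Cauchy_Schwarz[OF semi_inner_sq_integrable fun_subspace_sq_integrable] assms by blast

text \<open>Integrating \<open>\<partial>\<^sub>i (x\<^sub>i \<phi>\<^sup>2) = \<phi>\<^sup>2 + 2 x\<^sub>i \<phi> \<partial>\<^sub>i \<phi>\<close> bounds \<open>\<phi>\<close> by a single partial derivative.\<close>

lemma test_function_Poincare:
  fixes \<Omega> :: "(real^'n) set"
  assumes \<Omega>: "\<Omega> \<in> sets lebesgue" and \<phi>: "\<phi> \<in> test_functions \<Omega>" and R: "\<Omega> \<subseteq> cball 0 R"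
  shows "(LINT x|lebesgue_on \<Omega>. \<phi> x * \<phi> x) \<le>
    4 * R\<^sup>2 * (LINT x|lebesgue_on \<Omega>. pderiv_at i \<phi> x * pderiv_at i \<phi> x)"
proof -
  let ?N = "lebesgue_on \<Omega>" and ?f = "\<lambda>x. (x $ i * \<phi> x) * \<phi> x"
  let ?A = "LINT x|?N. \<phi> x * \<phi> x" and ?D = "LINT x|?N. pderiv_at i \<phi> x * pderiv_at i \<phi> x"
  note d = test_function_differentiable[OF \<phi>]
  have lin: "((\<lambda>x::real^'n. x $ i) has_derivative (\<lambda>v. v $ i)) (at x)" for x
    by (intro bounded_linear_imp_has_derivative bounded_linear_vec_nth)
  then have dl: "(\<lambda>x::real^'n. x $ i) differentiable (at x)" for x by (auto simp: differentiable_def)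
  have pl: "pderiv_at i (\<lambda>x::real^'n. x $ i) x = 1" for x using pderiv_at_eqI[OF lin] by simp
  have dm: "(\<lambda>x. x $ i * \<phi> x) differentiable (at x)" for x
    by (rule differentiable_mult[OF dl d])
  have P: "pderiv_at i ?f = (\<lambda>x. \<phi> x * \<phi> x + 2 * ((x $ i * \<phi> x) * pderiv_at i \<phi> x))"
  proof
    fix x
    have "pderiv_at i ?f x = (x $ i * \<phi> x) * pderiv_at i \<phi> x + pderiv_at i (\<lambda>x. x $ i * \<phi> x) x * \<phi> x"
      by (rule pderiv_at_mult[OF dm d])
    also have "pderiv_at i (\<lambda>x. x $ i * \<phi> x) x = x $ i * pderiv_at i \<phi> x + 1 * \<phi> x"
      unfolding pl[of x, symmetric] by (rule pderiv_at_mult[OF dl d])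
    finally show "pderiv_at i ?f x = \<phi> x * \<phi> x + 2 * ((x $ i * \<phi> x) * pderiv_at i \<phi> x)"
      by (simp only: algebra_simps)
  qed
  have c: "continuous_on UNIV (pderiv_at i ?f)"
    unfolding P by (intro continuous_on_add continuous_on_mult continuous_on_const
        continuous_on_component continuous_on_id test_function_continuous[OF \<phi>]
        test_function_continuous_pderiv[OF \<phi>])
  obtain S where S: "\<And>x. S < norm x \<Longrightarrow> \<phi> x = 0" "\<And>x i. S < norm x \<Longrightarrow> pderiv_at i \<phi> x = 0"
    using test_function_support_bounded[OF \<phi>] by blast
  have sq: "sq_integrable ?N \<phi>" "sq_integrable ?N (pderiv_at i \<phi>)"
    using test_function_sq_integrable[OF \<Omega> \<phi>] by auto
  have bnd: "(x $ i * \<phi> x)\<^sup>2 \<le> R\<^sup>2 * (\<phi> x)\<^sup>2" for x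
  proof (cases "x \<in> \<Omega>")
    case True
    then have "\<bar>x $ i\<bar> \<le> R" using R component_le_norm_cart[of x i] by auto
    then have "\<bar>x $ i\<bar>\<^sup>2 \<le> R\<^sup>2" by (rule power_mono) simp
    then have "(x $ i)\<^sup>2 * (\<phi> x)\<^sup>2 \<le> R\<^sup>2 * (\<phi> x)\<^sup>2"
      by (intro mult_right_mono) simp_all
    then show ?thesis by (simp only: power_mult_distrib)
  qed (simp add: test_function_outside[OF \<phi>])
  have xm: "(\<lambda>x. x $ i * \<phi> x) \<in> borel_measurable ?N"
  proof (rule borel_measurable_times)
    have "(\<lambda>x::real^'n. x $ i) \<in> borel_measurable lborel"
      using borel_measurable_continuous_onI[of "\<lambda>x::real^'n. x $ i"] by (auto intro: continuous_intros)
    then show "(\<lambda>x::real^'n. x $ i) \<in> borel_measurable ?N"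
      by (intro measurable_restrict_space1 measurable_completion)
  qed (rule sq_integrable_measurable[OF sq(1)])
  have i2: "integrable ?N (\<lambda>x. R\<^sup>2 * (\<phi> x * \<phi> x))"
    using sq_integrable_inner[OF sq(1,1)] by simp
  have xs: "sq_integrable ?N (\<lambda>x. x $ i * \<phi> x)"
    unfolding sq_integrable_def
  proof
    show "integrable ?N (\<lambda>x. (x $ i * \<phi> x) \<bullet> (x $ i * \<phi> x))"
    proof (rule Bochner_Integration.integrable_bound[OF i2])
      show "(\<lambda>x. (x $ i * \<phi> x) \<bullet> (x $ i * \<phi> x)) \<in> borel_measurable ?N"
        by (rule borel_measurable_inner[OF xm xm])
      have "norm ((x $ i * \<phi> x) \<bullet> (x $ i * \<phi> x)) \<le> norm (R\<^sup>2 * (\<phi> x * \<phi> x))" for x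
      proof -
        have "norm ((x $ i * \<phi> x) \<bullet> (x $ i * \<phi> x)) = (x $ i * \<phi> x)\<^sup>2"
          by (simp only: inner_real_def power2_eq_square real_norm_def abs_of_nonneg[OF zero_le_square])
        also have "\<dots> \<le> R\<^sup>2 * (\<phi> x)\<^sup>2" by (rule bnd)
        also have "\<dots> \<le> norm (R\<^sup>2 * (\<phi> x * \<phi> x))"
          by (simp only: power2_eq_square[of "\<phi> x", symmetric] real_norm_def abs_ge_self)
        finally show ?thesis .
      qed
      then show "AE x in ?N. norm ((x $ i * \<phi> x) \<bullet> (x $ i * \<phi> x)) \<le> norm (R\<^sup>2 * (\<phi> x * \<phi> x))"
        by (rule AE_I2)
    qed
  qed (rule xm)
  have "(LINT x|?N. (x $ i * \<phi> x) \<bullet> (x $ i * \<phi> x)) \<le> (LINT x|?N. R\<^sup>2 * (\<phi> x * \<phi> x))"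
  proof (rule integral_mono[OF sq_integrable_inner[OF xs xs] i2])
    show "(x $ i * \<phi> x) \<bullet> (x $ i * \<phi> x) \<le> R\<^sup>2 * (\<phi> x * \<phi> x)" for x
      using bnd[of x] by (simp only: inner_real_def power2_eq_square)
  qed
  also have "\<dots> = R\<^sup>2 * ?A" by (rule integral_mult_right_zero)
  finally have xle: "(LINT x|?N. (x $ i * \<phi> x) \<bullet> (x $ i * \<phi> x)) \<le> R\<^sup>2 * ?A" .
  have "0 = (LINT x|lborel. pderiv_at i ?f x)"
    by (rule integral_pderiv_eq_0(2)[where R=S, symmetric, OF differentiable_mult[OF dm d] c]) (simp add: S(1))
  also have "\<dots> = (LINT x|?N. pderiv_at i ?f x)"
    by (rule lebesgue_on_eq_lborel(1)[symmetric, OF \<Omega> borel_measurable_continuous_onI[OF c]])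
      (simp add: P test_function_outside[OF \<phi>])
  also have "\<dots> = ?A + 2 * (LINT x|?N. (x $ i * \<phi> x) \<bullet> pderiv_at i \<phi> x)"
  proof -
    have "integrable ?N (\<lambda>x. \<phi> x * \<phi> x)" using sq_integrable_inner[OF sq(1,1)] by (simp only: inner_real_def)
    moreover have "integrable ?N (\<lambda>x. (x $ i * \<phi> x) * pderiv_at i \<phi> x)"
      using sq_integrable_inner[OF xs sq(2)] by (simp only: inner_real_def)
    ultimately show ?thesis
      unfolding P inner_real_def
      by (simp only: Bochner_Integration.integral_add integral_mult_right_zero
          Bochner_Integration.integrable_mult_right)
  qed
  finally have 0: "0 = ?A + 2 * (LINT x|?N. (x $ i * \<phi> x) \<bullet> pderiv_at i \<phi> x)" .
  define A D X Y where "A = ?A" and "D = ?D" and "X = (LINT x|?N. (x $ i * \<phi> x) \<bullet> (x $ i * \<phi> x))"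
    and "Y = (LINT x|?N. (x $ i * \<phi> x) \<bullet> pderiv_at i \<phi> x)"
  have nonneg: "0 \<le> A" "0 \<le> D"
    unfolding A_def D_def by (rule Bochner_Integration.integral_nonneg, rule zero_le_square)+
  have CS: "\<bar>Y\<bar> \<le> sqrt X * sqrt D"
    using sq_integrable_Cauchy_Schwarz[OF xs sq(2)] unfolding X_def Y_def D_def inner_real_def .
  \<comment> \<open>With X <= R^2 A this leads to A <= 2 |R| sqrt A sqrt D; absorbing sqrt A squares
    the remaining factor, hence the constant 4 R^2.\<close>
  have "A \<le> 2 * \<bar>Y\<bar>" using 0 unfolding A_def[symmetric] Y_def[symmetric] by linarith
  moreover have "sqrt X * sqrt D \<le> sqrt (R\<^sup>2 * A) * sqrt D"
    using xle nonneg unfolding X_def[symmetric] A_def[symmetric] by (simp add: mult_right_mono)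
  ultimately have "A \<le> 2 * (sqrt (R\<^sup>2 * A) * sqrt D)" using CS by linarith
  also have "2 * (sqrt (R\<^sup>2 * A) * sqrt D) = sqrt (4 * R\<^sup>2 * D) * sqrt A"
    by (simp only: real_sqrt_mult real_sqrt_four mult_ac)
  finally have "A \<le> 4 * R\<^sup>2 * D"
    by (rule le_of_square_le_mult[rotated 2]) (simp_all only: nonneg mult_nonneg_nonneg zero_le_power2 zero_le_numeral)
  then show ?thesis unfolding A_def D_def .
qed

section \<open>Uniqueness of weak gradients\<close>

text \<open>Boxes form an intersection-stable generator of the Borel sets, so by the \<pi>-\<lambda>
  principle the integral of \<open>f\<close> vanishes over every Borel set.\<close>

lemma AE_zero_of_integral_box:
  fixes f :: "'a::euclidean_space \<Rightarrow> real"
  assumes f: "integrable lborel f"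
    and box: "\<And>l u. (LINT x|lborel. indicator (box l u) x * f x) = 0"
  shows "AE x in lborel. f x = 0"
proof (rule sigma_finite_measure.density_zero[OF sigma_finite_lborel f])
  have int: "integrable lborel (\<lambda>x. indicator A x * f x)" if "A \<in> sets borel" for A
    using integrable_mult_indicator[of A lborel f] that f by simp
  fix A :: "'a set" assume "A \<in> sets lborel"
  then have A: "A \<in> sigma_sets UNIV (range (\<lambda>(a, b). box a b :: 'a set))"
    by (simp add: borel_eq_box)
  have "Int_stable (range (\<lambda>(a, b). box a b :: 'a set))"
    by (auto simp: Int_stable_def box_Int_box)
  moreover have "range (\<lambda>(a, b). box a b :: 'a set) \<subseteq> Pow UNIV" by simp
  ultimately have "(LINT x|lborel. indicator A x * f x) = 0"
    using A
  proof (induction rule: sigma_sets_induct_disjoint)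
    case (basic A)
    then show ?case using box by auto
  next
    case empty
    then show ?case by simp
  next
    case (compl A)
    then have A: "A \<in> sets borel" by (simp add: borel_eq_box)
    \<comment> \<open>Complements require the integral over the whole space, which is the limit of
      integrals over growing centred boxes.\<close>
    have "(LINT x|lborel. f x) = 0"
    proof -
      have lim: "(\<lambda>n. LINT x|lborel. indicator (box (- real n *\<^sub>R One) (real n *\<^sub>R One)) x * f x)
        \<longlonglongrightarrow> (LINT x|lborel. f x)"
      proof (rule integral_dominated_convergence[where w="\<lambda>x. \<bar>f x\<bar>"])
        show "AE x in lborel. (\<lambda>n. indicator (box (- real n *\<^sub>R One) (real n *\<^sub>R One)) x * f x) \<longlonglongrightarrow> f x"
        proof (intro AE_I2 tendsto_eventually)
          fix x :: 'a
          obtain N :: nat where N: "norm x < real N" using reals_Archimedean2 by blast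
          show "\<forall>\<^sub>F n in sequentially. indicator (box (- real n *\<^sub>R One) (real n *\<^sub>R One)) x * f x = f x"
            using eventually_ge_at_top[of N]
          proof eventually_elim
            fix n assume n: "N \<le> n"
            have "\<bar>x \<bullet> b\<bar> < real n" if "b \<in> Basis" for b
              using Basis_le_norm[OF that, of x] N n by linarith
            then have "x \<in> box (- real n *\<^sub>R One) (real n *\<^sub>R One)"
              by (auto simp: mem_box abs_less_iff inner_sum_left_Basis minus_less_iff)
            then show "indicator (box (- real n *\<^sub>R One) (real n *\<^sub>R One)) x * f x = f x" by simp
          qed
        qed
      qed (use f in \<open>auto simp: indicator_def\<close>)
      show ?thesis using LIMSEQ_unique[OF lim, of 0] by (simp add: box)
    qed
    moreover have "(LINT x|lborel. indicator (UNIV - A) x * f x) =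
      (LINT x|lborel. f x - indicator A x * f x)"
      by (intro Bochner_Integration.integral_cong) (auto simp: indicator_def)
    ultimately show ?case using compl int[OF A] f by simp
  next
    case (union A)
    then have A: "A i \<in> sets borel" for i by (auto simp: borel_eq_box)
    have "(LINT x:(\<Union>i. A i)|lborel. f x) = (\<Sum>i. LINT x:A i|lborel. f x)"
    proof (rule lebesgue_integral_countable_add)
      show "set_integrable lborel (\<Union>i. A i) f"
        using int[of "\<Union>i. A i"] A by (auto simp: set_integrable_def)
    qed (use A union(1) in \<open>auto simp: disjoint_family_on_def\<close>)
    then show ?case using union(3) by (simp add: set_lebesgue_integral_def)
  qed
  then show "(LINT x:A|lborel. f x) = 0" by (simp add: set_lebesgue_integral_def)
qed

text \<open>The fundamental lemma of the calculus of variations. Bumps give vanishing integrals over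
  boxes whose closed boxes lie in \<open>\<Omega>\<close>; this localizes to each such box, and
  countably many of them cover \<open>\<Omega>\<close>. Boundedness of \<open>\<Omega>\<close> makes
  the square integrable \<open>g\<close> integrable, so that it dominates the products with
  bumps.\<close>

lemma AE_zero_of_test_functions:
  fixes \<Omega> :: "(real^'n) set"
  assumes \<Omega>: "open \<Omega>" "bounded \<Omega>" and g: "sq_integrable (lebesgue_on \<Omega>) g"
    and ort: "\<And>\<phi>. \<phi> \<in> test_functions \<Omega> \<Longrightarrow> (LINT x|lebesgue_on \<Omega>. g x * \<phi> x) = 0"
  shows "AE x in lebesgue_on \<Omega>. g x = 0"
proof -
  let ?N = "lebesgue_on \<Omega>"
  have \<Omega>s: "\<Omega> \<in> sets lebesgue" using \<Omega>(1) by simp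
  have sp: "\<Omega> \<inter> space lebesgue \<in> sets lebesgue" using \<Omega>s by simp
  have "\<Omega> \<in> lmeasurable" using bounded_set_imp_lmeasurable[OF \<Omega>(2) \<Omega>s] .
  then have "integrable lebesgue (\<lambda>x. indicator \<Omega> x *\<^sub>R (1 :: real))"
    by (simp add: lmeasurable_iff_integrable)
  then have "integrable ?N (\<lambda>x. 1 :: real)"
    unfolding integrable_restrict_space[OF sp] .
  then have "sq_integrable ?N (\<lambda>x. 1 :: real)" by (simp add: sq_integrable_def)
  from sq_integrable_inner[OF g this] have gi: "integrable ?N g" by simp
  define f where "f = (\<lambda>x. indicator \<Omega> x *\<^sub>R g x)"
  have fi: "integrable lebesgue f" unfolding f_def using gi unfolding integrable_restrict_space[OF sp] .
  \<comment> \<open>The zero extension \<open>f\<close> is only Lebesgue measurable; a Borel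
    representative is needed for the criterion on \<open>lborel\<close>.\<close>
  obtain f' where f': "f' \<in> borel_measurable lborel" and AEf: "AE x in lborel. f x = f' x"
    using completion_ex_borel_measurable_real[of f lborel] fi by (auto simp: borel_measurable_integrable)
  have AEf': "AE x in lebesgue. f x = f' x" using AE_completion[OF AEf] .
  have f'm: "f' \<in> borel_measurable lebesgue" using f' by (rule measurable_completion)
  have "integrable lebesgue f'"
    using integrable_cong_AE_imp[OF fi f'm] AEf' by (auto simp: eq_commute)
  then have f'i: "integrable lborel f'" using f' by (simp add: integrable_completion)
  have box0: "(LINT x|lborel. indicator (box a b) x * f' x) = 0" if ab: "cbox a b \<subseteq> \<Omega>" for a b
  proof -
    have sub: "box a b \<subseteq> \<Omega>" using ab box_subset_cbox by blast
    have "(\<lambda>n. LINT x|?N. g x * box_bump (inverse (real (Suc n))) a b x)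
      \<longlonglongrightarrow> (LINT x|?N. g x * indicator (box a b) x)"
    proof (rule integral_dominated_convergence[where w="\<lambda>x. \<bar>g x\<bar>"])
      have bm: "box_bump (inverse (real (Suc n))) a b \<in> borel_measurable ?N" for n
        by (rule sq_integrable_measurable[OF test_function_sq_integrable(1)[OF \<Omega>s box_bump_test_function[OF _ ab]]])
          simp
      have gm: "g \<in> borel_measurable ?N" using gi by (rule borel_measurable_integrable)
      show "(\<lambda>x. g x * box_bump (inverse (real (Suc n))) a b x) \<in> borel_measurable ?N" for n
        using gm bm by (rule borel_measurable_times)
      have "box a b \<in> sets ?N" using sub \<Omega>s by (simp add: sets_restrict_space_iff)
      then have "(\<lambda>x. indicator (box a b) x :: real) \<in> borel_measurable ?N"
        by (rule borel_measurable_indicator)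
      with gm show "(\<lambda>x. g x * indicator (box a b) x) \<in> borel_measurable ?N"
        by (rule borel_measurable_times)
      show "integrable ?N (\<lambda>x. \<bar>g x\<bar>)" using gi by simp
      show "AE x in ?N. (\<lambda>n. g x * box_bump (inverse (real (Suc n))) a b x) \<longlonglongrightarrow> g x * indicator (box a b) x"
        by (intro AE_I2 tendsto_mult tendsto_const box_bump_tendsto_indicator)
      show "AE x in ?N. norm (g x * box_bump (inverse (real (Suc n))) a b x) \<le> \<bar>g x\<bar>" for n
      proof (rule AE_I2)
        fix x
        show "norm (g x * box_bump (inverse (real (Suc n))) a b x) \<le> \<bar>g x\<bar>"
          using box_bump_bounds[of "inverse (real (Suc n))" a b x]
          by (simp add: abs_mult mult_left_le)
      qed
    qed
    moreover have "(LINT x|?N. g x * box_bump (inverse (real (Suc n))) a b x) = 0" for n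
      by (rule ort[OF box_bump_test_function[OF _ ab]]) simp
    ultimately have "(LINT x|?N. g x * indicator (box a b) x) = 0"
      using LIMSEQ_unique[OF _ tendsto_const] by simp
    also have "(LINT x|?N. g x * indicator (box a b) x) = (LINT x|lebesgue. indicator (box a b) x * f x)"
      unfolding integral_restrict_space[OF sp] f_def
      by (intro Bochner_Integration.integral_cong) (auto simp: indicator_def)
    also have "\<dots> = (LINT x|lebesgue. indicator (box a b) x * f' x)"
    proof (rule integral_cong_AE)
      have ib: "(\<lambda>x. indicator (box a b) x :: real) \<in> borel_measurable lebesgue"
        by (rule borel_measurable_indicator) simp
      show "(\<lambda>x. indicator (box a b) x * f x) \<in> borel_measurable lebesgue"
        by (rule borel_measurable_times[OF ib borel_measurable_integrable[OF fi]])
      show "(\<lambda>x. indicator (box a b) x * f' x) \<in> borel_measurable lebesgue"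
        by (rule borel_measurable_times[OF ib f'm])
      show "AE x in lebesgue. indicator (box a b) x * f x = indicator (box a b) x * f' x"
        using AEf' by eventually_elim simp
    qed
    also have "\<dots> = (LINT x|lborel. indicator (box a b) x * f' x)"
      by (rule integral_completion) (use f' in auto)
    finally show ?thesis by simp
  qed
  have AEbox: "AE x in lborel. x \<in> box a b \<longrightarrow> f' x = 0" if ab: "cbox a b \<subseteq> \<Omega>" for a b
  proof -
    have "AE x in lborel. indicator (box a b) x * f' x = 0"
    proof (rule AE_zero_of_integral_box)
      show "integrable lborel (\<lambda>x. indicator (box a b) x * f' x)"
        using integrable_mult_indicator[of "box a b" lborel f'] f'i by simp
      fix l u
      \<comment> \<open>The criterion asks for arbitrary boxes. Their intersection with the fixed
        box is again a box, and its closed box stays inside \<open>\<Omega>\<close>.\<close>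
      define l' u' where "l' = (\<Sum>i\<in>Basis. max (l \<bullet> i) (a \<bullet> i) *\<^sub>R i)"
        and "u' = (\<Sum>i\<in>Basis. min (u \<bullet> i) (b \<bullet> i) *\<^sub>R i)"
      have B: "box l u \<inter> box a b = box l' u'" unfolding l'_def u'_def by (rule box_Int_box)
      have "cbox l' u' \<subseteq> cbox a b" by (auto simp: l'_def u'_def mem_box)
      then have "cbox l' u' \<subseteq> \<Omega>" using ab by blast
      from box0[OF this] show "(LINT x|lborel. indicator (box l u) x * (indicator (box a b) x * f' x)) = 0"
        unfolding B[symmetric] by (simp add: indicator_inter_arith mult.assoc)
    qed
    then show ?thesis by eventually_elim (auto simp: indicator_def)
  qed
  obtain \<D> where \<D>: "countable \<D>" "\<D> \<subseteq> Pow \<Omega>" "\<And>X. X \<in> \<D> \<Longrightarrow> \<exists>a b. X = cbox a b" "\<Union>\<D> = \<Omega>"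
    using open_countable_Union_open_cbox[OF \<Omega>(1)] by metis
  have AEcbox: "AE x in lborel. x \<in> X \<longrightarrow> f' x = 0" if X: "X \<in> \<D>" for X
  proof -
    obtain a b where ab: "X = cbox a b" using \<D>(3)[OF X] by blast
    have "cbox a b \<subseteq> \<Omega>" using \<D>(2) X ab by blast
    from AEbox[OF this] have "AE x in lborel. x \<in> box a b \<longrightarrow> f' x = 0" .
    \<comment> \<open>The cover consists of closed boxes while the information concerns open ones;
      the boundary in between is a null set.\<close>
    moreover have "AE x in lborel. x \<notin> cbox a b - box a b"
    proof (rule AE_not_in)
      have "cbox a b - box a b \<in> null_sets lebesgue"
        using negligible_frontier_interval[of a b] by (simp add: negligible_iff_null_sets)
      then show "cbox a b - box a b \<in> null_sets lborel"
        by (simp add: null_sets_def emeasure_completion)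
    qed
    ultimately show ?thesis unfolding ab by eventually_elim auto
  qed
  have "AE x in lborel. \<forall>X\<in>\<D>. x \<in> X \<longrightarrow> f' x = 0"
    unfolding AE_ball_countable[OF \<D>(1)] using AEcbox by blast
  then have "AE x in lborel. x \<in> \<Omega> \<longrightarrow> f' x = 0"
    by eventually_elim (use \<D>(4) in blast)
  then have "AE x in lebesgue. x \<in> \<Omega> \<longrightarrow> f' x = 0" by (rule AE_completion)
  then have "AE x in lebesgue. x \<in> \<Omega> \<longrightarrow> g x = 0"
    using AEf' by eventually_elim (auto simp: f_def)
  then show ?thesis using AE_restrict_space_iff[OF sp] by simp
qed

section \<open>Sobolev spaces\<close>

text \<open>\<open>wgrad\<close> is a chosen representative, so differential operators built from it
  respect linear combinations only almost everywhere. Integrals of their products are nevertheless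
  linear.\<close>

definition ae_linear :: "'x measure \<Rightarrow> ('a \<Rightarrow> 'b::real_vector) set \<Rightarrow> (('a \<Rightarrow> 'b) \<Rightarrow> 'x \<Rightarrow> 'c::euclidean_space) \<Rightarrow> bool"
  where "ae_linear N S F \<longleftrightarrow> (\<forall>u\<in>S. sq_integrable N (F u)) \<and>
    (\<forall>u\<in>S. \<forall>v\<in>S. \<forall>c d. AE x in N. F (\<lambda>x. c *\<^sub>R u x + d *\<^sub>R v x) x = c *\<^sub>R F u x + d *\<^sub>R F v x)"

lemma ae_linear_sq_integrable: "ae_linear N S F \<Longrightarrow> u \<in> S \<Longrightarrow> sq_integrable N (F u)"
  by (simp add: ae_linear_def)

lemma ae_linear_lincomb:
  "ae_linear N S F \<Longrightarrow> u \<in> S \<Longrightarrow> v \<in> S \<Longrightarrow>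
    AE x in N. F (\<lambda>x. c *\<^sub>R u x + d *\<^sub>R v x) x = c *\<^sub>R F u x + d *\<^sub>R F v x"
  by (simp add: ae_linear_def)

lemma ae_linear_mono: "ae_linear N S F \<Longrightarrow> S' \<subseteq> S \<Longrightarrow> ae_linear N S' F"
  unfolding ae_linear_def by blast

lemma linear_fun_integral_ae_linear:
  assumes F: "ae_linear N S F" and S: "fun_subspace S" and g: "sq_integrable N g"
  shows "linear_fun S (\<lambda>v. LINT x|N. g x \<bullet> F v x)"
  unfolding linear_fun_def
proof (intro ballI allI)
  fix v w c d assume v: "v \<in> S" and w: "w \<in> S"
  let ?z = "\<lambda>x. c *\<^sub>R v x + d *\<^sub>R w x"
  note sq = ae_linear_sq_integrable[OF F]
  note i = sq_integrable_inner[OF g sq]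
  have "(LINT x|N. g x \<bullet> F ?z x) = (LINT x|N. c * (g x \<bullet> F v x) + d * (g x \<bullet> F w x))"
  proof (rule integral_cong_AE)
    show "(\<lambda>x. g x \<bullet> F ?z x) \<in> borel_measurable N"
      by (rule borel_measurable_integrable[OF i[OF fun_subspace_lincomb[OF S v w]]])
    show "(\<lambda>x. c * (g x \<bullet> F v x) + d * (g x \<bullet> F w x)) \<in> borel_measurable N"
      using i[OF v] i[OF w] by (intro borel_measurable_integrable) simp
    show "AE x in N. g x \<bullet> F ?z x = c * (g x \<bullet> F v x) + d * (g x \<bullet> F w x)"
      using ae_linear_lincomb[OF F v w, of c d] by eventually_elim (simp add: inner_add_right)
  qed
  also have "\<dots> = c * (LINT x|N. g x \<bullet> F v x) + d * (LINT x|N. g x \<bullet> F w x)"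
    using i[OF v] i[OF w] by simp
  finally show "(LINT x|N. g x \<bullet> F ?z x) = c * (LINT x|N. g x \<bullet> F v x) + d * (LINT x|N. g x \<bullet> F w x)" .
qed

lemma semi_inner_ae_linear:
  assumes F: "ae_linear N S F" and S: "fun_subspace S"
  shows "semi_inner_on S (\<lambda>u v. LINT x|N. F u x \<bullet> F v x)"
  unfolding semi_inner_on_def
  by (intro conjI ballI linear_fun_integral_ae_linear[OF F S] ae_linear_sq_integrable[OF F])
    (simp_all add: inner_commute)

lemma semi_inner_combination:
  assumes "semi_inner_on S b" "semi_inner_on S b'" "0 \<le> c" "0 \<le> d"
  shows "semi_inner_on S (\<lambda>u v. c * b u v + d * b' u v)"
  unfolding semi_inner_on_def
proof (intro conjI ballI)
  fix u assume u: "u \<in> S"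
  show "linear_fun S (\<lambda>v. c * b u v + d * b' u v)"
    using semi_inner_linear[OF assms(1) u] semi_inner_linear[OF assms(2) u]
    by (simp add: linear_fun_def algebra_simps)
  show "0 \<le> c * b u u + d * b' u u"
    using semi_inner_nonneg[OF assms(1) u] semi_inner_nonneg[OF assms(2) u] assms(3,4) by simp
  fix v assume v: "v \<in> S"
  show "c * b u v + d * b' u v = c * b v u + d * b' v u"
    using semi_inner_sym[OF assms(1) u v] semi_inner_sym[OF assms(2) u v] by simp
qed

lemma ae_linear_id: "(\<And>u. u \<in> S \<Longrightarrow> sq_integrable N u) \<Longrightarrow> ae_linear N S (\<lambda>u. u)"
  by (simp add: ae_linear_def)

text \<open>Strain and divergence are fixed linear maps of the gradient matrix, so both inherit
  square integrability and linearity from \<open>vgrad\<close>.\<close>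

lemma ae_linear_compose:
  assumes F: "ae_linear N S F" and T: "linear T"
  shows "ae_linear N S (\<lambda>u x. T (F u x))"
proof -
  have T_bl: "bounded_linear T" using T linear_conv_bounded_linear by blast
  obtain K where K: "\<And>y. norm (T y) \<le> norm y * K" using bounded_linear.bounded[OF T_bl] by blast
  show ?thesis
    unfolding ae_linear_def
  proof (intro conjI ballI allI)
    fix u assume u: "u \<in> S"
    have m: "F u \<in> borel_measurable N" and i: "integrable N (\<lambda>x. K\<^sup>2 * (F u x \<bullet> F u x))"
      using ae_linear_sq_integrable[OF F u] by (auto simp: sq_integrable_def)
    have Tm: "(\<lambda>x. T (F u x)) \<in> borel_measurable N"
      using borel_measurable_continuous_on[OF linear_continuous_on[OF T_bl] m] .
    have "T y \<bullet> T y \<le> K\<^sup>2 * (y \<bullet> y)" for y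
    proof -
      have "(norm (T y))\<^sup>2 \<le> (norm y * K)\<^sup>2" by (rule power_mono[OF K]) simp
      then show ?thesis by (simp only: power_mult_distrib dot_square_norm mult.commute)
    qed
    then have "norm (T (F u x) \<bullet> T (F u x)) \<le> norm (K\<^sup>2 * (F u x \<bullet> F u x))" for x
      using inner_ge_zero[of "T (F u x)"] abs_ge_self order_trans by (metis real_norm_def abs_of_nonneg)
    then have "integrable N (\<lambda>x. T (F u x) \<bullet> T (F u x))"
      by (intro Bochner_Integration.integrable_bound[OF i] borel_measurable_inner Tm AE_I2)
    with Tm show "sq_integrable N (\<lambda>x. T (F u x))" by (simp add: sq_integrable_def)
  next
    fix u v c d assume "u \<in> S" "v \<in> S"
    from ae_linear_lincomb[OF F this, of c d]
    show "AE x in N. T (F (\<lambda>x. c *\<^sub>R u x + d *\<^sub>R v x) x) = c *\<^sub>R T (F u x) + d *\<^sub>R T (F v x)"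
      by eventually_elim (simp add: linear_add[OF T] linear_scale[OF T])
  qed
qed

lemma is_weak_grad_lincomb:
  assumes \<Omega>: "\<Omega> \<in> sets lebesgue" and u: "sq_integrable (lebesgue_on \<Omega>) u" "is_weak_grad \<Omega> u G"
    and v: "sq_integrable (lebesgue_on \<Omega>) v" "is_weak_grad \<Omega> v H"
  shows "is_weak_grad \<Omega> (\<lambda>x. c * u x + d * v x) (\<lambda>x. c *\<^sub>R G x + d *\<^sub>R H x)"
  unfolding is_weak_grad_iff[OF \<Omega>]
proof (intro conjI ballI allI)
  let ?N = "lebesgue_on \<Omega>"
  have G: "sq_integrable ?N G" and H: "sq_integrable ?N H"
    using u(2) v(2) unfolding is_weak_grad_iff[OF \<Omega>] by auto
  show "sq_integrable ?N (\<lambda>x. c *\<^sub>R G x + d *\<^sub>R H x)" by (rule sq_integrable_lincomb[OF G H])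
  fix \<phi> i assume \<phi>: "\<phi> \<in> test_functions \<Omega>"
  note sq = test_function_sq_integrable[OF \<Omega> \<phi>]
  have Gi: "sq_integrable ?N (\<lambda>x. G x $ i)" and Hi: "sq_integrable ?N (\<lambda>x. H x $ i)"
    using G H unfolding sq_integrable_vec[of _ G] sq_integrable_vec[of _ H] by auto
  have I: "(LINT x|?N. (c * f x + d * g x) * h x) = c * (LINT x|?N. f x * h x) + d * (LINT x|?N. g x * h x)"
    if "sq_integrable ?N f" "sq_integrable ?N g" "sq_integrable ?N h" for f g h :: "real^'a \<Rightarrow> real"
    using sq_integrable_inner[OF that(1,3)] sq_integrable_inner[OF that(2,3)]
    by (simp add: distrib_right mult.assoc)
  have "(LINT x|?N. (c * u x + d * v x) * pderiv_at i \<phi> x) =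
    - (LINT x|?N. (c * G x $ i + d * H x $ i) * \<phi> x)"
    using u(2) v(2) \<phi> unfolding I[OF u(1) v(1) sq(2)] I[OF Gi Hi sq(1)] is_weak_grad_iff[OF \<Omega>]
    by simp
  then show "(LINT x|?N. (c * u x + d * v x) * pderiv_at i \<phi> x) =
    - (LINT x|?N. (c *\<^sub>R G x + d *\<^sub>R H x) $ i * \<phi> x)" by simp
qed

text \<open>Each component of the difference is orthogonal to every test function. This makes the
  chosen \<open>wgrad\<close> linear almost everywhere and identifies it with the classical gradient
  on test functions.\<close>

lemma weak_grad_unique:
  fixes \<Omega> :: "(real^'n) set"
  assumes \<Omega>: "open \<Omega>" "bounded \<Omega>" and G: "is_weak_grad \<Omega> u G" and H: "is_weak_grad \<Omega> u H"
  shows "AE x in lebesgue_on \<Omega>. G x = H x"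
proof -
  let ?N = "lebesgue_on \<Omega>"
  have \<Omega>s: "\<Omega> \<in> sets lebesgue" using \<Omega>(1) by simp
  have sG: "sq_integrable ?N G" and sH: "sq_integrable ?N H"
    using G H unfolding is_weak_grad_iff[OF \<Omega>s] by auto
  have "AE x in ?N. G x $ i - H x $ i = 0" for i
  proof (rule AE_zero_of_test_functions[OF \<Omega>])
    have Gi: "sq_integrable ?N (\<lambda>x. G x $ i)" and Hi: "sq_integrable ?N (\<lambda>x. H x $ i)"
      using sG sH unfolding sq_integrable_vec[of _ G] sq_integrable_vec[of _ H] by auto
    then show "sq_integrable ?N (\<lambda>x. G x $ i - H x $ i)" by (rule sq_integrable_diff)
    fix \<phi> assume \<phi>: "\<phi> \<in> test_functions \<Omega>"
    note sq = test_function_sq_integrable(1)[OF \<Omega>s \<phi>]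
    have "(LINT x|?N. G x $ i * \<phi> x) = (LINT x|?N. H x $ i * \<phi> x)"
    proof -
      have "- (LINT x|?N. G x $ i * \<phi> x) = (LINT x|?N. u x * pderiv_at i \<phi> x)"
        using conjunct2[OF G[unfolded is_weak_grad_iff[OF \<Omega>s]]] \<phi> by simp
      also have "\<dots> = - (LINT x|?N. H x $ i * \<phi> x)"
        using conjunct2[OF H[unfolded is_weak_grad_iff[OF \<Omega>s]]] \<phi> by simp
      finally show ?thesis by (simp only: neg_equal_iff_equal)
    qed
    then show "(LINT x|?N. (G x $ i - H x $ i) * \<phi> x) = 0"
      using sq_integrable_inner[OF Gi sq] sq_integrable_inner[OF Hi sq]
      by (simp add: left_diff_distrib)
  qed
  then have "AE x in ?N. \<forall>i. G x $ i - H x $ i = 0" by (simp add: AE_all_countable)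
  then show ?thesis by eventually_elim (simp add: vec_eq_iff)
qed

section \<open>Linear structure of H1 and H10, and vanishing of functions in H10\<close>

lemma H1_iff:
  assumes "\<Omega> \<in> sets lebesgue"
  shows "u \<in> H1 \<Omega> \<longleftrightarrow> sq_integrable (lebesgue_on \<Omega>) u \<and> (\<exists>G. is_weak_grad \<Omega> u G)"
  unfolding H1_def mem_Collect_eq L2_iff_sq_integrable[OF assms] ..

lemma H1_D:
  assumes \<Omega>: "\<Omega> \<in> sets lebesgue" and u: "u \<in> H1 \<Omega>"
  shows "sq_integrable (lebesgue_on \<Omega>) u" and "is_weak_grad \<Omega> u (wgrad \<Omega> u)"
    and "sq_integrable (lebesgue_on \<Omega>) (wgrad \<Omega> u)"
proof -
  note u' = u[unfolded H1_iff[OF \<Omega>]]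
  show "sq_integrable (lebesgue_on \<Omega>) u" by (rule conjunct1[OF u'])
  show w: "is_weak_grad \<Omega> u (wgrad \<Omega> u)" unfolding wgrad_def by (rule someI_ex[OF conjunct2[OF u']])
  show "sq_integrable (lebesgue_on \<Omega>) (wgrad \<Omega> u)"
    by (rule conjunct1[OF w[unfolded is_weak_grad_iff[OF \<Omega>]]])
qed

lemma H1_I:
  assumes \<Omega>: "\<Omega> \<in> sets lebesgue"
    and "sq_integrable (lebesgue_on \<Omega>) u" "is_weak_grad \<Omega> u G"
  shows "u \<in> H1 \<Omega>"
  unfolding H1_iff[OF \<Omega>] by (intro conjI exI) (rule assms)+

lemma test_function_H1: "\<Omega> \<in> sets lebesgue \<Longrightarrow> \<phi> \<in> test_functions \<Omega> \<Longrightarrow> \<phi> \<in> H1 \<Omega>"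
  for \<Omega> :: "(real^'n) set"
  by (rule H1_I[OF _ test_function_sq_integrable(1) test_function_is_weak_grad])

lemma H1_lincomb:
  assumes \<Omega>: "\<Omega> \<in> sets lebesgue" and u: "u \<in> H1 \<Omega>" and v: "v \<in> H1 \<Omega>"
  shows "(\<lambda>x. c * u x + d * v x) \<in> H1 \<Omega>"
  using H1_I[OF \<Omega> sq_integrable_lincomb[OF H1_D(1)[OF \<Omega> u] H1_D(1)[OF \<Omega> v], of c d, unfolded real_scaleR_def]
      is_weak_grad_lincomb[OF \<Omega> H1_D(1,2)[OF \<Omega> u] H1_D(1,2)[OF \<Omega> v]]] .

lemma fun_subspace_H1:
  fixes \<Omega> :: "(real^'n) set"
  assumes "\<Omega> \<in> sets lebesgue" shows "fun_subspace (H1 \<Omega>)"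
  unfolding fun_subspace_def real_scaleR_def
  using H1_lincomb[OF assms] test_function_H1[OF assms zero_test_function] by blast

lemma ae_linear_wgrad:
  fixes \<Omega> :: "(real^'n) set"
  assumes \<Omega>: "open \<Omega>" "bounded \<Omega>"
  shows "ae_linear (lebesgue_on \<Omega>) (H1 \<Omega>) (wgrad \<Omega>)"
proof -
  have \<Omega>s: "\<Omega> \<in> sets lebesgue" using \<Omega>(1) by simp
  show ?thesis
    unfolding ae_linear_def real_scaleR_def
  proof (intro conjI ballI allI H1_D(3)[OF \<Omega>s])
    fix u v c d assume u: "u \<in> H1 \<Omega>" and v: "v \<in> H1 \<Omega>"
    show "AE x in lebesgue_on \<Omega>. wgrad \<Omega> (\<lambda>x. c * u x + d * v x) x = c *\<^sub>R wgrad \<Omega> u x + d *\<^sub>R wgrad \<Omega> v x"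
      by (rule weak_grad_unique[OF \<Omega> H1_D(2)[OF \<Omega>s H1_lincomb[OF \<Omega>s u v]]
            is_weak_grad_lincomb[OF \<Omega>s H1_D(1,2)[OF \<Omega>s u] H1_D(1,2)[OF \<Omega>s v]]])
  qed
qed

text \<open>The factors 1 make this literally a weighted sum of two semi-inner products, the shape
  treated by \<open>semi_inner_combination\<close>.\<close>

definition h1_inner :: "(real^'n) set \<Rightarrow> (real^'n \<Rightarrow> real) \<Rightarrow> (real^'n \<Rightarrow> real) \<Rightarrow> real"
  where "h1_inner \<Omega> u v = 1 * (LINT x|lebesgue_on \<Omega>. u x \<bullet> v x) +
    1 * (LINT x|lebesgue_on \<Omega>. wgrad \<Omega> u x \<bullet> wgrad \<Omega> v x)"

lemma semi_inner_h1:
  fixes \<Omega> :: "(real^'n) set"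
  assumes \<Omega>: "open \<Omega>" "bounded \<Omega>"
  shows "semi_inner_on (H1 \<Omega>) (h1_inner \<Omega>)"
proof -
  have \<Omega>s: "\<Omega> \<in> sets lebesgue" using \<Omega>(1) by simp
  show ?thesis
    unfolding h1_inner_def[abs_def]
    by (rule semi_inner_combination[OF semi_inner_ae_linear[OF ae_linear_id] semi_inner_ae_linear[OF ae_linear_wgrad[OF \<Omega>]]])
      (simp_all add: H1_D(1)[OF \<Omega>s] fun_subspace_H1[OF \<Omega>s])
qed

lemma l2_norm_square: "\<Omega> \<in> sets lebesgue \<Longrightarrow> (l2_norm \<Omega> f)\<^sup>2 = (LINT x|lebesgue_on \<Omega>. f x \<bullet> f x)"
  unfolding l2_norm_def by (simp add: l2_inner_eq)

lemma h1_norm_eq: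
  "\<Omega> \<in> sets lebesgue \<Longrightarrow> h1_norm \<Omega> u = sqrt (h1_inner \<Omega> u u)"
  unfolding h1_norm_def h1_inner_def by (simp add: l2_norm_square)

lemma tendsto_sqrt_zero_iff:
  fixes f :: "nat \<Rightarrow> real"
  assumes "\<And>n. 0 \<le> f n"
  shows "(\<lambda>n. sqrt (f n)) \<longlonglongrightarrow> 0 \<longleftrightarrow> f \<longlonglongrightarrow> 0"
proof
  assume "(\<lambda>n. sqrt (f n)) \<longlonglongrightarrow> 0"
  from tendsto_power[OF this, of 2] show "f \<longlonglongrightarrow> 0" using assms by simp
next
  assume "f \<longlonglongrightarrow> 0"
  from tendsto_real_sqrt[OF this] show "(\<lambda>n. sqrt (f n)) \<longlonglongrightarrow> 0" by simp
qed

text \<open>Convergence is restated for the squared norm, which is a quadratic form and hence open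
  to the semi-inner product estimates.\<close>

lemma H10_iff:
  fixes \<Omega> :: "(real^'n) set"
  assumes \<Omega>: "open \<Omega>" "bounded \<Omega>"
  shows "u \<in> H10 \<Omega> \<longleftrightarrow> u \<in> H1 \<Omega> \<and> (\<exists>\<phi>. (\<forall>n::nat. \<phi> n \<in> test_functions \<Omega>) \<and>
    (\<lambda>n. h1_inner \<Omega> (\<lambda>x. u x - \<phi> n x) (\<lambda>x. u x - \<phi> n x)) \<longlonglongrightarrow> 0)"
proof -
  have \<Omega>s: "\<Omega> \<in> sets lebesgue" using \<Omega>(1) by simp
  have nn: "0 \<le> h1_inner \<Omega> (\<lambda>x. u x - \<phi> x) (\<lambda>x. u x - \<phi> x)"
    if "u \<in> H1 \<Omega>" "\<phi> \<in> test_functions \<Omega>" for \<phi>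
    by (rule semi_inner_nonneg[OF semi_inner_h1[OF \<Omega>]
          fun_subspace_diff[OF fun_subspace_H1[OF \<Omega>s] that(1) test_function_H1[OF \<Omega>s that(2)]]])
  have "(\<lambda>n. h1_norm \<Omega> (\<lambda>x. u x - \<phi> n x)) \<longlonglongrightarrow> 0 \<longleftrightarrow>
    (\<lambda>n. h1_inner \<Omega> (\<lambda>x. u x - \<phi> n x) (\<lambda>x. u x - \<phi> n x)) \<longlonglongrightarrow> 0"
    if "u \<in> H1 \<Omega>" "\<forall>n::nat. \<phi> n \<in> test_functions \<Omega>" for \<phi>
    unfolding h1_norm_eq[OF \<Omega>s] by (rule tendsto_sqrt_zero_iff) (rule nn[OF that(1) that(2)[rule_format]])
  then show ?thesis unfolding H10_def mem_Collect_eq by blast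
qed

text \<open>Linear combinations of the approximating test functions approximate the linear
  combination; the parallelogram bound controls the squared error.\<close>

lemma fun_subspace_H10:
  fixes \<Omega> :: "(real^'n) set"
  assumes \<Omega>: "open \<Omega>" "bounded \<Omega>"
  shows "fun_subspace (H10 \<Omega>)"
  unfolding fun_subspace_def
proof (intro conjI ballI allI)
  have \<Omega>s: "\<Omega> \<in> sets lebesgue" using \<Omega>(1) by simp
  note S = fun_subspace_H1[OF \<Omega>s] and b = semi_inner_h1[OF \<Omega>]
  have z: "(\<lambda>_. 0) \<in> H1 \<Omega>" by (rule fun_subspace_zero[OF S])
  have "h1_inner \<Omega> (\<lambda>_. 0) (\<lambda>_. 0) = 0" by (rule linear_fun_zero[OF semi_inner_linear[OF b z] S])
  then show "(\<lambda>_. 0) \<in> H10 \<Omega>"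
    unfolding H10_iff[OF \<Omega>] using z zero_test_function[of \<Omega>]
    by (intro conjI exI[of _ "\<lambda>_ _. 0"]) simp_all
  fix u v c d assume "u \<in> H10 \<Omega>" "v \<in> H10 \<Omega>"
  then obtain \<phi> \<psi> where u: "u \<in> H1 \<Omega>" and \<phi>: "\<forall>n::nat. \<phi> n \<in> test_functions \<Omega>"
      "(\<lambda>n. h1_inner \<Omega> (\<lambda>x. u x - \<phi> n x) (\<lambda>x. u x - \<phi> n x)) \<longlonglongrightarrow> 0"
    and v: "v \<in> H1 \<Omega>" and \<psi>: "\<forall>n::nat. \<psi> n \<in> test_functions \<Omega>"
      "(\<lambda>n. h1_inner \<Omega> (\<lambda>x. v x - \<psi> n x) (\<lambda>x. v x - \<psi> n x)) \<longlonglongrightarrow> 0"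
    unfolding H10_iff[OF \<Omega>] by blast
  let ?w = "\<lambda>x. c *\<^sub>R u x + d *\<^sub>R v x" and ?\<chi> = "\<lambda>n x. c * \<phi> n x + d * \<psi> n x"
  let ?e = "\<lambda>n x. u x - \<phi> n x" and ?f = "\<lambda>n x. v x - \<psi> n x"
  have e: "?e n \<in> H1 \<Omega>" and f: "?f n \<in> H1 \<Omega>" for n
    by (rule fun_subspace_diff[OF S u test_function_H1[OF \<Omega>s \<phi>(1)[rule_format]]],
        rule fun_subspace_diff[OF S v test_function_H1[OF \<Omega>s \<psi>(1)[rule_format]]])
  have eq: "(\<lambda>x. ?w x - ?\<chi> n x) = (\<lambda>x. c *\<^sub>R ?e n x + d *\<^sub>R ?f n x)" for n
    by (rule ext) (simp only: real_scaleR_def algebra_simps)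
  have w: "?w \<in> H1 \<Omega>" by (rule fun_subspace_lincomb[OF S u v])
  have "(\<lambda>n. 2 * c\<^sup>2 * h1_inner \<Omega> (?e n) (?e n) + 2 * d\<^sup>2 * h1_inner \<Omega> (?f n) (?f n))
    \<longlonglongrightarrow> 2 * c\<^sup>2 * 0 + 2 * d\<^sup>2 * 0"
    by (intro tendsto_add tendsto_mult tendsto_const \<phi>(2) \<psi>(2))
  then have up: "(\<lambda>n. 2 * c\<^sup>2 * h1_inner \<Omega> (?e n) (?e n) + 2 * d\<^sup>2 * h1_inner \<Omega> (?f n) (?f n))
    \<longlonglongrightarrow> 0" by (simp only: mult_zero_right add_0)
  have lim: "(\<lambda>n. h1_inner \<Omega> (\<lambda>x. ?w x - ?\<chi> n x) (\<lambda>x. ?w x - ?\<chi> n x)) \<longlonglongrightarrow> 0"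
    unfolding eq
  proof (rule tendsto_sandwich[OF _ _ tendsto_const up])
    show "\<forall>\<^sub>F n in sequentially. 0 \<le> h1_inner \<Omega> (\<lambda>x. c *\<^sub>R ?e n x + d *\<^sub>R ?f n x) (\<lambda>x. c *\<^sub>R ?e n x + d *\<^sub>R ?f n x)"
      by (rule always_eventually) (rule allI, rule semi_inner_nonneg[OF b fun_subspace_lincomb[OF S e f]])
    show "\<forall>\<^sub>F n in sequentially. h1_inner \<Omega> (\<lambda>x. c *\<^sub>R ?e n x + d *\<^sub>R ?f n x) (\<lambda>x. c *\<^sub>R ?e n x + d *\<^sub>R ?f n x)
      \<le> 2 * c\<^sup>2 * h1_inner \<Omega> (?e n) (?e n) + 2 * d\<^sup>2 * h1_inner \<Omega> (?f n) (?f n)"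
      by (rule always_eventually) (rule allI, rule semi_inner_lincomb_le[OF b S e f])
  qed
  have \<chi>: "\<forall>n. ?\<chi> n \<in> test_functions \<Omega>"
    by (rule allI) (rule test_functions_lincomb[OF \<phi>(1)[rule_format] \<psi>(1)[rule_format]])
  show "?w \<in> H10 \<Omega>" unfolding H10_iff[OF \<Omega>] by (intro conjI exI[of _ ?\<chi>] w \<chi> lim)
qed

text \<open>If \<phi>_n approximates \<open>u\<close>, then almost everywhere the i-th derivative of
  \<phi>_n is minus that of the error u - \<phi>_n, hence small. The one-directional Poincare
  inequality makes \<phi>_n small in L2, and so \<open>u\<close> is zero.\<close>

lemma H10_zero_of_partial_zero:
  fixes \<Omega> :: "(real^'n) set"
  assumes \<Omega>: "open \<Omega>" "bounded \<Omega>" and u: "u \<in> H10 \<Omega>"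
    and zero: "AE x in lebesgue_on \<Omega>. wgrad \<Omega> u x $ i = 0"
  shows "AE x in lebesgue_on \<Omega>. u x = 0"
proof -
  let ?N = "lebesgue_on \<Omega>"
  have \<Omega>s: "\<Omega> \<in> sets lebesgue" using \<Omega>(1) by simp
  note S = fun_subspace_H1[OF \<Omega>s] and b = semi_inner_h1[OF \<Omega>]
  obtain \<phi> where uH: "u \<in> H1 \<Omega>" and \<phi>: "\<And>n::nat. \<phi> n \<in> test_functions \<Omega>"
      "(\<lambda>n. h1_inner \<Omega> (\<lambda>x. u x - \<phi> n x) (\<lambda>x. u x - \<phi> n x)) \<longlonglongrightarrow> 0"
    using u unfolding H10_iff[OF \<Omega>] by blast
  obtain R where R: "\<Omega> \<subseteq> cball 0 R" using bounded_subset_ballD[OF \<Omega>(2), of 0] ball_subset_cball by (metis order_trans)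
  let ?e = "\<lambda>n x. u x - \<phi> n x"
  define h where "h n = h1_inner \<Omega> (?e n) (?e n)" for n
  have su: "sq_integrable ?N u" by (rule H1_D(1)[OF \<Omega>s uH])
  \<comment> \<open>The constant comes from |u|^2 <= 2 |u - \<phi>_n|^2 + 2 |\<phi>_n|^2 and the
    Poincare constant 4 R^2 in the second term.\<close>
  have bound: "(LINT x|?N. u x \<bullet> u x) \<le> (2 + 8 * R\<^sup>2) * h n" for n
  proof -
    note \<phi>n = \<phi>(1)[of n]
    note sq = test_function_sq_integrable[OF \<Omega>s \<phi>n]
    have \<phi>H: "\<phi> n \<in> H1 \<Omega>" by (rule test_function_H1[OF \<Omega>s \<phi>n])
    have e: "?e n \<in> H1 \<Omega>" by (rule fun_subspace_diff[OF S uH \<phi>H])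
    note ge = H1_D(3)[OF \<Omega>s e]
    have gei: "sq_integrable ?N (\<lambda>x. wgrad \<Omega> (?e n) x $ i)"
      using ge unfolding sq_integrable_vec[of _ "wgrad \<Omega> (?e n)"] by blast
    have "AE x in ?N. wgrad \<Omega> (\<lambda>x. 1 *\<^sub>R u x + (-1) *\<^sub>R \<phi> n x) x = 1 *\<^sub>R wgrad \<Omega> u x + (-1) *\<^sub>R wgrad \<Omega> (\<phi> n) x"
      by (rule ae_linear_lincomb[OF ae_linear_wgrad[OF \<Omega>] uH \<phi>H])
    moreover have "(\<lambda>x. 1 *\<^sub>R u x + (-1) *\<^sub>R \<phi> n x) = ?e n" by simp
    ultimately have "AE x in ?N. wgrad \<Omega> (?e n) x = 1 *\<^sub>R wgrad \<Omega> u x + (-1) *\<^sub>R wgrad \<Omega> (\<phi> n) x"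
      by (simp only:)
    moreover have "AE x in ?N. wgrad \<Omega> (\<phi> n) x = (\<chi> i. pderiv_at i (\<phi> n) x)"
      by (rule weak_grad_unique[OF \<Omega> H1_D(2)[OF \<Omega>s \<phi>H] test_function_is_weak_grad[OF \<Omega>s \<phi>n]])
    ultimately have AEi: "AE x in ?N. wgrad \<Omega> (?e n) x $ i = - pderiv_at i (\<phi> n) x"
      using zero by eventually_elim (simp only: vector_add_component vector_scaleR_component vec_lambda_beta real_scaleR_def mult_zero_right add_0 mult_minus1)
    have "(LINT x|?N. pderiv_at i (\<phi> n) x * pderiv_at i (\<phi> n) x) =
      (LINT x|?N. wgrad \<Omega> (?e n) x $ i \<bullet> wgrad \<Omega> (?e n) x $ i)"
    proof (rule integral_cong_AE)
      show "(\<lambda>x. pderiv_at i (\<phi> n) x * pderiv_at i (\<phi> n) x) \<in> borel_measurable ?N"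
        by (intro borel_measurable_times sq_integrable_measurable[OF sq(2)])
      show "(\<lambda>x. wgrad \<Omega> (?e n) x $ i \<bullet> wgrad \<Omega> (?e n) x $ i) \<in> borel_measurable ?N"
        by (intro borel_measurable_inner sq_integrable_measurable[OF gei])
      show "AE x in ?N. pderiv_at i (\<phi> n) x * pderiv_at i (\<phi> n) x = wgrad \<Omega> (?e n) x $ i \<bullet> wgrad \<Omega> (?e n) x $ i"
        using AEi by eventually_elim simp
    qed
    also have "\<dots> \<le> (LINT x|?N. wgrad \<Omega> (?e n) x \<bullet> wgrad \<Omega> (?e n) x)"
    proof (rule integral_mono[OF sq_integrable_inner[OF gei gei] sq_integrable_inner[OF ge ge]])
      have "y $ i \<bullet> y $ i \<le> y \<bullet> y" for y :: "real^'n"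
        unfolding inner_vec_def by (rule member_le_sum) simp_all
      then show "wgrad \<Omega> (?e n) x $ i \<bullet> wgrad \<Omega> (?e n) x $ i \<le> wgrad \<Omega> (?e n) x \<bullet> wgrad \<Omega> (?e n) x" for x .
    qed
    finally have 1: "(LINT x|?N. pderiv_at i (\<phi> n) x * pderiv_at i (\<phi> n) x) \<le>
      (LINT x|?N. wgrad \<Omega> (?e n) x \<bullet> wgrad \<Omega> (?e n) x)" .
    define E G P D where "E = (LINT x|?N. ?e n x \<bullet> ?e n x)"
      and "G = (LINT x|?N. wgrad \<Omega> (?e n) x \<bullet> wgrad \<Omega> (?e n) x)"
      and "P = (LINT x|?N. \<phi> n x \<bullet> \<phi> n x)"
      and "D = (LINT x|?N. pderiv_at i (\<phi> n) x * pderiv_at i (\<phi> n) x)"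
    have hE: "h n = E + G" unfolding h_def h1_inner_def E_def G_def by (simp only: mult_1)
    have "0 \<le> E" unfolding E_def by (rule Bochner_Integration.integral_nonneg) (rule inner_ge_zero)
    moreover have "0 \<le> G" unfolding G_def by (rule Bochner_Integration.integral_nonneg) (rule inner_ge_zero)
    moreover have "D \<le> G" using 1 unfolding D_def G_def .
    moreover have "P \<le> 4 * R\<^sup>2 * D"
      using test_function_Poincare[OF \<Omega>s \<phi>n R, of i] unfolding P_def D_def inner_real_def .
    moreover have "(LINT x|?N. u x \<bullet> u x) \<le> 2 * E + 2 * P"
    proof -
      have se: "sq_integrable ?N (?e n)" by (rule H1_D(1)[OF \<Omega>s e])
      have mem: "?e n \<in> {f. sq_integrable ?N f}" "\<phi> n \<in> {f. sq_integrable ?N f}"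
        unfolding mem_Collect_eq by (rule se, rule sq(1))
      have eq: "1 *\<^sub>R (u x - \<phi> n x) + 1 *\<^sub>R \<phi> n x = u x" for x by simp
      show ?thesis
        using semi_inner_lincomb_le[OF semi_inner_sq_integrable[of ?N] fun_subspace_sq_integrable
            mem, of 1 1]
        unfolding eq E_def[symmetric] P_def[symmetric] by (simp only: power_one mult_1_right)
    qed
    moreover have "4 * R\<^sup>2 * D \<le> 4 * R\<^sup>2 * G" using \<open>D \<le> G\<close> by (intro mult_left_mono) simp_all
    moreover have "0 \<le> R\<^sup>2 * E" using \<open>0 \<le> E\<close> by (intro mult_nonneg_nonneg) simp_all
    moreover have "(2 + 8 * R\<^sup>2) * h n = 2 * E + 2 * G + 8 * (R\<^sup>2 * E) + 2 * (4 * R\<^sup>2 * G)"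
      unfolding hE by (simp add: algebra_simps)
    ultimately show ?thesis by linarith
  qed
  have "(\<lambda>n. (2 + 8 * R\<^sup>2) * h n) \<longlonglongrightarrow> (2 + 8 * R\<^sup>2) * 0"
    unfolding h_def by (intro tendsto_mult tendsto_const \<phi>(2))
  then have "(LINT x|?N. u x \<bullet> u x) \<le> (2 + 8 * R\<^sup>2) * 0"
    by (rule LIMSEQ_le_const) (use bound in blast)
  moreover have "0 \<le> (LINT x|?N. u x \<bullet> u x)"
    by (rule Bochner_Integration.integral_nonneg) (rule inner_ge_zero)
  ultimately have "(LINT x|?N. u x \<bullet> u x) = 0" by (simp only: mult_zero_right order_antisym)
  then show ?thesis by (rule AE_eq_zero_of_norm_zero[OF su])
qed

text \<open>Passage from almost everywhere to everywhere: the zero set of a continuous function is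
  closed, so it contains the open set \<open>\<Omega>\<close> and then its closure; the remaining
  points are covered by the extension by zero.\<close>

lemma continuous_zero_of_AE:
  fixes u :: "real^'n \<Rightarrow> real"
  assumes \<Omega>: "open \<Omega>" and u: "continuous_on UNIV u" and ae: "AE x in lebesgue_on \<Omega>. u x = 0"
    and out: "\<And>x. x \<notin> closure \<Omega> \<Longrightarrow> u x = 0"
  shows "u = (\<lambda>_. 0)"
proof -
  have cl: "closed {x. u x = 0}" using u by (intro closed_Collect_eq continuous_on_const)
  have sp: "\<Omega> \<inter> space lebesgue \<in> sets lebesgue" using \<Omega> by simp
  have "AE x in lebesgue. x \<in> \<Omega> \<longrightarrow> u x = 0" using ae unfolding AE_restrict_space_iff[OF sp] .
  then have "x \<in> {x. u x = 0}" if "x \<in> \<Omega>" for x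
    by (intro mem_closed_if_AE_lebesgue_open[OF \<Omega> cl _ that]) simp
  then have "closure \<Omega> \<subseteq> {x. u x = 0}" by (intro closure_minimal cl) blast
  then show ?thesis using out by blast
qed

section \<open>Finite-element spaces\<close>

definition sym_part :: "real^'n^'n \<Rightarrow> real^'n^'n"
  where "sym_part A = (1/2) *\<^sub>R (A + transpose A)"

lemma inner_transpose: "transpose A \<bullet> transpose A = A \<bullet> A" for A :: "real^'n^'n"
  unfolding inner_vec_def transpose_def vec_lambda_beta by (rule sum.swap)

lemma linear_sym_part: "linear sym_part"
  by (rule linearI) (simp_all add: sym_part_def transpose_def vec_eq_iff algebra_simps)

lemma linear_trace: "linear (trace :: real^'n^'n \<Rightarrow> real)"
  by (rule linearI) (simp_all add: trace_def sum.distrib sum_distrib_left)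

lemma trace_sym_part: "trace (sym_part A) = trace A"
  by (simp add: trace_def sym_part_def transpose_def)

lemma sym_part_diag: "sym_part A $ i $ i = A $ i $ i"
  by (simp add: sym_part_def transpose_def)

text \<open>Transposition preserves the Frobenius norm, so the symmetric part averages two matrices
  of equal norm.\<close>

lemma inner_sym_part_le: "sym_part A \<bullet> sym_part A \<le> A \<bullet> A"
proof -
  have "norm (transpose A) = norm A" by (simp only: norm_eq_sqrt_inner inner_transpose)
  then have "norm (sym_part A) \<le> norm A"
    unfolding sym_part_def using norm_triangle_ineq[of A "transpose A"] by simp
  from power_mono[OF this norm_ge_zero, of 2] show ?thesis by (simp only: dot_square_norm)
qed

text \<open>Cauchy-Schwarz for the diagonal against the all-ones vector; the off-diagonal entries
  only enlarge the right side.\<close>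

lemma trace_square_le: "(trace A)\<^sup>2 \<le> real CARD('n) * (A \<bullet> A)" for A :: "real^'n^'n"
proof -
  have "(trace A)\<^sup>2 \<le> (\<Sum>i\<in>UNIV. (A $ i $ i)\<^sup>2) * real CARD('n)"
    unfolding trace_def by (rule sum_squared_le_sum_of_squares)
  also have "(\<Sum>i\<in>UNIV. (A $ i $ i)\<^sup>2) \<le> (\<Sum>i\<in>UNIV. A $ i \<bullet> A $ i)"
  proof (rule sum_mono)
    show "(A $ i $ i)\<^sup>2 \<le> A $ i \<bullet> A $ i" for i
      unfolding inner_vec_def[of "A $ i"] inner_real_def power2_eq_square
      by (rule member_le_sum) simp_all
  qed
  finally show ?thesis by (simp add: inner_vec_def[of A] mult.commute)
qed

lemma strain_eq: "strain \<Omega> v = (\<lambda>x. sym_part (vgrad \<Omega> v x))"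
  by (simp add: fun_eq_iff strain_def sym_part_def)

lemma wdiv_eq: "wdiv \<Omega> v = (\<lambda>x. trace (vgrad \<Omega> v x))"
  by (simp add: fun_eq_iff wdiv_def)

section \<open>Local shape functions and their determination by point values\<close>

lemma fun_subspace_P1_local: "fun_subspace (P1_local T)" for T :: "(real^'n) set"
  unfolding fun_subspace_def P1_local_def real_scaleR_def
proof (intro conjI ballI allI)
  show "(\<lambda>_. 0) \<in> {p. \<exists>a b. \<forall>x. p x = a \<bullet> x + b}" by (auto intro: exI[of _ 0])
  fix u v :: "real^'n \<Rightarrow> real" and c d assume "u \<in> {p. \<exists>a b. \<forall>x. p x = a \<bullet> x + b}" "v \<in> {p. \<exists>a b. \<forall>x. p x = a \<bullet> x + b}"
  then obtain a b a' b' where "\<forall>x. u x = a \<bullet> x + b" "\<forall>x. v x = a' \<bullet> x + b'" by blast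
  then show "(\<lambda>x. c * u x + d * v x) \<in> {p. \<exists>a b. \<forall>x. p x = a \<bullet> x + b}"
    by (intro CollectI exI[of _ "c *\<^sub>R a + d *\<^sub>R a'"] exI[of _ "c * b + d * b'"])
      (simp add: inner_add_left algebra_simps)
qed

lemma fun_subspace_P1_bubble_local: "fun_subspace (P1_bubble_local T)" for T :: "(real^'n) set"
  unfolding fun_subspace_def P1_bubble_local_def real_scaleR_def
proof (intro conjI ballI allI)
  let ?P = "{p. \<exists>a b c. \<forall>x. p x = a \<bullet> x + b + c * bubble T x}"
  show "(\<lambda>_. 0) \<in> ?P" by (intro CollectI exI[of _ 0]) simp
  fix u v :: "real^'n \<Rightarrow> real" and c d assume "u \<in> ?P" "v \<in> ?P"
  then obtain a b e a' b' e' where "\<forall>x. u x = a \<bullet> x + b + e * bubble T x"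
    "\<forall>x. v x = a' \<bullet> x + b' + e' * bubble T x" by blast
  then show "(\<lambda>x. c * u x + d * v x) \<in> ?P"
    by (intro CollectI exI[of _ "c *\<^sub>R a + d *\<^sub>R a'"] exI[of _ "c * b + d * b'"] exI[of _ "c * e + d * e'"])
      (simp add: inner_add_left algebra_simps)
qed

text \<open>Places the piecewise linear spaces inside the bubble-enriched one, so a single
  determination argument serves both elements and the pressure.\<close>

lemma P1_local_subset: "P1_local T \<subseteq> P1_bubble_local T"
proof
  fix p assume "p \<in> P1_local T"
  then obtain a b where p: "\<forall>x. p x = a \<bullet> x + b" unfolding P1_local_def by blast
  show "p \<in> P1_bubble_local T"
    unfolding P1_bubble_local_def
    by (intro CollectI exI[of _ a] exI[of _ b] exI[of _ 0]) (simp add: p)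
qed

lemma fe_space_mono:
  assumes "\<And>T. loc T \<subseteq> loc' T" shows "fe_space loc \<Omega> \<T> \<subseteq> fe_space loc' \<Omega> \<T>"
  using assms unfolding fe_space_def by blast

lemma fun_subspace_fe_space:
  fixes \<Omega> :: "(real^'n) set"
  assumes \<Omega>: "open \<Omega>" "bounded \<Omega>" and loc: "\<And>T. fun_subspace (loc T)"
  shows "fun_subspace (fe_space loc \<Omega> \<T>)"
  unfolding fun_subspace_def
proof (intro conjI ballI allI)
  note H = fun_subspace_H10[OF \<Omega>]
  have "\<exists>p\<in>loc T. \<forall>x\<in>T. 0 = p x" for T
    by (rule bexI[OF _ fun_subspace_zero[OF loc]]) simp
  then show "(\<lambda>_. 0) \<in> fe_space loc \<Omega> \<T>"
    unfolding fe_space_def using fun_subspace_zero[OF H] by (intro CollectI conjI ballI allI impI) simp_all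
  fix u v c d assume u: "u \<in> fe_space loc \<Omega> \<T>" and v: "v \<in> fe_space loc \<Omega> \<T>"
  note u' = u[unfolded fe_space_def mem_Collect_eq] and v' = v[unfolded fe_space_def mem_Collect_eq]
  show "(\<lambda>x. c *\<^sub>R u x + d *\<^sub>R v x) \<in> fe_space loc \<Omega> \<T>"
    unfolding fe_space_def
  proof (intro CollectI conjI ballI allI impI)
    show "(\<lambda>x. c *\<^sub>R u x + d *\<^sub>R v x) \<in> H10 \<Omega>" using fun_subspace_lincomb[OF H] u' v' by blast
    show "continuous_on UNIV (\<lambda>x. c *\<^sub>R u x + d *\<^sub>R v x)"
      using u' v' by (intro continuous_on_add continuous_on_scaleR continuous_on_const) blast+
    show "c *\<^sub>R u x + d *\<^sub>R v x = 0" if "x \<notin> \<Union>\<T>" for x using u' v' that by simp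
    fix T assume T: "T \<in> \<T>"
    obtain p where p: "p \<in> loc T" "\<forall>x\<in>T. u x = p x" using u' T by blast
    obtain q where q: "q \<in> loc T" "\<forall>x\<in>T. v x = q x" using v' T by blast
    show "\<exists>p\<in>loc T. \<forall>x\<in>T. c *\<^sub>R u x + d *\<^sub>R v x = p x"
      by (rule bexI[OF _ fun_subspace_lincomb[OF loc p(1) q(1), of c d]]) (simp add: p(2) q(2))
  qed
qed

text \<open>A local shape function \<open>a \<bullet> x + b + c * bubble T x\<close> is the inner product of \<open>(a, b, c)\<close> with
  \<open>(x, 1, bubble T x)\<close>, so its values on a basis of the span of these vectors determine it on \<open>T\<close>.\<close>

lemma P1_bubble_determined:
  fixes T :: "(real^'n) set"
  obtains P where "finite P" "P \<subseteq> T"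
    "\<forall>p\<in>P1_bubble_local T. (\<forall>x\<in>P. p x = 0) \<longrightarrow> (\<forall>x\<in>T. p x = 0)"
proof -
  define f where "f x = (x, 1 :: real, bubble T x)" for x
  obtain B where B: "B \<subseteq> f ` T" "independent B" "f ` T \<subseteq> span B"
    \<comment> \<open>The basis is drawn from the image of \<open>T\<close>, so each basis vector is
      \<open>f y\<close> for a point \<open>y\<close> of \<open>T\<close>, which \<open>fst\<close>
      recovers.\<close>
    using maximal_independent_subset[of "f ` T"] by metis
  have fin: "finite B" using independent_imp_finite[OF B(2)] .
  show thesis
  proof (rule that[of "fst ` B"])
    show "finite (fst ` B)" using fin by simp
    show "fst ` B \<subseteq> T"
    proof
      fix x assume "x \<in> fst ` B"
      then obtain y where "y \<in> T" "x = fst (f y)" using B(1) by blast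
      then show "x \<in> T" by (simp add: f_def)
    qed
    show "\<forall>p\<in>P1_bubble_local T. (\<forall>x\<in>fst ` B. p x = 0) \<longrightarrow> (\<forall>x\<in>T. p x = 0)"
    proof (intro ballI impI)
      fix p x assume p: "p \<in> P1_bubble_local T" and z: "\<forall>x\<in>fst ` B. p x = 0" and x: "x \<in> T"
      obtain a b c where "\<forall>x. p x = a \<bullet> x + b + c * bubble T x"
        using p unfolding P1_bubble_local_def by blast
      then have pf: "p y = (a, b, c) \<bullet> f y" for y by (simp add: f_def inner_Pair)
      have "B \<subseteq> {w. (a, b, c) \<bullet> w = 0}"
      proof
        fix w assume w: "w \<in> B"
        then obtain y where y: "w = f y" using B(1) by blast
        have "p (fst w) = 0" using z w by blast
        then have "p y = 0" unfolding y by (simp add: f_def)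
        then show "w \<in> {w. (a, b, c) \<bullet> w = 0}" unfolding pf y by simp
      qed
      then have "span B \<subseteq> {w. (a, b, c) \<bullet> w = 0}" by (rule span_minimal[OF _ subspace_hyperplane])
      then show "p x = 0" unfolding pf using B(3) x by blast
    qed
  qed
qed

text \<open>The determining points of all simplices together suffice: the mesh is finite, and
  outside it the functions vanish by construction.\<close>

lemma fe_space_determined:
  fixes \<Omega> :: "(real^'n) set"
  assumes "finite \<T>"
  obtains P where "finite P" "\<And>v. v \<in> fe_space P1_bubble_local \<Omega> \<T> \<Longrightarrow> (\<And>x. x \<in> P \<Longrightarrow> v x = 0) \<Longrightarrow> v = (\<lambda>_. 0)"
proof -
  have "\<forall>T::(real^'n) set. \<exists>P. finite P \<and>
    (\<forall>p\<in>P1_bubble_local T. (\<forall>x\<in>P. p x = 0) \<longrightarrow> (\<forall>x\<in>T. p x = 0)) \<and> P \<subseteq> T"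
  proof
    fix T :: "(real^'n) set"
    obtain P where "finite P" "P \<subseteq> T"
      "\<forall>p\<in>P1_bubble_local T. (\<forall>x\<in>P. p x = 0) \<longrightarrow> (\<forall>x\<in>T. p x = 0)"
      by (rule P1_bubble_determined)
    then show "\<exists>P. finite P \<and>
      (\<forall>p\<in>P1_bubble_local T. (\<forall>x\<in>P. p x = 0) \<longrightarrow> (\<forall>x\<in>T. p x = 0)) \<and> P \<subseteq> T" by blast
  qed
  from choice[OF this] obtain P where P0: "\<forall>T::(real^'n) set. finite (P T) \<and>
    (\<forall>p\<in>P1_bubble_local T. (\<forall>x\<in>P T. p x = 0) \<longrightarrow> (\<forall>x\<in>T. p x = 0)) \<and> P T \<subseteq> T" ..
  have P: "finite (P T)" "P T \<subseteq> T"
    "p \<in> P1_bubble_local T \<Longrightarrow> (\<forall>x\<in>P T. p x = 0) \<Longrightarrow> x \<in> T \<Longrightarrow> p x = 0" for T p x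
    using P0[rule_format, of T] by auto
  show thesis
  proof (rule that[of "\<Union>T\<in>\<T>. P T"])
    show "finite (\<Union>T\<in>\<T>. P T)" using assms P(1) by (rule finite_UN_I)
    fix v assume v: "v \<in> fe_space P1_bubble_local \<Omega> \<T>" and z: "\<And>x. x \<in> (\<Union>T\<in>\<T>. P T) \<Longrightarrow> v x = 0"
    note v' = v[unfolded fe_space_def mem_Collect_eq]
    have "v x = 0" for x
    proof (cases "x \<in> \<Union>\<T>")
      case True
      then obtain T where T: "T \<in> \<T>" "x \<in> T" by blast
      obtain p where p: "p \<in> P1_bubble_local T" "\<forall>x\<in>T. v x = p x" using v' T(1) by blast
      have "\<forall>y\<in>P T. p y = 0"
      proof
        fix y assume y: "y \<in> P T"
        then have "v y = 0" using z T(1) by blast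
        moreover have "v y = p y" using p(2) P(2) y by blast
        ultimately show "p y = 0" by simp
      qed
      from P(3)[OF p(1) this T(2)] show ?thesis using p(2) T(2) by simp
    qed (use v' in blast)
    then show "v = (\<lambda>_. 0)" by blast
  qed
qed

section \<open>Bilinear forms of the Biot system\<close>

text \<open>The properties of the discrete spaces on which the analysis rests, without reference to
  a mesh. \<open>F\<close> is the scalar space of displacement components; \<open>points\<close>
  encodes finite dimension, while \<open>cont\<close> and \<open>outside\<close> turn almost
  everywhere statements into equalities.\<close>

locale fe_pair =
  fixes \<Omega> :: "(real^'n::finite) set" and F Q :: "(real^'n \<Rightarrow> real) set"
  assumes \<Omega>: "open \<Omega>" "bounded \<Omega>"
    and F: "fun_subspace F" "F \<subseteq> H10 \<Omega>" and Q: "fun_subspace Q" "Q \<subseteq> H10 \<Omega>"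
    and cont: "\<And>u. u \<in> F \<union> Q \<Longrightarrow> continuous_on UNIV u"
    and outside: "\<And>u x. u \<in> F \<union> Q \<Longrightarrow> x \<notin> closure \<Omega> \<Longrightarrow> u x = 0"
    and points: "\<exists>P. finite P \<and> (\<forall>u\<in>F \<union> Q. (\<forall>x\<in>P. u x = 0) \<longrightarrow> u = (\<lambda>_. 0))"
begin

abbreviation "N \<equiv> lebesgue_on \<Omega>"

definition V :: "(real^'n \<Rightarrow> real^'n) set" where "V = {v. \<forall>i. (\<lambda>x. v x $ i) \<in> F}"

lemma \<Omega>_sets: "\<Omega> \<in> sets lebesgue" using \<Omega>(1) by simp

lemma H10_H1: "H10 \<Omega> \<subseteq> H1 \<Omega>" unfolding H10_def by blast

lemma V_component: "v \<in> V \<Longrightarrow> (\<lambda>x. v x $ i) \<in> F" by (simp add: V_def)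

lemma V_component_H1: "v \<in> V \<Longrightarrow> (\<lambda>x. v x $ i) \<in> H1 \<Omega>"
  using V_component F(2) H10_H1 by blast

lemma Q_H1: "Q \<subseteq> H1 \<Omega>" using Q(2) H10_H1 by blast

lemma fun_subspace_V: "fun_subspace V"
  unfolding fun_subspace_def
proof (intro conjI ballI allI)
  show "(\<lambda>_. 0) \<in> V" unfolding V_def using fun_subspace_zero[OF F(1)] by simp
  fix u v c d assume "u \<in> V" "v \<in> V"
  then show "(\<lambda>x. c *\<^sub>R u x + d *\<^sub>R v x) \<in> V"
    unfolding V_def mem_Collect_eq vector_add_component vector_scaleR_component
    by (intro allI fun_subspace_lincomb[OF F(1)]) (simp_all only:)
qed

lemma finitely_determined_Q: "finitely_determined Q"
  using points finitely_determined_by_points[of _ Q] by (metis UnI2)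

lemma finitely_determined_V: "finitely_determined V"
proof -
  obtain P where P: "finite P" "\<forall>u\<in>F \<union> Q. (\<forall>x\<in>P. u x = 0) \<longrightarrow> u = (\<lambda>_. 0)" using points by metis
  show ?thesis
  proof (rule finitely_determined_by_points[OF P(1)])
    fix v assume v: "v \<in> V" and z: "\<And>x. x \<in> P \<Longrightarrow> v x = 0"
    have "(\<lambda>x. v x $ i) = (\<lambda>_. 0)" for i
      by (rule P(2)[rule_format]) (use V_component[OF v] z in auto)
    then have "v x $ i = 0" for x i by meson
    then show "v = (\<lambda>_. 0)" by (simp add: fun_eq_iff vec_eq_iff)
  qed
qed

lemma ae_linear_vgrad: "ae_linear N V (vgrad \<Omega>)"
  unfolding ae_linear_def
proof (intro conjI ballI allI)
  fix u assume u: "u \<in> V"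
  show "sq_integrable N (vgrad \<Omega> u)"
    unfolding sq_integrable_vec[of N "vgrad \<Omega> u"]
  proof
    show "sq_integrable N (\<lambda>x. vgrad \<Omega> u x $ i)" for i
      unfolding vgrad_def vec_lambda_beta by (rule H1_D(3)[OF \<Omega>_sets V_component_H1[OF u]])
  qed
next
  fix u v c d assume u: "u \<in> V" and v: "v \<in> V"
  let ?w = "\<lambda>x. c *\<^sub>R u x + d *\<^sub>R v x"
  have "AE x in N. wgrad \<Omega> (\<lambda>x. c *\<^sub>R (u x $ i) + d *\<^sub>R (v x $ i)) x =
    c *\<^sub>R wgrad \<Omega> (\<lambda>x. u x $ i) x + d *\<^sub>R wgrad \<Omega> (\<lambda>x. v x $ i) x" for i
    by (rule ae_linear_lincomb[OF ae_linear_wgrad[OF \<Omega>] V_component_H1[OF u] V_component_H1[OF v]])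
  then have "AE x in N. \<forall>i. wgrad \<Omega> (\<lambda>x. c *\<^sub>R (u x $ i) + d *\<^sub>R (v x $ i)) x =
    c *\<^sub>R wgrad \<Omega> (\<lambda>x. u x $ i) x + d *\<^sub>R wgrad \<Omega> (\<lambda>x. v x $ i) x"
    unfolding AE_all_countable by blast
  then show "AE x in N. vgrad \<Omega> ?w x = c *\<^sub>R vgrad \<Omega> u x + d *\<^sub>R vgrad \<Omega> v x"
  proof eventually_elim
    case (elim x)
    show ?case
      using elim
      by (simp add: vgrad_def vec_eq_iff)
  qed
qed

lemma ae_linear_strain: "ae_linear N V (strain \<Omega>)"
  unfolding strain_eq[abs_def] by (rule ae_linear_compose[OF ae_linear_vgrad linear_sym_part])

lemma ae_linear_wdiv: "ae_linear N V (wdiv \<Omega>)"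
  unfolding wdiv_eq[abs_def] by (rule ae_linear_compose[OF ae_linear_vgrad linear_trace])

lemma ae_linear_wgrad_Q: "ae_linear N Q (wgrad \<Omega>)"
  by (rule ae_linear_mono[OF ae_linear_wgrad[OF \<Omega>] Q_H1])

lemma ae_linear_id_Q: "ae_linear N Q (\<lambda>p. p)"
  by (rule ae_linear_id) (rule H1_D(1)[OF \<Omega>_sets subsetD[OF Q_H1]])

section \<open>The component forms and their definiteness\<close>

definition grad_form :: "(real^'n \<Rightarrow> real) \<Rightarrow> (real^'n \<Rightarrow> real) \<Rightarrow> real"
  where "grad_form p q = (LINT x|N. wgrad \<Omega> p x \<bullet> wgrad \<Omega> q x)"

definition mass_form :: "(real^'n \<Rightarrow> real) \<Rightarrow> (real^'n \<Rightarrow> real) \<Rightarrow> real"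
  where "mass_form p q = (LINT x|N. p x \<bullet> q x)"

definition strain_form :: "(real^'n \<Rightarrow> real^'n) \<Rightarrow> (real^'n \<Rightarrow> real^'n) \<Rightarrow> real"
  where "strain_form u v = (LINT x|N. strain \<Omega> u x \<bullet> strain \<Omega> v x)"

definition div_form :: "(real^'n \<Rightarrow> real^'n) \<Rightarrow> (real^'n \<Rightarrow> real^'n) \<Rightarrow> real"
  where "div_form u v = (LINT x|N. wdiv \<Omega> u x \<bullet> wdiv \<Omega> v x)"

lemma a_form_eq: "a_form \<Omega> lam \<mu> u v = 2 * \<mu> * strain_form u v + lam * div_form u v"
  unfolding a_form_def strain_form_def div_form_def set_integral_eq_lebesgue_on[OF \<Omega>_sets]
    inner_real_def ..

lemma ap_form_eq: "ap_form \<Omega> K p q = K * grad_form p q"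
  unfolding ap_form_def grad_form_def set_integral_eq_lebesgue_on[OF \<Omega>_sets] inner_scaleR_left
  by (rule integral_mult_right_zero)

lemma semi_inner_grad: "semi_inner_on Q grad_form"
  unfolding grad_form_def[abs_def] by (rule semi_inner_ae_linear[OF ae_linear_wgrad_Q Q(1)])

lemma semi_inner_mass: "semi_inner_on Q mass_form"
  unfolding mass_form_def[abs_def] by (rule semi_inner_ae_linear[OF ae_linear_id_Q Q(1)])

lemma semi_inner_strain: "semi_inner_on V strain_form"
  unfolding strain_form_def[abs_def] by (rule semi_inner_ae_linear[OF ae_linear_strain fun_subspace_V])

lemma semi_inner_div: "semi_inner_on V div_form"
  unfolding div_form_def[abs_def] by (rule semi_inner_ae_linear[OF ae_linear_wdiv fun_subspace_V])

lemma mass_form_definite: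
  assumes p: "p \<in> Q" and z: "mass_form p p = 0" shows "p = (\<lambda>_. 0)"
proof (rule continuous_zero_of_AE[OF \<Omega>(1)])
  show "continuous_on UNIV p" by (rule cont[OF UnI2[OF p]])
  show "AE x in N. p x = 0"
    by (rule AE_eq_zero_of_norm_zero[OF H1_D(1)[OF \<Omega>_sets subsetD[OF Q_H1 p]] z[unfolded mass_form_def]])
  show "p x = 0" if "x \<notin> closure \<Omega>" for x by (rule outside[OF UnI2[OF p] that])
qed

text \<open>No Korn inequality is needed: the diagonal of \<open>\<epsilon>(u) = 0\<close> says \<open>\<partial>\<^sub>i u\<^sub>i = 0\<close>, and a function of
  \<open>H10 \<Omega>\<close> with one vanishing partial derivative is zero.\<close>

lemma strain_form_definite:
  assumes u: "u \<in> V" and z: "strain_form u u = 0" shows "u = (\<lambda>_. 0)"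
proof -
  have ae: "AE x in N. strain \<Omega> u x = 0"
    by (rule AE_eq_zero_of_norm_zero[OF ae_linear_sq_integrable[OF ae_linear_strain u] z[unfolded strain_form_def]])
  have "(\<lambda>x. u x $ i) = (\<lambda>_. 0)" for i
  proof (rule continuous_zero_of_AE[OF \<Omega>(1)])
    note ui = V_component[OF u, of i]
    show "continuous_on UNIV (\<lambda>x. u x $ i)" by (rule cont[OF UnI1[OF ui]])
    show "AE x in N. u x $ i = 0"
    proof (rule H10_zero_of_partial_zero[OF \<Omega> subsetD[OF F(2) ui]])
      show "AE x in N. wgrad \<Omega> (\<lambda>x. u x $ i) x $ i = 0"
        using ae
      proof eventually_elim
        case (elim x)
        have "strain \<Omega> u x $ i $ i = wgrad \<Omega> (\<lambda>x. u x $ i) x $ i"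
          unfolding strain_eq sym_part_diag vgrad_def vec_lambda_beta ..
        then show ?case unfolding elim by simp
      qed
    qed
    show "u x $ i = 0" if "x \<notin> closure \<Omega>" for x by (rule outside[OF UnI1[OF ui] that])
  qed
  then have "u x $ i = 0" for x i by meson
  then show ?thesis by (simp add: fun_eq_iff vec_eq_iff)
qed

lemma vgrad_inner_integrable: "v \<in> V \<Longrightarrow> integrable N (\<lambda>x. vgrad \<Omega> v x \<bullet> vgrad \<Omega> v x)"
  using sq_integrable_inner[OF ae_linear_sq_integrable[OF ae_linear_vgrad] ae_linear_sq_integrable[OF ae_linear_vgrad]] .

lemma strain_inner_integrable: "v \<in> V \<Longrightarrow> integrable N (\<lambda>x. strain \<Omega> v x \<bullet> strain \<Omega> v x)"
  using sq_integrable_inner[OF ae_linear_sq_integrable[OF ae_linear_strain] ae_linear_sq_integrable[OF ae_linear_strain]] .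

lemma wdiv_inner_integrable: "v \<in> V \<Longrightarrow> integrable N (\<lambda>x. wdiv \<Omega> v x \<bullet> wdiv \<Omega> v x)"
  using sq_integrable_inner[OF ae_linear_sq_integrable[OF ae_linear_wdiv] ae_linear_sq_integrable[OF ae_linear_wdiv]] .

text \<open>Symmetrization keeps the diagonal, so the divergence is also the trace of the
  strain.\<close>

lemma div_form_le_strain_form:
  assumes v: "v \<in> V" shows "div_form v v \<le> real CARD('n) * strain_form v v"
proof -
  have "div_form v v \<le> (LINT x|N. real CARD('n) * (strain \<Omega> v x \<bullet> strain \<Omega> v x))"
    unfolding div_form_def
  proof (rule integral_mono[OF wdiv_inner_integrable[OF v] Bochner_Integration.integrable_mult_right[OF strain_inner_integrable[OF v]]])
    show "wdiv \<Omega> v x \<bullet> wdiv \<Omega> v x \<le> real CARD('n) * (strain \<Omega> v x \<bullet> strain \<Omega> v x)" for x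
      using trace_square_le[of "sym_part (vgrad \<Omega> v x)"]
      unfolding wdiv_eq strain_eq trace_sym_part inner_real_def power2_eq_square .
  qed
  also have "\<dots> = real CARD('n) * strain_form v v"
    unfolding strain_form_def by (rule integral_mult_right_zero)
  finally show ?thesis .
qed

definition grad_norm2 :: "(real^'n \<Rightarrow> real^'n) \<Rightarrow> real"
  where "grad_norm2 v = (LINT x|N. vgrad \<Omega> v x \<bullet> vgrad \<Omega> v x)"

lemma strain_form_le:
  assumes v: "v \<in> V" shows "strain_form v v \<le> grad_norm2 v"
  unfolding strain_form_def grad_norm2_def strain_eq
  by (rule integral_mono[OF strain_inner_integrable[OF v, unfolded strain_eq] vgrad_inner_integrable[OF v]])
    (rule inner_sym_part_le)

lemma grad_norm2_le: "grad_norm2 v \<le> (vh1_norm \<Omega> v)\<^sup>2"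
proof -
  have "(vh1_norm \<Omega> v)\<^sup>2 = (l2_norm \<Omega> v)\<^sup>2 + (l2_norm \<Omega> (vgrad \<Omega> v))\<^sup>2"
    unfolding vh1_norm_def by (rule real_sqrt_pow2) (rule add_nonneg_nonneg[OF zero_le_power2 zero_le_power2])
  moreover have "(l2_norm \<Omega> (vgrad \<Omega> v))\<^sup>2 = grad_norm2 v"
    unfolding grad_norm2_def by (rule l2_norm_square[OF \<Omega>_sets])
  ultimately show ?thesis using zero_le_power2[of "l2_norm \<Omega> v"] by linarith
qed

end

text \<open>Here \<open>P\<close> and \<open>G\<close> are the L2 norms of a pressure and of its
  gradient, \<open>A\<close> is the energy norm of the representer, and \<open>c\<close> is
  \<open>C p p\<close>. Scaling by t = \<alpha> / \<zeta> gives \<gamma> t P <= sqrt d A + \<xi> t h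
  G. Squaring produces the factor 2, and the stabilization bounds (t h G)^2 by c / \<delta>.\<close>

lemma infsup_arith:
  fixes \<gamma> \<xi> \<delta> h \<alpha> \<zeta> d P G A c :: real
  assumes pos: "\<gamma> > 0" "\<delta> > 0" "\<alpha> > 0" "\<zeta> > 0" and nonneg: "\<xi> \<ge> 0" "d \<ge> 0" "P \<ge> 0" "A \<ge> 0" "c \<ge> 0"
    and le: "\<gamma> * P - \<xi> * h * G \<le> sqrt d * \<zeta> * A / \<alpha>"
    and c: "\<delta> * (\<alpha>\<^sup>2 / \<zeta>\<^sup>2) * h\<^sup>2 * G\<^sup>2 \<le> c"
  shows "\<alpha>\<^sup>2 / \<zeta>\<^sup>2 * P\<^sup>2 \<le> 2 * (d + \<xi>\<^sup>2 / \<delta>) / \<gamma>\<^sup>2 * (A\<^sup>2 + c)"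
proof -
  define t where "t = \<alpha> / \<zeta>"
  have t: "t > 0" "\<zeta> / \<alpha> * t = 1" "\<alpha>\<^sup>2 / \<zeta>\<^sup>2 = t\<^sup>2"
    using pos by (simp_all add: t_def power_divide)
  define X Y where "X = t * P" and "Y = t * h * G"
  have "t * (\<gamma> * P - \<xi> * h * G) \<le> t * (sqrt d * \<zeta> * A / \<alpha>)" using le t(1) by (intro mult_left_mono) simp_all
  also have "t * (sqrt d * \<zeta> * A / \<alpha>) = (\<zeta> / \<alpha> * t) * (sqrt d * A)" by (simp add: field_simps)
  finally have 1: "\<gamma> * X \<le> sqrt d * A + \<xi> * Y" unfolding t(2) X_def Y_def by (simp add: algebra_simps)
  have X: "0 \<le> \<gamma> * X" using pos nonneg t by (simp add: X_def)
  have Y: "Y\<^sup>2 \<le> c / \<delta>"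
  proof -
    have "\<delta> * Y\<^sup>2 \<le> c" using c unfolding t(3) Y_def by (simp add: power_mult_distrib mult.assoc)
    then show ?thesis using pos(2) by (simp add: pos_le_divide_eq mult.commute)
  qed
  have "(\<gamma> * X)\<^sup>2 \<le> (sqrt d * A + \<xi> * Y)\<^sup>2" using 1 X by (rule power_mono)
  also have "\<dots> \<le> 2 * (sqrt d * A)\<^sup>2 + 2 * (\<xi> * Y)\<^sup>2"
  proof -
    have "(x + y)\<^sup>2 \<le> 2 * x\<^sup>2 + 2 * y\<^sup>2" for x y :: real
      using sum_squares_bound[of x y] unfolding power2_sum by linarith
    then show ?thesis .
  qed
  also have "\<dots> = 2 * (d * A\<^sup>2) + 2 * (\<xi>\<^sup>2 * Y\<^sup>2)" using nonneg(2) by (simp only: power_mult_distrib real_sqrt_pow2)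
  also have "\<dots> \<le> 2 * (d * A\<^sup>2) + 2 * (\<xi>\<^sup>2 * (c / \<delta>))"
    using Y by (intro add_left_mono mult_left_mono) simp_all
  \<comment> \<open>The nonnegative mixed terms d c and (\<xi>^2 / \<delta>) A^2 are added so that
    the bound factors.\<close>
  also have "\<dots> \<le> 2 * (d + \<xi>\<^sup>2 / \<delta>) * (A\<^sup>2 + c)"
  proof -
    have "0 \<le> d * c" "0 \<le> \<xi>\<^sup>2 / \<delta> * A\<^sup>2" using nonneg pos by simp_all
    moreover have "2 * (d + \<xi>\<^sup>2 / \<delta>) * (A\<^sup>2 + c) =
      2 * (d * A\<^sup>2) + 2 * (\<xi>\<^sup>2 * (c / \<delta>)) + 2 * (d * c) + 2 * (\<xi>\<^sup>2 / \<delta> * A\<^sup>2)"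
      by (simp add: algebra_simps add_divide_distrib)
    ultimately show ?thesis by linarith
  qed
  finally have "\<gamma>\<^sup>2 * X\<^sup>2 \<le> 2 * (d + \<xi>\<^sup>2 / \<delta>) * (A\<^sup>2 + c)" by (simp only: power_mult_distrib)
  moreover have "\<gamma>\<^sup>2 > 0" using pos(1) by simp
  ultimately have "X\<^sup>2 \<le> 2 * (d + \<xi>\<^sup>2 / \<delta>) * (A\<^sup>2 + c) / \<gamma>\<^sup>2"
    by (simp only: pos_le_divide_eq mult.commute)
  then show ?thesis unfolding t(3) X_def by (simp only: power_mult_distrib times_divide_eq_left)
qed

lemma linear_fun_scale_right: "linear_fun S f \<Longrightarrow> linear_fun S (\<lambda>v. k * f v)"
  by (simp add: linear_fun_def algebra_simps)

section \<open>The coupling form, energy bounds and operator blocks\<close>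

context fe_pair
begin

text \<open>The coupling without the minus sign of \<open>B_op\<close>; the abstract coupling form
  \<open>c\<close> is obtained as -\<alpha> times this.\<close>

definition dv :: "(real^'n \<Rightarrow> real^'n) \<Rightarrow> (real^'n \<Rightarrow> real) \<Rightarrow> real"
  where "dv v q = (LINT x|N. wdiv \<Omega> v x \<bullet> q x)"

lemma l2_inner_wdiv: "l2_inner \<Omega> (wdiv \<Omega> v) q = dv v q"
  unfolding dv_def by (rule l2_inner_eq[OF \<Omega>_sets])

lemma linear_dv_left: "q \<in> Q \<Longrightarrow> linear_fun V (\<lambda>v. dv v q)"
  unfolding dv_def inner_commute[of "wdiv \<Omega> _ _"]
  by (rule linear_fun_integral_ae_linear[OF ae_linear_wdiv fun_subspace_V ae_linear_sq_integrable[OF ae_linear_id_Q]])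

lemma linear_dv_right: "v \<in> V \<Longrightarrow> linear_fun Q (dv v)"
  unfolding dv_def[abs_def]
  by (rule linear_fun_integral_ae_linear[OF ae_linear_id_Q Q(1) ae_linear_sq_integrable[OF ae_linear_wdiv]])

lemma dv_le:
  assumes "v \<in> V" "q \<in> Q"
  shows "\<bar>dv v q\<bar> \<le> sqrt (div_form v v) * sqrt (mass_form q q)"
  unfolding dv_def div_form_def mass_form_def
  by (rule sq_integrable_Cauchy_Schwarz[OF ae_linear_sq_integrable[OF ae_linear_wdiv assms(1)]
        ae_linear_sq_integrable[OF ae_linear_id_Q assms(2)]])

lemma semi_inner_a: "0 \<le> lam \<Longrightarrow> 0 < \<mu> \<Longrightarrow> semi_inner_on V (a_form \<Omega> lam \<mu>)"
  unfolding a_form_eq[abs_def] by (rule semi_inner_combination[OF semi_inner_strain semi_inner_div]) simp_all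

lemma inner_a:
  assumes "0 \<le> lam" "0 < \<mu>"
  shows "inner_on V (a_form \<Omega> lam \<mu>)"
  unfolding inner_on_def
proof (intro conjI ballI impI semi_inner_a assms)
  fix u assume u: "u \<in> V" and z: "a_form \<Omega> lam \<mu> u u = 0"
  have "0 \<le> lam * div_form u u" "0 \<le> strain_form u u"
    using semi_inner_nonneg[OF semi_inner_div u] semi_inner_nonneg[OF semi_inner_strain u] assms(1) by simp_all
  moreover have "2 * \<mu> * strain_form u u + lam * div_form u u = 0" using z unfolding a_form_eq .
  moreover have "0 \<le> 2 * \<mu> * strain_form u u" using calculation(2) assms(2) by simp
  ultimately have "2 * \<mu> * strain_form u u = 0" by linarith
  then have "strain_form u u = 0" using assms(2) by simp
  then show "u = (\<lambda>_. 0)" by (rule strain_form_definite[OF u])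
qed

text \<open>Definiteness is taken from the mass term, so a nonnegative weight on the gradient part
  suffices.\<close>

lemma inner_s:
  assumes "0 \<le> k" "0 < l"
  shows "inner_on Q (\<lambda>p q. k * grad_form p q + l * mass_form p q)"
  unfolding inner_on_def
proof (intro conjI ballI impI semi_inner_combination semi_inner_grad semi_inner_mass)
  fix p assume p: "p \<in> Q" and z: "k * grad_form p p + l * mass_form p p = 0"
  have "0 \<le> k * grad_form p p" "0 \<le> l * mass_form p p"
    using semi_inner_nonneg[OF semi_inner_grad p] semi_inner_nonneg[OF semi_inner_mass p] assms by simp_all
  with z have "l * mass_form p p = 0" by linarith
  then have "mass_form p p = 0" using assms(2) by simp
  then show "p = (\<lambda>_. 0)" by (rule mass_form_definite[OF p])
qed (use assms in simp_all)

text \<open>The strain term is traded for the divergence at the rate 1 / d, which is the origin of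
  \<zeta>^2 = \<lambda> + 2 \<mu> / d.\<close>

lemma div_form_le_a_form:
  assumes lam: "0 \<le> lam" "0 < \<mu>" and v: "v \<in> V"
  shows "(lam + 2 * \<mu> / real CARD('n)) * div_form v v \<le> a_form \<Omega> lam \<mu> v v"
proof -
  have "2 * \<mu> / real CARD('n) * div_form v v \<le> 2 * \<mu> / real CARD('n) * (real CARD('n) * strain_form v v)"
    using lam by (intro mult_left_mono div_form_le_strain_form[OF v]) simp
  also have "\<dots> = 2 * \<mu> * strain_form v v" by simp
  finally show ?thesis unfolding a_form_eq distrib_right by linarith
qed

text \<open>Counterpart of the preceding bound: now the divergence is traded for the strain at the
  rate d, and 2 \<mu> + \<lambda> d equals d \<zeta>^2.\<close>

lemma a_form_le_vh1_norm:
  assumes lam: "0 \<le> lam" "0 < \<mu>" and v: "v \<in> V"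
  shows "a_form \<Omega> lam \<mu> v v \<le> real CARD('n) * (lam + 2 * \<mu> / real CARD('n)) * (vh1_norm \<Omega> v)\<^sup>2"
proof -
  have "lam * div_form v v \<le> lam * (real CARD('n) * strain_form v v)"
    using lam by (intro mult_left_mono div_form_le_strain_form[OF v])
  then have "a_form \<Omega> lam \<mu> v v \<le> (2 * \<mu> + lam * real CARD('n)) * strain_form v v"
    unfolding a_form_eq by (simp add: algebra_simps)
  also have "2 * \<mu> + lam * real CARD('n) = real CARD('n) * (lam + 2 * \<mu> / real CARD('n))"
    by (simp add: algebra_simps)
  also have "real CARD('n) * (lam + 2 * \<mu> / real CARD('n)) * strain_form v v \<le>
    real CARD('n) * (lam + 2 * \<mu> / real CARD('n)) * (vh1_norm \<Omega> v)\<^sup>2"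
    using lam by (intro mult_left_mono order_trans[OF strain_form_le[OF v] grad_norm2_le]) simp
  finally show ?thesis .
qed

lemma vh1_norm_nonneg: "0 \<le> vh1_norm \<Omega> v"
  unfolding vh1_norm_def by (rule real_sqrt_ge_zero) (rule add_nonneg_nonneg[OF zero_le_power2 zero_le_power2])

lemma l2_norm_eq: "l2_norm \<Omega> p = sqrt (mass_form p p)" "l2_norm \<Omega> (wgrad \<Omega> p) = sqrt (grad_form p p)"
  unfolding l2_norm_def mass_form_def grad_form_def l2_inner_eq[OF \<Omega>_sets] by (rule refl)+

text \<open>The double negation is deliberate: with c v p = -\<alpha> (div v, p), the negated second
  equation carries \<open>- c u q\<close>, the sign pattern of the abstract saddle point
  problem.\<close>

lemma biot_op_eq:
  assumes u: "u \<in> V" and p: "p \<in> Q"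
  shows "biot_op \<Omega> V Q lam \<mu> \<alpha> K \<tau> \<eta> h (u, p) =
    (functional V (\<lambda>v. a_form \<Omega> lam \<mu> u v + - \<alpha> * dv v p),
     functional Q (\<lambda>q. - (- \<alpha> * dv u q) + (\<tau> * K + \<eta> * h\<^sup>2) * grad_form p q))"
  unfolding biot_op_def block_def fst_conv snd_conv
proof (intro arg_cong2[where f=Pair] ext)
  show "Au_op \<Omega> lam \<mu> V u v + \<alpha> * BT_op \<Omega> V Q p v = functional V (\<lambda>v. a_form \<Omega> lam \<mu> u v + - \<alpha> * dv v p) v" for v
    unfolding Au_op_def BT_op_def B_op_def functional_def l2_inner_wdiv using p by simp
  show "- \<alpha> * B_op \<Omega> Q u q + (\<tau> * Ap_op \<Omega> K Q p q + \<eta> * h\<^sup>2 * Lp_op \<Omega> Q p q) =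
    functional Q (\<lambda>q. - (- \<alpha> * dv u q) + (\<tau> * K + \<eta> * h\<^sup>2) * grad_form p q) q" for q
    unfolding Ap_op_def Lp_op_def B_op_def functional_def l2_inner_wdiv ap_form_eq
    unfolding l2_inner_eq[OF \<Omega>_sets] grad_form_def[symmetric]
    by (simp add: algebra_simps)
qed

lemma precond_block_eq:
  assumes u: "u \<in> V" and p: "p \<in> Q"
  shows "block (Au_op \<Omega> lam \<mu> V) (\<lambda>p v. \<alpha> * BT_op \<Omega> V Q p v) (\<lambda>u q. 0)
      (\<lambda>p q. \<tau> * Ap_op \<Omega> K Q p q + \<eta> * h\<^sup>2 * Lp_op \<Omega> Q p q + \<alpha>\<^sup>2 / \<zeta>\<^sup>2 * M_op \<Omega> Q p q) (u, p) =
    (functional V (\<lambda>v. a_form \<Omega> lam \<mu> u v + - \<alpha> * dv v p),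
     functional Q (\<lambda>q. (\<tau> * K + \<eta> * h\<^sup>2) * grad_form p q + \<alpha>\<^sup>2 / \<zeta>\<^sup>2 * mass_form p q))"
    and "block (Au_op \<Omega> lam \<mu> V) (\<lambda>p v. 0) (\<lambda>u q. 0)
      (\<lambda>p q. \<tau> * Ap_op \<Omega> K Q p q + \<eta> * h\<^sup>2 * Lp_op \<Omega> Q p q + \<alpha>\<^sup>2 / \<zeta>\<^sup>2 * M_op \<Omega> Q p q) (u, p) =
    (functional V (\<lambda>v. a_form \<Omega> lam \<mu> u v),
     functional Q (\<lambda>q. (\<tau> * K + \<eta> * h\<^sup>2) * grad_form p q + \<alpha>\<^sup>2 / \<zeta>\<^sup>2 * mass_form p q))"
proof -
  have 1: "Au_op \<Omega> lam \<mu> V u v + \<alpha> * BT_op \<Omega> V Q p v = functional V (\<lambda>v. a_form \<Omega> lam \<mu> u v + - \<alpha> * dv v p) v" for v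
    unfolding Au_op_def BT_op_def B_op_def functional_def l2_inner_wdiv using p by simp
  have 2: "0 + (\<tau> * Ap_op \<Omega> K Q p q + \<eta> * h\<^sup>2 * Lp_op \<Omega> Q p q + \<alpha>\<^sup>2 / \<zeta>\<^sup>2 * M_op \<Omega> Q p q) =
    functional Q (\<lambda>q. (\<tau> * K + \<eta> * h\<^sup>2) * grad_form p q + \<alpha>\<^sup>2 / \<zeta>\<^sup>2 * mass_form p q) q" for q
    unfolding Ap_op_def Lp_op_def M_op_def functional_def ap_form_eq
      l2_inner_eq[OF \<Omega>_sets] grad_form_def[symmetric] mass_form_def[symmetric]
    by (simp add: algebra_simps)
  have 3: "Au_op \<Omega> lam \<mu> V u v + 0 = functional V (\<lambda>v. a_form \<Omega> lam \<mu> u v) v" for v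
    unfolding Au_op_def by simp
  show "block (Au_op \<Omega> lam \<mu> V) (\<lambda>p v. \<alpha> * BT_op \<Omega> V Q p v) (\<lambda>u q. 0)
      (\<lambda>p q. \<tau> * Ap_op \<Omega> K Q p q + \<eta> * h\<^sup>2 * Lp_op \<Omega> Q p q + \<alpha>\<^sup>2 / \<zeta>\<^sup>2 * M_op \<Omega> Q p q) (u, p) =
    (functional V (\<lambda>v. a_form \<Omega> lam \<mu> u v + - \<alpha> * dv v p),
     functional Q (\<lambda>q. (\<tau> * K + \<eta> * h\<^sup>2) * grad_form p q + \<alpha>\<^sup>2 / \<zeta>\<^sup>2 * mass_form p q))"
    unfolding block_def fst_conv snd_conv 1 2 ..
  show "block (Au_op \<Omega> lam \<mu> V) (\<lambda>p v. 0) (\<lambda>u q. 0)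
      (\<lambda>p q. \<tau> * Ap_op \<Omega> K Q p q + \<eta> * h\<^sup>2 * Lp_op \<Omega> Q p q + \<alpha>\<^sup>2 / \<zeta>\<^sup>2 * M_op \<Omega> Q p q) (u, p) =
    (functional V (\<lambda>v. a_form \<Omega> lam \<mu> u v),
     functional Q (\<lambda>q. (\<tau> * K + \<eta> * h\<^sup>2) * grad_form p q + \<alpha>\<^sup>2 / \<zeta>\<^sup>2 * mass_form p q))"
    unfolding block_def fst_conv snd_conv 3 2 ..
qed

end

section \<open>Parameter-uniform estimates for the Biot operator\<close>

context fe_pair
begin

text \<open>Since \<alpha> (div v, p) = - a(r, v), Cauchy-Schwarz in \<open>a\<close> and the bound
  of \<open>a\<close> by d \<zeta>^2 |v|_1^2 limit every quotient in the supremum.\<close>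

lemma weak_inf_sup_riesz_bound:
  assumes lam: "0 \<le> lam" "0 < \<mu>" and \<alpha>: "0 < \<alpha>"
    and \<zeta>: "\<zeta> = sqrt (lam + 2 * \<mu> / real CARD('n))"
    and wis: "weak_inf_sup \<Omega> V Q \<gamma> \<xi> h" and p: "p \<in> Q" and r: "r \<in> V"
    and rep: "\<And>v. v \<in> V \<Longrightarrow> a_form \<Omega> lam \<mu> r v = - \<alpha> * dv v p"
  shows "\<gamma> * sqrt (mass_form p p) - \<xi> * h * sqrt (grad_form p p) \<le>
    sqrt (real CARD('n)) * \<zeta> * sqrt (a_form \<Omega> lam \<mu> r r) / \<alpha>"
proof -
  let ?a = "a_form \<Omega> lam \<mu>" and ?d = "real CARD('n)"
  let ?M = "sqrt ?d * \<zeta> * sqrt (?a r r) / \<alpha>"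
  have semi: "semi_inner_on V ?a" by (rule semi_inner_a[OF lam])
  have Z: "0 \<le> lam + 2 * \<mu> / ?d" using lam by simp
  have \<zeta>0: "0 \<le> \<zeta>" unfolding \<zeta> by (rule real_sqrt_ge_zero[OF Z])
  have M: "0 \<le> ?M" using \<zeta>0 \<alpha> semi_inner_nonneg[OF semi r] by simp
  have le: "dv v p / vh1_norm \<Omega> v \<le> ?M" if v: "v \<in> V" for v
  \<comment> \<open>A quotient with zero denominator has the value 0 and is covered by nonnegativity
    of the bound.\<close>
  proof (cases "vh1_norm \<Omega> v = 0")
    case True
    then show ?thesis using M by (simp only: div_by_0)
  next
    case False
    then have n: "0 < vh1_norm \<Omega> v" using vh1_norm_nonneg[of v] by linarith
    have "sqrt (?a v v) \<le> sqrt (?d * (lam + 2 * \<mu> / ?d) * (vh1_norm \<Omega> v)\<^sup>2)"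
      by (rule real_sqrt_le_mono[OF a_form_le_vh1_norm[OF lam v]])
    also have "\<dots> = sqrt ?d * \<zeta> * vh1_norm \<Omega> v"
      unfolding \<zeta> real_sqrt_mult using n by (simp only: real_sqrt_abs abs_of_pos)
    finally have av: "sqrt (?a v v) \<le> sqrt ?d * \<zeta> * vh1_norm \<Omega> v" .
    have "\<alpha> * dv v p \<le> \<bar>?a r v\<bar>" unfolding rep[OF v] by simp
    also have "\<dots> \<le> sqrt (?a r r) * sqrt (?a v v)"
      by (rule semi_inner_Cauchy_Schwarz[OF semi fun_subspace_V r v])
    also have "\<dots> \<le> sqrt (?a r r) * (sqrt ?d * \<zeta> * vh1_norm \<Omega> v)"
      by (intro mult_left_mono av real_sqrt_ge_zero semi_inner_nonneg[OF semi r])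
    finally have "\<alpha> * dv v p \<le> sqrt (?a r r) * (sqrt ?d * \<zeta> * vh1_norm \<Omega> v)" .
    then have "dv v p \<le> ?M * vh1_norm \<Omega> v" using \<alpha> by (simp add: pos_le_divide_eq mult_ac)
    then show ?thesis using n by (simp only: pos_divide_le_eq)
  qed
  have "ereal (\<gamma> * l2_norm \<Omega> p - \<xi> * h * l2_norm \<Omega> (wgrad \<Omega> p)) \<le>
    (SUP v\<in>V - {\<lambda>_. 0}. ereal (l2_inner \<Omega> (wdiv \<Omega> v) p / vh1_norm \<Omega> v))"
    using wis p unfolding weak_inf_sup_def by (rule bspec)
  also have "\<dots> \<le> ereal ?M"
  proof (rule SUP_least)
    fix v assume "v \<in> V - {\<lambda>_. 0}"
    then have "v \<in> V" by (rule DiffD1)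
    from le[OF this] show "ereal (l2_inner \<Omega> (wdiv \<Omega> v) p / vh1_norm \<Omega> v) \<le> ereal ?M"
      unfolding l2_inner_wdiv ereal_less_eq .
  qed
  finally show ?thesis unfolding l2_norm_eq ereal_less_eq .
qed

text \<open>Instance of the abstract saddle point result. Both gradient terms merge into the single
  weight \<tau> K + \<eta> h^2, and the mass form has weight (\<alpha> / \<zeta>)^2.\<close>

lemma biot_field_of_values:
  assumes lam: "0 \<le> lam" "0 < \<mu>" and pos: "0 < \<alpha>" "0 < K" "0 < h" "0 < \<tau>" "0 < \<delta>" "0 < \<gamma>" "0 \<le> \<xi>"
    and \<zeta>: "\<zeta> = sqrt (lam + 2 * \<mu> / real CARD('n))" and \<eta>: "\<eta> = \<delta> * (\<alpha>\<^sup>2 / \<zeta>\<^sup>2)"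
    and wis: "weak_inf_sup \<Omega> V Q \<gamma> \<xi> h"
    and x': "x' \<in> dual V \<times> dual Q" "x' \<noteq> (\<lambda>_. 0, \<lambda>_. 0)"
  defines "\<kappa> \<equiv> 2 * (real CARD('n) + \<xi>\<^sup>2 / \<delta>) / \<gamma>\<^sup>2"
    and "A \<equiv> biot_op \<Omega> V Q lam \<mu> \<alpha> K \<tau> \<eta> h"
    and "BU \<equiv> precond_U \<Omega> V Q lam \<mu> \<alpha> K \<tau> \<eta> h \<zeta>"
    and "BD \<equiv> precond_D \<Omega> V Q lam \<mu> \<alpha> K \<tau> \<eta> h \<zeta>"
  shows "1 / (2 * (1 + \<kappa>)) \<le> dual_inner BD (A (BU x')) x' / dual_inner BD x' x'"
    and "dual_norm BD (A (BU x')) / dual_norm BD x' \<le> 3"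
proof -
  let ?a = "a_form \<Omega> lam \<mu>" and ?k = "\<tau> * K + \<eta> * h\<^sup>2" and ?l = "\<alpha>\<^sup>2 / \<zeta>\<^sup>2"
  let ?C = "\<lambda>p q. ?k * grad_form p q" and ?m = "\<lambda>p q. ?l * mass_form p q"
  let ?c = "\<lambda>v p. - \<alpha> * dv v p"
  have Z: "0 < lam + 2 * \<mu> / real CARD('n)" using lam by (simp add: add_nonneg_pos)
  have \<zeta>pos: "0 < \<zeta>" unfolding \<zeta> by (rule real_sqrt_gt_zero[OF Z])
  have \<zeta>2: "\<zeta>\<^sup>2 = lam + 2 * \<mu> / real CARD('n)" unfolding \<zeta> by (rule real_sqrt_pow2[OF less_imp_le[OF Z]])
  have l: "0 < ?l" using pos(1) \<zeta>pos by simp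
  have \<eta>h: "0 \<le> \<eta> * h\<^sup>2" unfolding \<eta> using l pos by simp
  have k: "0 \<le> ?k" using \<eta>h pos by simp
  \<comment> \<open>A single scaled form is obtained as a combination whose other weight is
    zero.\<close>
  have semiC: "semi_inner_on Q ?C"
    using semi_inner_combination[OF semi_inner_grad semi_inner_mass k order_refl] by simp
  have semim: "semi_inner_on Q ?m"
    using semi_inner_combination[OF semi_inner_grad semi_inner_mass order_refl less_imp_le[OF l]] by simp
  have \<kappa>: "0 \<le> \<kappa>" unfolding \<kappa>_def using pos by simp
  have bound: "\<bar>?c v q\<bar> \<le> sqrt (?a v v) * sqrt (?m q q)" if v: "v \<in> V" and q: "q \<in> Q" for v q
  proof -
    have "\<zeta> * sqrt (div_form v v) = sqrt (\<zeta>\<^sup>2 * div_form v v)"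
      using \<zeta>pos by (simp only: real_sqrt_mult real_sqrt_abs abs_of_pos)
    also have "\<dots> \<le> sqrt (?a v v)"
      unfolding \<zeta>2 by (rule real_sqrt_le_mono[OF div_form_le_a_form[OF lam v]])
    finally have 1: "\<zeta> * sqrt (div_form v v) \<le> sqrt (?a v v)" .
    have "sqrt (?l) = \<alpha> / \<zeta>"
      using pos(1) \<zeta>pos by (simp only: real_sqrt_divide real_sqrt_abs abs_of_pos)
    then have 2: "sqrt (?m q q) = \<alpha> / \<zeta> * sqrt (mass_form q q)" by (simp only: real_sqrt_mult)
    have "\<bar>?c v q\<bar> = \<alpha> * \<bar>dv v q\<bar>" using pos(1) by (simp only: abs_mult abs_minus_cancel abs_of_pos)
    also have "\<dots> \<le> \<alpha> * (sqrt (div_form v v) * sqrt (mass_form q q))"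
      using pos(1) by (intro mult_left_mono dv_le[OF v q]) (rule less_imp_le)
    \<comment> \<open>The factor \<zeta> / \<zeta> is inserted so that \<zeta> joins the divergence
      and 1 / \<zeta> joins the mass norm.\<close>
    also have "\<dots> = (\<zeta> * sqrt (div_form v v)) * (\<alpha> / \<zeta> * sqrt (mass_form q q))"
      using \<zeta>pos by (simp add: field_simps)
    also have "\<dots> \<le> sqrt (?a v v) * (\<alpha> / \<zeta> * sqrt (mass_form q q))"
      using pos(1) \<zeta>pos semi_inner_nonneg[OF semi_inner_mass q]
      by (intro mult_right_mono 1 mult_nonneg_nonneg real_sqrt_ge_zero divide_nonneg_nonneg) simp_all
    finally show ?thesis unfolding 2 .
  qed
  have infsup: "?m p p \<le> \<kappa> * (?a r r + ?C p p)"
    if p: "p \<in> Q" and r: "r \<in> V" and rep: "\<And>v. v \<in> V \<Longrightarrow> ?a r v = ?c v p" for p r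
  proof -
    have mp: "0 \<le> mass_form p p" and gp: "0 \<le> grad_form p p" and ar: "0 \<le> ?a r r"
      by (rule semi_inner_nonneg[OF semi_inner_mass p], rule semi_inner_nonneg[OF semi_inner_grad p],
          rule semi_inner_nonneg[OF semi_inner_a[OF lam] r])
    have C0: "0 \<le> ?C p p" by (rule mult_nonneg_nonneg[OF k gp])
    have "0 \<le> \<tau> * K" using pos by simp
    \<comment> \<open>The diffusion part \<tau> K of the weight is discarded, so neither \<tau> nor
      K enters \<kappa>; the stabilization alone pays for the inf-sup defect.\<close>
    then have "\<eta> * h\<^sup>2 * grad_form p p \<le> ?C p p" using gp by (intro mult_right_mono) simp_all
    then have C: "\<delta> * (\<alpha>\<^sup>2 / \<zeta>\<^sup>2) * h\<^sup>2 * (sqrt (grad_form p p))\<^sup>2 \<le> ?C p p"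
      unfolding real_sqrt_pow2[OF gp] \<eta> .
    have "\<alpha>\<^sup>2 / \<zeta>\<^sup>2 * (sqrt (mass_form p p))\<^sup>2 \<le> \<kappa> * ((sqrt (?a r r))\<^sup>2 + ?C p p)"
      unfolding \<kappa>_def
      by (rule infsup_arith[OF pos(6,5,1) \<zeta>pos pos(7) of_nat_0_le_iff real_sqrt_ge_zero[OF mp]
            real_sqrt_ge_zero[OF ar] C0 weak_inf_sup_riesz_bound[OF lam pos(1) \<zeta> wis p r rep] C])
    then show ?thesis unfolding real_sqrt_pow2[OF mp] real_sqrt_pow2[OF ar] .
  qed
  let ?s = "\<lambda>p q. ?C p q + ?m p q"
  define U where "U = block (Au_op \<Omega> lam \<mu> V) (\<lambda>p v. \<alpha> * BT_op \<Omega> V Q p v) (\<lambda>u q. 0)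
    (\<lambda>p q. \<tau> * Ap_op \<Omega> K Q p q + \<eta> * h\<^sup>2 * Lp_op \<Omega> Q p q + \<alpha>\<^sup>2 / \<zeta>\<^sup>2 * M_op \<Omega> Q p q)"
  define D where "D = block (Au_op \<Omega> lam \<mu> V) (\<lambda>p v. 0) (\<lambda>u q. 0)
    (\<lambda>p q. \<tau> * Ap_op \<Omega> K Q p q + \<eta> * h\<^sup>2 * Lp_op \<Omega> Q p q + \<alpha>\<^sup>2 / \<zeta>\<^sup>2 * M_op \<Omega> Q p q)"
  have Aeq: "A (u, p) = (functional V (\<lambda>v. ?a u v + ?c v p), functional Q (\<lambda>q. - ?c u q + ?C p q))"
    if "u \<in> V" "p \<in> Q" for u p unfolding A_def by (rule biot_op_eq[OF that])
  have Ueq: "U (u, p) = (functional V (\<lambda>v. ?a u v + ?c v p), functional Q (\<lambda>q. ?s p q))"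
    if "u \<in> V" "p \<in> Q" for u p unfolding U_def by (rule precond_block_eq(1)[OF that])
  have Deq: "D (u, p) = (functional V (\<lambda>v. ?a u v), functional Q (\<lambda>q. ?s p q))"
    if "u \<in> V" "p \<in> Q" for u p unfolding D_def by (rule precond_block_eq(2)[OF that])
  have c1: "linear_fun V (\<lambda>v. ?c v p)" if "p \<in> Q" for p
    by (rule linear_fun_scale_right[OF linear_dv_left[OF that]])
  have c2: "linear_fun Q (?c v)" if "v \<in> V" for v
    by (rule linear_fun_scale_right[OF linear_dv_right[OF that]])
  note fov = saddle_point_field_of_values[where V=V and Q=Q and a="?a" and s="?s" and C="?C" and m="?m"
      and c="?c" and \<kappa>=\<kappa> and A=A and U=U and D=D and x'=x',
      OF fun_subspace_V finitely_determined_V inner_a[OF lam] Q(1) finitely_determined_Q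
      inner_s[OF k l] semiC semim refl c1 c2 bound \<kappa> infsup Aeq Ueq Deq x']
  show "1 / (2 * (1 + \<kappa>)) \<le> dual_inner BD (A (BU x')) x' / dual_inner BD x' x'"
    unfolding BU_def BD_def precond_U_def precond_D_def U_def[symmetric] D_def[symmetric] by (rule fov(1))
  show "dual_norm BD (A (BU x')) / dual_norm BD x' \<le> 3"
    unfolding BU_def BD_def precond_U_def precond_D_def U_def[symmetric] D_def[symmetric] by (rule fov(2))
qed

end

text \<open>Both spaces lie in the bubble-enriched space, from which continuity, vanishing outside
  the mesh and the determining points are inherited; the simplices lie in the closure of
  \<open>\<Omega>\<close>.\<close>

lemma fe_pair_of_mesh:
  fixes \<Omega> :: "(real^'n::finite) set"
  assumes \<Omega>: "open \<Omega>" "bounded \<Omega>" and mesh: "mesh \<Omega> \<T> h"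
    and loc: "loc = P1_local \<or> loc = P1_bubble_local"
  shows "fe_pair \<Omega> (fe_space loc \<Omega> \<T>) (pressure_space \<Omega> \<T>)"
proof -
  have fin: "finite \<T>" and sub: "\<Union>\<T> \<subseteq> closure \<Omega>"
    using mesh unfolding mesh_def triangulation_def by blast+
  have locs: "fun_subspace (loc T)" "loc T \<subseteq> P1_bubble_local T" for T
    using loc fun_subspace_P1_local fun_subspace_P1_bubble_local P1_local_subset by auto
  let ?U = "fe_space loc \<Omega> \<T> \<union> pressure_space \<Omega> \<T>"
  have U: "?U \<subseteq> fe_space P1_bubble_local \<Omega> \<T>"
    unfolding pressure_space_def
    by (rule Un_least[OF fe_space_mono[OF locs(2)] fe_space_mono[OF P1_local_subset]])
  show ?thesis
  proof
    show "open \<Omega>" "bounded \<Omega>" by (rule \<Omega>)+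
    show "fun_subspace (fe_space loc \<Omega> \<T>)" by (rule fun_subspace_fe_space[OF \<Omega> locs(1)])
    show "fun_subspace (pressure_space \<Omega> \<T>)"
      unfolding pressure_space_def by (rule fun_subspace_fe_space[OF \<Omega> fun_subspace_P1_local])
    show "fe_space loc \<Omega> \<T> \<subseteq> H10 \<Omega>" "pressure_space \<Omega> \<T> \<subseteq> H10 \<Omega>"
      unfolding pressure_space_def fe_space_def by blast+
    show "continuous_on UNIV u" if "u \<in> ?U" for u
      using subsetD[OF U that] unfolding fe_space_def by blast
    show "u x = 0" if "u \<in> ?U" "x \<notin> closure \<Omega>" for u x
      using subsetD[OF U that(1)] that(2) sub unfolding fe_space_def by blast
    obtain P where P: "finite P"
      "\<And>v. v \<in> fe_space P1_bubble_local \<Omega> \<T> \<Longrightarrow> (\<And>x. x \<in> P \<Longrightarrow> v x = 0) \<Longrightarrow> v = (\<lambda>_. 0)"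
      by (rule fe_space_determined[OF fin, of \<Omega>]) blast
    show "\<exists>P. finite P \<and> (\<forall>u\<in>?U. (\<forall>x\<in>P. u x = 0) \<longrightarrow> u = (\<lambda>_. 0))"
    proof (intro exI[of _ P] conjI P(1) ballI impI)
      fix u assume "u \<in> ?U" "\<forall>x\<in>P. u x = 0"
      then show "u = (\<lambda>_. 0)" using P(2)[OF subsetD[OF U]] by blast
    qed
  qed
qed

theorem theorem6:
  fixes \<gamma> \<xi> \<delta> :: real
  assumes "CARD('n::finite) \<in> {2, 3}" and "\<gamma> > 0" and "\<xi> \<ge> 0" and "\<delta> > 0"
  shows "\<exists>\<Sigma> > 0. \<exists>\<Upsilon> > 0.
    \<forall>(\<Omega> :: (real^'n) set) \<T> el V Q h \<tau> lam \<mu> \<alpha> K \<zeta> \<eta> \<A> \<B>\<^sub>U \<B>\<^sub>D.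
      bounded \<Omega> \<and> open \<Omega> \<and> lipschitz_boundary \<Omega> \<and>
      lam \<ge> 0 \<and> \<mu> > 0 \<and> \<alpha> > 0 \<and> K > 0 \<and> h > 0 \<and> \<tau> > 0 \<and>
      mesh \<Omega> \<T> h \<and> V = displacement_space el \<Omega> \<T> \<and> Q = pressure_space \<Omega> \<T> \<and>
      weak_inf_sup \<Omega> V Q \<gamma> \<xi> h \<and> (el = Mini \<longrightarrow> \<xi> = 0) \<and>
      \<zeta> = sqrt (lam + 2 * \<mu> / real CARD('n)) \<and> \<eta> = \<delta> * (\<alpha>\<^sup>2 / \<zeta>\<^sup>2) \<and>
      \<A> = biot_op \<Omega> V Q lam \<mu> \<alpha> K \<tau> \<eta> h \<and>
      \<B>\<^sub>U = precond_U \<Omega> V Q lam \<mu> \<alpha> K \<tau> \<eta> h \<zeta> \<and>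
      \<B>\<^sub>D = precond_D \<Omega> V Q lam \<mu> \<alpha> K \<tau> \<eta> h \<zeta> \<longrightarrow>
      (\<forall>x' \<in> dual V \<times> dual Q. x' \<noteq> (\<lambda>_. 0, \<lambda>_. 0) \<longrightarrow>
         \<Sigma> \<le> dual_inner \<B>\<^sub>D (\<A> (\<B>\<^sub>U x')) x' / dual_inner \<B>\<^sub>D x' x' \<and>
         dual_norm \<B>\<^sub>D (\<A> (\<B>\<^sub>U x')) / dual_norm \<B>\<^sub>D x' \<le> \<Upsilon>)"
proof -
  \<comment> \<open>Only the dimension, \<xi>, \<delta> and \<gamma> occur here, and
    \<open>\<kappa>\<close> is fixed before the domain, the mesh and the physical parameters are
    introduced; this is the claimed independence.\<close>
  define \<kappa> where "\<kappa> = 2 * (real CARD('n) + \<xi>\<^sup>2 / \<delta>) / \<gamma>\<^sup>2"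
  have "0 \<le> \<kappa>" unfolding \<kappa>_def using assms(4) by simp
  then have \<Sigma>: "0 < 1 / (2 * (1 + \<kappa>))" by simp
  show ?thesis
  proof (rule exI[of _ "1 / (2 * (1 + \<kappa>))"], rule conjI[OF \<Sigma>], rule exI[of _ 3],
      rule conjI[OF zero_less_numeral], intro allI impI ballI, elim conjE)
    fix \<Omega> :: "(real^'n) set" and \<T> el V Q and h \<tau> lam \<mu> \<alpha> K \<zeta> \<eta> :: real and \<A> \<B>\<^sub>U \<B>\<^sub>D x'
    assume \<Omega>: "bounded \<Omega>" "open \<Omega>"
      and par: "lam \<ge> 0" "\<mu> > 0" "\<alpha> > 0" "K > 0" "h > 0" "\<tau> > 0"
      and mesh: "mesh \<Omega> \<T> h" and V: "V = displacement_space el \<Omega> \<T>" and Q: "Q = pressure_space \<Omega> \<T>"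
      and wis: "weak_inf_sup \<Omega> V Q \<gamma> \<xi> h"
      and \<zeta>: "\<zeta> = sqrt (lam + 2 * \<mu> / real CARD('n))" and \<eta>: "\<eta> = \<delta> * (\<alpha>\<^sup>2 / \<zeta>\<^sup>2)"
      and ops: "\<A> = biot_op \<Omega> V Q lam \<mu> \<alpha> K \<tau> \<eta> h" "\<B>\<^sub>U = precond_U \<Omega> V Q lam \<mu> \<alpha> K \<tau> \<eta> h \<zeta>"
        "\<B>\<^sub>D = precond_D \<Omega> V Q lam \<mu> \<alpha> K \<tau> \<eta> h \<zeta>"
      and x': "x' \<in> dual V \<times> dual Q" "x' \<noteq> (\<lambda>_. 0, \<lambda>_. 0)"
    define loc :: "(real^'n) set \<Rightarrow> (real^'n \<Rightarrow> real) set"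
      where "loc = (case el of P1_P1 \<Rightarrow> P1_local | Mini \<Rightarrow> P1_bubble_local)"
    have loc: "loc = P1_local \<or> loc = P1_bubble_local" unfolding loc_def by (cases el) simp_all
    \<comment> \<open>The choice of element affects only the scalar space of the displacement
      components; the vector space built from it in the locale is the given
      \<open>V\<close>.\<close>
    interpret fe: fe_pair \<Omega> "fe_space loc \<Omega> \<T>" Q
      unfolding Q by (rule fe_pair_of_mesh[OF \<Omega>(2,1) mesh loc])
    have VV: "V = fe.V"
      unfolding V displacement_space_def fe.V_def unfolding loc_def by (cases el) simp_all
    note fov = fe.biot_field_of_values[OF par(1,2,3,4,5,6) assms(4,2,3) \<zeta> \<eta> wis[unfolded VV] x'(1)[unfolded VV] x'(2)]
    show "1 / (2 * (1 + \<kappa>)) \<le> dual_inner \<B>\<^sub>D (\<A> (\<B>\<^sub>U x')) x' / dual_inner \<B>\<^sub>D x' x' \<and>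
      dual_norm \<B>\<^sub>D (\<A> (\<B>\<^sub>U x')) / dual_norm \<B>\<^sub>D x' \<le> 3"
      unfolding ops VV \<kappa>_def by (rule conjI[OF fov])
  qed
qed

end
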